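(* Let $\Lambda_\bullet,\Omega_\bullet$ be two $1$-cells in $\mathbf{UC}$ from $\Gamma_\bullet$ to $\Delta_\bullet$, with associated right correspondences ${}_{A_\infty}(H_\infty)_{B_\infty}$ and ${}_{A_\infty}(G_\infty)_{B_\infty}$. Given a $2$-cell $\{\eta^{(k)}\in\mathrm{NT}(\Lambda_k,\Omega_k)\}_{k\ge K}$ from $\Lambda_\bullet$ to $\Omega_\bullet$ (so every consecutive pair $(\eta^{(k)},\eta^{(k+1)})$, $k\ge K$, satisfies the exchange relation), the operator $\Phi_{\eta^{(k)}_{\Gamma_k\cdots\Gamma_1m_0}}$ is an intertwiner in ${}_{A_\infty}\mathcal L_{B_\infty}(H_\infty,G_\infty)$ and is independent of $k\ge K$. Conversely, for every $T\in{}_{A_\infty}\mathcal L_{B_\infty}(H_\infty,G_\infty)$ and for all $k\ge K_T:=\min\{l:TH_0\subset G_l\}$ there exists a unique $\eta^{(k)}\in\mathrm{NT}(\Lambda_k,\Omega_k)$ such that $T=\Phi_{\eta^{(k)}_{\Gamma_k\cdots\Gamma_1m_0}}$. Further, $(\eta^{(k)},\eta^{(k+1)})$ satisfies the exchange relation for all $k\ge K_T$.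
   Context: **Conventions.** A finite semisimple C*-category is a semisimple C*-category (finite-dimensional morphism spaces, closed under finite direct sums and subobjects) with finitely many isomorphism classes of simple objects; $V_{\mathcal M}$ is a set of representatives of the simple objects of $\mathcal M$. A $*$-linear functor is bi-faithful if it and its adjoint are faithful. Composition of functors is juxtaposition; $\mathrm{NT}(F,G)$ is the space of natural linear transformations; $F(\eta)$, $\eta_F$ are whiskerings. **0- and 1-cells of $\mathbf{UC}$.** A 0-cell $\Gamma_\bullet$ is a sequence of $*$-linear bi-faithful functors $\Gamma_k:\mathcal M_{k-1}\to\mathcal M_k$ ($k\ge1$) between finite semisimple C*-categories. Put $m_0=\bigoplus_{v\in V_{\mathcal M_0}}v$, $A_k=\mathrm{End}(\Gamma_k\cdots\Gamma_1m_0)$ with unital inclusions $A_{k-1}\ni\alpha\mapsto\Gamma_k\alpha\in A_k$, $A_\infty=\bigcup_kA_k$. A 1-cell $\Lambda_\bullet=(\Lambda_\bullet,W^\Lambda_\bullet)$ from $\Gamma_\bullet$ to $\Delta_\bullet=\{\Delta_k:\mathcal N_{k-1}\to\mathcal N_k\}_{k\ge1}$ consists of $*$-linear bi-faithful functors $\Lambda_k:\mathcal M_k\to\mathcal N_k$ ($k\ge0$) and natural unitaries $W^\Lambda_k:\Delta_k\Lambda_{k-1}\to\Lambda_k\Gamma_k$ ($k\ge1$). Let $n_0,B_k,B_\infty$ be associated to $\Delta_\bullet$ as $m_0,A_k,A_\infty$ are to $\Gamma_\bullet$. **Right correspondences.** $H_k=\mathcal N_k(\Delta_k\cdots\Delta_1n_0,\Lambda_k\Gamma_k\cdots\Gamma_1m_0)$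 with actions $\alpha\cdot\xi\cdot\beta=\Lambda_k(\alpha)\circ\xi\circ\beta$ ($\alpha\in A_k,\beta\in B_k$), $B_k$-valued inner product $\langle\xi,\zeta\rangle_{B_k}=\zeta^*\circ\xi$, and inclusions $H_k\ni\xi\mapsto(W^\Lambda_{k+1})_{\Gamma_k\cdots\Gamma_1m_0}\circ\Delta_{k+1}\xi\in H_{k+1}$; these are compatible, and $H_\infty=\bigcup_kH_k$ is an $A_\infty$-$B_\infty$ right correspondence. $G_k,G_\infty$ are defined likewise from $\Omega_\bullet$. ${}_{A_\infty}\mathcal L_{B_\infty}(H_\infty,G_\infty)$ is the space of $A_\infty$-$B_\infty$-linear maps adjointable with respect to the $B_\infty$-valued inner products. **The operators $\Phi_\gamma$.** Write $x_k=\Gamma_k\cdots\Gamma_1m_0$. For $\gamma\in\mathcal N_k(\Lambda_kx_k,\Omega_kx_k)$ put $\gamma_0=\gamma$, $\gamma_{j+1}=(W^\Omega_{k+j+1})_{x_{k+j}}\circ\Delta_{k+j+1}(\gamma_j)\circ(W^\Lambda_{k+j+1})^*_{x_{k+j}}\in\mathcal N_{k+j+1}(\Lambda_{k+j+1}x_{k+j+1},\Omega_{k+j+1}x_{k+j+1})$. Then $\Phi_\gamma:H_\infty\to G_\infty$ is the (well-defined) map $\Phi_\gamma(\xi)=\gamma_l\circ\xi\in G_{k+l}$ for $\xi\in H_{k+l}$, $l\ge0$. **Exchange relation.** $(\eta,\kappa)\in\mathrm{NT}(\Lambda_k,\Omega_k)\times\mathrm{NT}(\Lambda_{k+1},\Omega_{k+1})$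 satisfies the exchange relation if $W^\Omega_{k+1}\circ\Delta_{k+1}(\eta)=\kappa_{\Gamma_{k+1}}\circ W^\Lambda_{k+1}$. **2-cells.** $\mathbf{UC}_2(\Lambda_\bullet,\Omega_\bullet)$ is the space of sequences $\{\eta^{(k)}\in\mathrm{NT}(\Lambda_k,\Omega_k)\}_{k\ge0}$ for which consecutive pairs eventually satisfy the exchange relation, modulo the sequences which are eventually zero. A class is written as a truncated representative $\{\eta^{(k)}\}_{k\ge K}$ for which all consecutive pairs with $k\ge K$ satisfy the exchange relation. *)

theory Defs
  imports Complex_Main "HOL-Library.FuncSet"
begin

section \<open>C*-categories\<close>

text \<open>Composition is written in the usual order: \<open>g \<cdot> f\<close> is \<open>g\<close> after \<open>f\<close>.\<close>

record ('o, 'm) ccat =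
  Obj :: "'o set"
  Hom :: "'o \<Rightarrow> 'o \<Rightarrow> 'm set"
  ident :: "'o \<Rightarrow> 'm"
  cmp :: "'m \<Rightarrow> 'm \<Rightarrow> 'm" (infixl "\<cdot>\<index>" 70)
  hzero :: "'o \<Rightarrow> 'o \<Rightarrow> 'm"
  hadd :: "'m \<Rightarrow> 'm \<Rightarrow> 'm"
  hscale :: "complex \<Rightarrow> 'm \<Rightarrow> 'm"
  hadj :: "'m \<Rightarrow> 'm"
  hnorm :: "'m \<Rightarrow> real"

text \<open>Morphism spaces are pairwise disjoint (\<open>hom_disjoint\<close>), so that every morphism has a
  well-defined source and target; only the zero morphism needs them as arguments.\<close>

locale cstar_category =
  fixes C :: "('o, 'm) ccat" (structure)
  assumes hom_disjoint:
      "\<lbrakk>x \<in> Obj C; y \<in> Obj C; x' \<in> Obj C; y' \<in> Obj C; f \<in> Hom C x y; f \<in> Hom C x' y'\<rbrakk>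
        \<Longrightarrow> x = x' \<and> y = y'"
    and id_in: "x \<in> Obj C \<Longrightarrow> ident C x \<in> Hom C x x"
    and cmp_in: "\<lbrakk>x \<in> Obj C; y \<in> Obj C; z \<in> Obj C; f \<in> Hom C x y; g \<in> Hom C y z\<rbrakk>
        \<Longrightarrow> g \<cdot> f \<in> Hom C x z"
    and cmp_id_right: "\<lbrakk>x \<in> Obj C; y \<in> Obj C; f \<in> Hom C x y\<rbrakk> \<Longrightarrow> f \<cdot> ident C x = f"
    and cmp_id_left: "\<lbrakk>x \<in> Obj C; y \<in> Obj C; f \<in> Hom C x y\<rbrakk> \<Longrightarrow> ident C y \<cdot> f = f"
    and cmp_assoc: "\<lbrakk>w \<in> Obj C; x \<in> Obj C; y \<in> Obj C; z \<in> Obj C;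
        f \<in> Hom C w x; g \<in> Hom C x y; h \<in> Hom C y z\<rbrakk> \<Longrightarrow> (h \<cdot> g) \<cdot> f = h \<cdot> (g \<cdot> f)"
    and zero_in: "\<lbrakk>x \<in> Obj C; y \<in> Obj C\<rbrakk> \<Longrightarrow> hzero C x y \<in> Hom C x y"
    and add_in: "\<lbrakk>x \<in> Obj C; y \<in> Obj C; f \<in> Hom C x y; g \<in> Hom C x y\<rbrakk>
        \<Longrightarrow> hadd C f g \<in> Hom C x y"
    and scale_in: "\<lbrakk>x \<in> Obj C; y \<in> Obj C; f \<in> Hom C x y\<rbrakk> \<Longrightarrow> hscale C c f \<in> Hom C x y"
    and add_assoc: "\<lbrakk>x \<in> Obj C; y \<in> Obj C; f \<in> Hom C x y; g \<in> Hom C x y; h \<in> Hom C x y\<rbrakk>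
        \<Longrightarrow> hadd C (hadd C f g) h = hadd C f (hadd C g h)"
    and add_commute: "\<lbrakk>x \<in> Obj C; y \<in> Obj C; f \<in> Hom C x y; g \<in> Hom C x y\<rbrakk>
        \<Longrightarrow> hadd C f g = hadd C g f"
    and add_zero: "\<lbrakk>x \<in> Obj C; y \<in> Obj C; f \<in> Hom C x y\<rbrakk> \<Longrightarrow> hadd C f (hzero C x y) = f"
    and add_minus: "\<lbrakk>x \<in> Obj C; y \<in> Obj C; f \<in> Hom C x y\<rbrakk>
        \<Longrightarrow> hadd C f (hscale C (- 1) f) = hzero C x y"
    and scale_one: "\<lbrakk>x \<in> Obj C; y \<in> Obj C; f \<in> Hom C x y\<rbrakk> \<Longrightarrow> hscale C 1 f = f"
    and scale_scale: "\<lbrakk>x \<in> Obj C; y \<in> Obj C; f \<in> Hom C x y\<rbrakk>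
        \<Longrightarrow> hscale C a (hscale C b f) = hscale C (a * b) f"
    and scale_add_left: "\<lbrakk>x \<in> Obj C; y \<in> Obj C; f \<in> Hom C x y\<rbrakk>
        \<Longrightarrow> hscale C (a + b) f = hadd C (hscale C a f) (hscale C b f)"
    and scale_add_right: "\<lbrakk>x \<in> Obj C; y \<in> Obj C; f \<in> Hom C x y; g \<in> Hom C x y\<rbrakk>
        \<Longrightarrow> hscale C a (hadd C f g) = hadd C (hscale C a f) (hscale C a g)"
    and cmp_add_left: "\<lbrakk>x \<in> Obj C; y \<in> Obj C; z \<in> Obj C;
        f \<in> Hom C x y; g \<in> Hom C y z; h \<in> Hom C y z\<rbrakk>
        \<Longrightarrow> hadd C g h \<cdot> f = hadd C (g \<cdot> f) (h \<cdot> f)"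
    and cmp_add_right: "\<lbrakk>x \<in> Obj C; y \<in> Obj C; z \<in> Obj C;
        f \<in> Hom C x y; g \<in> Hom C x y; h \<in> Hom C y z\<rbrakk>
        \<Longrightarrow> h \<cdot> hadd C f g = hadd C (h \<cdot> f) (h \<cdot> g)"
    and cmp_scale_left: "\<lbrakk>x \<in> Obj C; y \<in> Obj C; z \<in> Obj C; f \<in> Hom C x y; g \<in> Hom C y z\<rbrakk>
        \<Longrightarrow> hscale C a g \<cdot> f = hscale C a (g \<cdot> f)"
    and cmp_scale_right: "\<lbrakk>x \<in> Obj C; y \<in> Obj C; z \<in> Obj C; f \<in> Hom C x y; g \<in> Hom C y z\<rbrakk>
        \<Longrightarrow> g \<cdot> hscale C a f = hscale C a (g \<cdot> f)"
    and adj_in: "\<lbrakk>x \<in> Obj C; y \<in> Obj C; f \<in> Hom C x y\<rbrakk> \<Longrightarrow> hadj C f \<in> Hom C y x"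
    and adj_adj: "\<lbrakk>x \<in> Obj C; y \<in> Obj C; f \<in> Hom C x y\<rbrakk> \<Longrightarrow> hadj C (hadj C f) = f"
    and adj_cmp: "\<lbrakk>x \<in> Obj C; y \<in> Obj C; z \<in> Obj C; f \<in> Hom C x y; g \<in> Hom C y z\<rbrakk>
        \<Longrightarrow> hadj C (g \<cdot> f) = hadj C f \<cdot> hadj C g"
    and adj_add: "\<lbrakk>x \<in> Obj C; y \<in> Obj C; f \<in> Hom C x y; g \<in> Hom C x y\<rbrakk>
        \<Longrightarrow> hadj C (hadd C f g) = hadd C (hadj C f) (hadj C g)"
    and adj_scale: "\<lbrakk>x \<in> Obj C; y \<in> Obj C; f \<in> Hom C x y\<rbrakk>
        \<Longrightarrow> hadj C (hscale C a f) = hscale C (cnj a) (hadj C f)"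
    and norm_nonneg: "\<lbrakk>x \<in> Obj C; y \<in> Obj C; f \<in> Hom C x y\<rbrakk> \<Longrightarrow> 0 \<le> hnorm C f"
    and norm_eq_zero: "\<lbrakk>x \<in> Obj C; y \<in> Obj C; f \<in> Hom C x y\<rbrakk>
        \<Longrightarrow> hnorm C f = 0 \<longleftrightarrow> f = hzero C x y"
    and norm_triangle: "\<lbrakk>x \<in> Obj C; y \<in> Obj C; f \<in> Hom C x y; g \<in> Hom C x y\<rbrakk>
        \<Longrightarrow> hnorm C (hadd C f g) \<le> hnorm C f + hnorm C g"
    and norm_scale: "\<lbrakk>x \<in> Obj C; y \<in> Obj C; f \<in> Hom C x y\<rbrakk>
        \<Longrightarrow> hnorm C (hscale C a f) = cmod a * hnorm C f"
    and norm_complete: "\<lbrakk>x \<in> Obj C; y \<in> Obj C; \<And>n::nat. s n \<in> Hom C x y;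
        \<And>e::real. e > 0 \<Longrightarrow>
          \<exists>n0. \<forall>m\<ge>n0. \<forall>n\<ge>n0. hnorm C (hadd C (s m) (hscale C (- 1) (s n))) < e\<rbrakk>
        \<Longrightarrow> \<exists>f\<in>Hom C x y. (\<lambda>n. hnorm C (hadd C (s n) (hscale C (- 1) f))) \<longlonglongrightarrow> 0"
    and norm_cmp: "\<lbrakk>x \<in> Obj C; y \<in> Obj C; z \<in> Obj C; f \<in> Hom C x y; g \<in> Hom C y z\<rbrakk>
        \<Longrightarrow> hnorm C (g \<cdot> f) \<le> hnorm C g * hnorm C f"
    and cstar_identity: "\<lbrakk>x \<in> Obj C; y \<in> Obj C; f \<in> Hom C x y\<rbrakk>
        \<Longrightarrow> hnorm C (hadj C f \<cdot> f) = (hnorm C f)\<^sup>2"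
    and adj_cmp_positive: "\<lbrakk>x \<in> Obj C; y \<in> Obj C; f \<in> Hom C x y\<rbrakk>
        \<Longrightarrow> \<exists>g\<in>Hom C x x. hadj C f \<cdot> f = hadj C g \<cdot> g"

definition hsum :: "('o, 'm) ccat \<Rightarrow> 'o \<Rightarrow> 'o \<Rightarrow> 'm list \<Rightarrow> 'm" where
  "hsum C x y fs = foldr (hadd C) fs (hzero C x y)"

definition fin_dim_hom :: "('o, 'm) ccat \<Rightarrow> 'o \<Rightarrow> 'o \<Rightarrow> bool" where
  "fin_dim_hom C x y \<longleftrightarrow>
     (\<exists>bs. set bs \<subseteq> Hom C x y \<and>
        (\<forall>f\<in>Hom C x y. \<exists>cs. length cs = length bs \<and> f = hsum C x y (map2 (hscale C) cs bs)))"

text \<open>\<open>z\<close> is an orthogonal direct sum of the list \<open>xs\<close> of objects; for the empty list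
  this says that \<open>z\<close> is a zero object.\<close>

definition is_dsum :: "('o, 'm) ccat \<Rightarrow> 'o list \<Rightarrow> 'o \<Rightarrow> bool" where
  "is_dsum C xs z \<longleftrightarrow> z \<in> Obj C \<and>
     (\<exists>us. length us = length xs \<and>
        (\<forall>i<length xs. us ! i \<in> Hom C (xs ! i) z) \<and>
        (\<forall>i<length xs. \<forall>j<length xs. hadj C (us ! i) \<cdot>\<^bsub>C\<^esub> us ! j =
            (if i = j then ident C (xs ! i) else hzero C (xs ! j) (xs ! i))) \<and>
        hsum C z z (map (\<lambda>u. u \<cdot>\<^bsub>C\<^esub> hadj C u) us) = ident C z)"

definition is_dsum_set :: "('o, 'm) ccat \<Rightarrow> 'o set \<Rightarrow> 'o \<Rightarrow> bool" where
  "is_dsum_set C V z \<longleftrightarrow> (\<exists>vs. distinct vs \<and> set vs = V \<and> is_dsum C vs z)"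

definition isomorphic :: "('o, 'm) ccat \<Rightarrow> 'o \<Rightarrow> 'o \<Rightarrow> bool" where
  "isomorphic C x y \<longleftrightarrow>
     (\<exists>f\<in>Hom C x y. \<exists>g\<in>Hom C y x. g \<cdot>\<^bsub>C\<^esub> f = ident C x \<and> f \<cdot>\<^bsub>C\<^esub> g = ident C y)"

text \<open>An object is simple if its endomorphism algebra is one-dimensional.\<close>

definition simple_obj :: "('o, 'm) ccat \<Rightarrow> 'o \<Rightarrow> bool" where
  "simple_obj C x \<longleftrightarrow> x \<in> Obj C \<and> ident C x \<noteq> hzero C x x \<and>
     Hom C x x = range (\<lambda>c. hscale C c (ident C x))"

definition simple_reps :: "('o, 'm) ccat \<Rightarrow> 'o set \<Rightarrow> bool" where
  "simple_reps C V \<longleftrightarrow>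
     (\<forall>v\<in>V. simple_obj C v) \<and> (\<forall>x. simple_obj C x \<longrightarrow> (\<exists>!v. v \<in> V \<and> isomorphic C x v))"

locale finite_semisimple = cstar_category C for C :: "('o, 'm) ccat" (structure) +
  assumes fin_dim: "\<lbrakk>x \<in> Obj C; y \<in> Obj C\<rbrakk> \<Longrightarrow> fin_dim_hom C x y"
    and dsums: "set xs \<subseteq> Obj C \<Longrightarrow> \<exists>z. is_dsum C xs z"
    and subobjects: "\<lbrakk>x \<in> Obj C; p \<in> Hom C x x; p \<cdot> p = p; hadj C p = p\<rbrakk>
        \<Longrightarrow> \<exists>y\<in>Obj C. \<exists>u\<in>Hom C y x. hadj C u \<cdot> u = ident C y \<and> u \<cdot> hadj C u = p"
    and finitely_many_simples: "\<exists>V. finite V \<and> simple_reps C V"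

section \<open>Functors and natural transformations\<close>

record ('o, 'm, 'p, 'n) fctr =
  fob :: "'o \<Rightarrow> 'p"
  far :: "'m \<Rightarrow> 'n"

definition fid :: "('o, 'm, 'o, 'm) fctr" where
  "fid = \<lparr>fob = (\<lambda>x. x), far = (\<lambda>f. f)\<rparr>"

definition fcomp ::
  "('p, 'n, 'q, 'r) fctr \<Rightarrow> ('o, 'm, 'p, 'n) fctr \<Rightarrow> ('o, 'm, 'q, 'r) fctr" where
  "fcomp F G = \<lparr>fob = fob F \<circ> fob G, far = far F \<circ> far G\<rparr>"

locale star_functor =
  fixes C :: "('o, 'm) ccat" and D :: "('p, 'n) ccat" and F :: "('o, 'm, 'p, 'n) fctr"
  assumes fob_in: "x \<in> Obj C \<Longrightarrow> fob F x \<in> Obj D"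
    and far_in: "\<lbrakk>x \<in> Obj C; y \<in> Obj C; f \<in> Hom C x y\<rbrakk> \<Longrightarrow> far F f \<in> Hom D (fob F x) (fob F y)"
    and far_id: "x \<in> Obj C \<Longrightarrow> far F (ident C x) = ident D (fob F x)"
    and far_cmp: "\<lbrakk>x \<in> Obj C; y \<in> Obj C; z \<in> Obj C; f \<in> Hom C x y; g \<in> Hom C y z\<rbrakk>
        \<Longrightarrow> far F (g \<cdot>\<^bsub>C\<^esub> f) = far F g \<cdot>\<^bsub>D\<^esub> far F f"
    and far_add: "\<lbrakk>x \<in> Obj C; y \<in> Obj C; f \<in> Hom C x y; g \<in> Hom C x y\<rbrakk>
        \<Longrightarrow> far F (hadd C f g) = hadd D (far F f) (far F g)"
    and far_scale: "\<lbrakk>x \<in> Obj C; y \<in> Obj C; f \<in> Hom C x y\<rbrakk>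
        \<Longrightarrow> far F (hscale C a f) = hscale D a (far F f)"
    and far_adj: "\<lbrakk>x \<in> Obj C; y \<in> Obj C; f \<in> Hom C x y\<rbrakk> \<Longrightarrow> far F (hadj C f) = hadj D (far F f)"

definition faithful :: "('o, 'm) ccat \<Rightarrow> ('o, 'm, 'p, 'n) fctr \<Rightarrow> bool" where
  "faithful C F \<longleftrightarrow> (\<forall>x\<in>Obj C. \<forall>y\<in>Obj C. inj_on (far F) (Hom C x y))"

text \<open>Natural transformations are extensional families indexed by the objects of \<open>C\<close>, so
  that equality in \<open>NT C D F G\<close> is equality of all components.\<close>

definition NT :: "('o, 'm) ccat \<Rightarrow> ('p, 'n) ccat \<Rightarrow>
    ('o, 'm, 'p, 'n) fctr \<Rightarrow> ('o, 'm, 'p, 'n) fctr \<Rightarrow> ('o \<Rightarrow> 'n) set" where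
  "NT C D F G = {\<eta> \<in> (\<Pi>\<^sub>E x\<in>Obj C. Hom D (fob F x) (fob G x)).
     \<forall>x\<in>Obj C. \<forall>y\<in>Obj C. \<forall>f\<in>Hom C x y. \<eta> y \<cdot>\<^bsub>D\<^esub> far F f = far G f \<cdot>\<^bsub>D\<^esub> \<eta> x}"

definition natural_unitary :: "('o, 'm) ccat \<Rightarrow> ('p, 'n) ccat \<Rightarrow>
    ('o, 'm, 'p, 'n) fctr \<Rightarrow> ('o, 'm, 'p, 'n) fctr \<Rightarrow> ('o \<Rightarrow> 'n) \<Rightarrow> bool" where
  "natural_unitary C D F G w \<longleftrightarrow> w \<in> NT C D F G \<and>
     (\<forall>x\<in>Obj C. hadj D (w x) \<cdot>\<^bsub>D\<^esub> w x = ident D (fob F x) \<and>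
                w x \<cdot>\<^bsub>D\<^esub> hadj D (w x) = ident D (fob G x))"

text \<open>Unit, counit and the triangle identities. For *-functors the adjoints of the unit and the
  counit exhibit \<open>G\<close> as an adjoint of \<open>F\<close> on the other side as well, so there
  is no distinction between left and right adjoints.\<close>

definition is_adjoint :: "('o, 'm) ccat \<Rightarrow> ('p, 'n) ccat \<Rightarrow>
    ('o, 'm, 'p, 'n) fctr \<Rightarrow> ('p, 'n, 'o, 'm) fctr \<Rightarrow> bool" where
  "is_adjoint C D F G \<longleftrightarrow> star_functor D C G \<and>
     (\<exists>\<eta>\<in>NT C C fid (fcomp G F). \<exists>\<epsilon>\<in>NT D D (fcomp F G) fid.
        (\<forall>x\<in>Obj C. \<epsilon> (fob F x) \<cdot>\<^bsub>D\<^esub> far F (\<eta> x) = ident D (fob F x)) \<and>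
        (\<forall>y\<in>Obj D. far G (\<epsilon> y) \<cdot>\<^bsub>C\<^esub> \<eta> (fob G y) = ident C (fob G y)))"

definition bi_faithful :: "('o, 'm) ccat \<Rightarrow> ('p, 'n) ccat \<Rightarrow> ('o, 'm, 'p, 'n) fctr \<Rightarrow> bool" where
  "bi_faithful C D F \<longleftrightarrow> star_functor C D F \<and> faithful C F \<and>
     (\<exists>G. is_adjoint C D F G \<and> faithful D G)"

section \<open>The 0-, 1- and 2-cells of \<open>UC\<close>\<close>

text \<open>\<open>step \<Gamma> k\<close>, \<open>conn \<Lambda> k\<close> are only meaningful for \<open>k \<ge> 1\<close>:
  \<open>step \<Gamma> k\<close> is a functor from \<open>cat \<Gamma> (k - 1)\<close> to \<open>cat \<Gamma> k\<close>.
  That all categories of a 0-cell share the types of objects and morphisms is no restriction, as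
  countably many types embed into one.\<close>

record ('o, 'm) zcell =
  cat :: "nat \<Rightarrow> ('o, 'm) ccat"
  step :: "nat \<Rightarrow> ('o, 'm, 'o, 'm) fctr"

record ('o, 'm, 'p, 'n) ocell =
  fun1 :: "nat \<Rightarrow> ('o, 'm, 'p, 'n) fctr"
  conn :: "nat \<Rightarrow> 'o \<Rightarrow> 'n"

definition zero_cell :: "('o, 'm) zcell \<Rightarrow> bool" where
  "zero_cell \<Gamma> \<longleftrightarrow> (\<forall>k. finite_semisimple (cat \<Gamma> k)) \<and>
     (\<forall>k\<ge>1. bi_faithful (cat \<Gamma> (k - 1)) (cat \<Gamma> k) (step \<Gamma> k))"

definition one_cell ::
  "('o, 'm) zcell \<Rightarrow> ('p, 'n) zcell \<Rightarrow> ('o, 'm, 'p, 'n) ocell \<Rightarrow> bool" where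
  "one_cell \<Gamma> \<Delta> \<Lambda> \<longleftrightarrow>
     (\<forall>k. bi_faithful (cat \<Gamma> k) (cat \<Delta> k) (fun1 \<Lambda> k)) \<and>
     (\<forall>k\<ge>1. natural_unitary (cat \<Gamma> (k - 1)) (cat \<Delta> k)
        (fcomp (step \<Delta> k) (fun1 \<Lambda> (k - 1))) (fcomp (fun1 \<Lambda> k) (step \<Gamma> k)) (conn \<Lambda> k))"

definition exchange :: "('o, 'm) zcell \<Rightarrow> ('p, 'n) zcell \<Rightarrow>
    ('o, 'm, 'p, 'n) ocell \<Rightarrow> ('o, 'm, 'p, 'n) ocell \<Rightarrow> nat \<Rightarrow>
    ('o \<Rightarrow> 'n) \<Rightarrow> ('o \<Rightarrow> 'n) \<Rightarrow> bool" where
  "exchange \<Gamma> \<Delta> \<Lambda> \<Omega> k \<eta> \<kappa> \<longleftrightarrow>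
     (\<forall>x\<in>Obj (cat \<Gamma> k).
        conn \<Omega> (k + 1) x \<cdot>\<^bsub>cat \<Delta> (k + 1)\<^esub> far (step \<Delta> (k + 1)) (\<eta> x) =
        \<kappa> (fob (step \<Gamma> (k + 1)) x) \<cdot>\<^bsub>cat \<Delta> (k + 1)\<^esub> conn \<Lambda> (k + 1) x)"

definition nt_space :: "('o, 'm) zcell \<Rightarrow> ('p, 'n) zcell \<Rightarrow>
    ('o, 'm, 'p, 'n) ocell \<Rightarrow> ('o, 'm, 'p, 'n) ocell \<Rightarrow> nat \<Rightarrow> ('o \<Rightarrow> 'n) set" where
  "nt_space \<Gamma> \<Delta> \<Lambda> \<Omega> k = NT (cat \<Gamma> k) (cat \<Delta> k) (fun1 \<Lambda> k) (fun1 \<Omega> k)"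

definition two_cell_seqs :: "('o, 'm) zcell \<Rightarrow> ('p, 'n) zcell \<Rightarrow>
    ('o, 'm, 'p, 'n) ocell \<Rightarrow> ('o, 'm, 'p, 'n) ocell \<Rightarrow> (nat \<Rightarrow> 'o \<Rightarrow> 'n) set" where
  "two_cell_seqs \<Gamma> \<Delta> \<Lambda> \<Omega> =
     {\<eta>. (\<forall>k. \<eta> k \<in> nt_space \<Gamma> \<Delta> \<Lambda> \<Omega> k) \<and>
         (\<forall>\<^sub>F k in sequentially. exchange \<Gamma> \<Delta> \<Lambda> \<Omega> k (\<eta> k) (\<eta> (k + 1)))}"

text \<open>Two sequences agree modulo the eventually zero ones iff they are eventually equal.\<close>

definition two_cells :: "('o, 'm) zcell \<Rightarrow> ('p, 'n) zcell \<Rightarrow>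
    ('o, 'm, 'p, 'n) ocell \<Rightarrow> ('o, 'm, 'p, 'n) ocell \<Rightarrow> (nat \<Rightarrow> 'o \<Rightarrow> 'n) set set" where
  "two_cells \<Gamma> \<Delta> \<Lambda> \<Omega> = two_cell_seqs \<Gamma> \<Delta> \<Lambda> \<Omega> //
     {(\<eta>, \<theta>). \<eta> \<in> two_cell_seqs \<Gamma> \<Delta> \<Lambda> \<Omega> \<and> \<theta> \<in> two_cell_seqs \<Gamma> \<Delta> \<Lambda> \<Omega> \<and>
              (\<forall>\<^sub>F k in sequentially. \<eta> k = \<theta> k)}"

text \<open>The family of all \<open>\<eta> k\<close> with \<open>k \<ge> K\<close> is a truncated representative of the
  class \<open>c\<close>; the values \<open>\<eta> k\<close> for \<open>k < K\<close> are irrelevant.\<close>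

definition truncated_rep :: "('o, 'm) zcell \<Rightarrow> ('p, 'n) zcell \<Rightarrow>
    ('o, 'm, 'p, 'n) ocell \<Rightarrow> ('o, 'm, 'p, 'n) ocell \<Rightarrow>
    (nat \<Rightarrow> 'o \<Rightarrow> 'n) set \<Rightarrow> nat \<Rightarrow> (nat \<Rightarrow> 'o \<Rightarrow> 'n) \<Rightarrow> bool" where
  "truncated_rep \<Gamma> \<Delta> \<Lambda> \<Omega> c K \<eta> \<longleftrightarrow>
     (\<exists>\<theta>\<in>c. \<forall>k\<ge>K. \<theta> k = \<eta> k) \<and>
     (\<forall>k\<ge>K. exchange \<Gamma> \<Delta> \<Lambda> \<Omega> k (\<eta> k) (\<eta> (k + 1)))"

section \<open>Unions of increasing sequences\<close>

text \<open>A sequence of sets \<open>S\<^sub>k\<close> with (injective) maps \<open>S\<^sub>k \<rightarrow> S\<^sub>k\<^sub>+\<^sub>1\<close>. Its union is the direct limit, whose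
  elements are classes of pairs \<open>(k, a)\<close> with \<open>a \<in> S\<^sub>k\<close>, two pairs being identified if
  their images agree in some later set. \<open>dlevel S k\<close> is the copy of \<open>S\<^sub>k\<close> in the union.\<close>

record 'a dsys =
  stage :: "nat \<Rightarrow> 'a set"
  incl :: "nat \<Rightarrow> 'a \<Rightarrow> 'a"

primrec transport :: "'a dsys \<Rightarrow> nat \<Rightarrow> nat \<Rightarrow> 'a \<Rightarrow> 'a" where
  "transport S k 0 a = a"
| "transport S k (Suc j) a = incl S (k + j) (transport S k j a)"

definition dclass :: "'a dsys \<Rightarrow> nat \<Rightarrow> 'a \<Rightarrow> (nat \<times> 'a) set" where
  "dclass S k a = {(l, b). b \<in> stage S l \<and>
     (\<exists>n\<ge>max k l. transport S k (n - k) a = transport S l (n - l) b)}"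

definition dlevel :: "'a dsys \<Rightarrow> nat \<Rightarrow> (nat \<times> 'a) set set" where
  "dlevel S k = dclass S k ` stage S k"

definition dunion :: "'a dsys \<Rightarrow> (nat \<times> 'a) set set" where
  "dunion S = (\<Union>k. dlevel S k)"

text \<open>Maps and binary operations on unions that are given levelwise (from level \<open>K\<close> on, in
  the case of maps), compatibly with the inclusions.\<close>

definition dmap :: "nat \<Rightarrow> 'a dsys \<Rightarrow> 'b dsys \<Rightarrow> (nat \<Rightarrow> 'a \<Rightarrow> 'b) \<Rightarrow>
    (nat \<times> 'a) set \<Rightarrow> (nat \<times> 'b) set" where
  "dmap K S T f X = (THE Z. \<exists>k\<ge>K. \<exists>a\<in>stage S k. X = dclass S k a \<and> Z = dclass T k (f k a))"

definition dmap2 :: "'a dsys \<Rightarrow> 'b dsys \<Rightarrow> 'c dsys \<Rightarrow> (nat \<Rightarrow> 'a \<Rightarrow> 'b \<Rightarrow> 'c) \<Rightarrow>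
    (nat \<times> 'a) set \<Rightarrow> (nat \<times> 'b) set \<Rightarrow> (nat \<times> 'c) set" where
  "dmap2 S T U f X Y = (THE Z. \<exists>k. \<exists>a\<in>stage S k. \<exists>b\<in>stage T k.
     X = dclass S k a \<and> Y = dclass T k b \<and> Z = dclass U k (f k a b))"

section \<open>Right correspondences and intertwiners\<close>

record ('a, 'b, 'h) rcorr =
  vecs :: "'h set"
  vadd :: "'h \<Rightarrow> 'h \<Rightarrow> 'h"
  vscale :: "complex \<Rightarrow> 'h \<Rightarrow> 'h"
  lact :: "'a \<Rightarrow> 'h \<Rightarrow> 'h"
  ract :: "'h \<Rightarrow> 'b \<Rightarrow> 'h"
  inner :: "'h \<Rightarrow> 'h \<Rightarrow> 'b"

text \<open>The space of adjointable bimodule maps for algebras with carriers \<open>A\<close> and \<open>B\<close>,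
  as extensional functions.\<close>

definition intertwiners :: "'a set \<Rightarrow> 'b set \<Rightarrow> ('a, 'b, 'h) rcorr \<Rightarrow> ('a, 'b, 'g) rcorr \<Rightarrow>
    ('h \<Rightarrow> 'g) set" where
  "intertwiners A B H G = {T \<in> vecs H \<rightarrow>\<^sub>E vecs G.
     (\<forall>\<xi>\<in>vecs H. \<forall>\<zeta>\<in>vecs H. T (vadd H \<xi> \<zeta>) = vadd G (T \<xi>) (T \<zeta>)) \<and>
     (\<forall>c. \<forall>\<xi>\<in>vecs H. T (vscale H c \<xi>) = vscale G c (T \<xi>)) \<and>
     (\<forall>\<alpha>\<in>A. \<forall>\<xi>\<in>vecs H. T (lact H \<alpha> \<xi>) = lact G \<alpha> (T \<xi>)) \<and>
     (\<forall>\<xi>\<in>vecs H. \<forall>\<beta>\<in>B. T (ract H \<xi> \<beta>) = ract G (T \<xi>) \<beta>) \<and>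
     (\<exists>S\<in>vecs G \<rightarrow> vecs H. \<forall>\<xi>\<in>vecs H. \<forall>\<zeta>\<in>vecs G. inner G (T \<xi>) \<zeta> = inner H \<xi> (S \<zeta>))}"

section \<open>The correspondence of a 1-cell and the operators \<open>\<Phi>\<close>\<close>

text \<open>\<open>tower \<Gamma> m k\<close> is \<open>\<Gamma>\<^sub>k \<dots> \<Gamma>\<^sub>1 m\<close>.\<close>

primrec tower :: "('o, 'm) zcell \<Rightarrow> 'o \<Rightarrow> nat \<Rightarrow> 'o" where
  "tower \<Gamma> m 0 = m"
| "tower \<Gamma> m (Suc k) = fob (step \<Gamma> (Suc k)) (tower \<Gamma> m k)"

definition alg_sys :: "('o, 'm) zcell \<Rightarrow> 'o \<Rightarrow> 'm dsys" where
  "alg_sys \<Gamma> m = \<lparr>stage = (\<lambda>k. Hom (cat \<Gamma> k) (tower \<Gamma> m k) (tower \<Gamma> m k)),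
                   incl = (\<lambda>k. far (step \<Gamma> (k + 1)))\<rparr>"

definition corr_sys :: "('o, 'm) zcell \<Rightarrow> ('p, 'n) zcell \<Rightarrow> 'o \<Rightarrow> 'p \<Rightarrow>
    ('o, 'm, 'p, 'n) ocell \<Rightarrow> 'n dsys" where
  "corr_sys \<Gamma> \<Delta> m n \<Lambda> =
     \<lparr>stage = (\<lambda>k. Hom (cat \<Delta> k) (tower \<Delta> n k) (fob (fun1 \<Lambda> k) (tower \<Gamma> m k))),
      incl = (\<lambda>k \<xi>. conn \<Lambda> (k + 1) (tower \<Gamma> m k) \<cdot>\<^bsub>cat \<Delta> (k + 1)\<^esub> far (step \<Delta> (k + 1)) \<xi>)\<rparr>"

definition corr :: "('o, 'm) zcell \<Rightarrow> ('p, 'n) zcell \<Rightarrow> 'o \<Rightarrow> 'p \<Rightarrow>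
    ('o, 'm, 'p, 'n) ocell \<Rightarrow> ((nat \<times> 'm) set, (nat \<times> 'n) set, (nat \<times> 'n) set) rcorr" where
  "corr \<Gamma> \<Delta> m n \<Lambda> =
     (let A = alg_sys \<Gamma> m; B = alg_sys \<Delta> n; H = corr_sys \<Gamma> \<Delta> m n \<Lambda> in
      \<lparr>vecs = dunion H,
       vadd = dmap2 H H H (\<lambda>k. hadd (cat \<Delta> k)),
       vscale = (\<lambda>c. dmap 0 H H (\<lambda>k. hscale (cat \<Delta> k) c)),
       lact = dmap2 A H H (\<lambda>k \<alpha> \<xi>. far (fun1 \<Lambda> k) \<alpha> \<cdot>\<^bsub>cat \<Delta> k\<^esub> \<xi>),
       ract = dmap2 H B H (\<lambda>k \<xi> \<beta>. \<xi> \<cdot>\<^bsub>cat \<Delta> k\<^esub> \<beta>),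
       inner = dmap2 H H B (\<lambda>k \<xi> \<zeta>. hadj (cat \<Delta> k) \<zeta> \<cdot>\<^bsub>cat \<Delta> k\<^esub> \<xi>)\<rparr>)"

definition corr_intertwiners :: "('o, 'm) zcell \<Rightarrow> ('p, 'n) zcell \<Rightarrow> 'o \<Rightarrow> 'p \<Rightarrow>
    ('o, 'm, 'p, 'n) ocell \<Rightarrow> ('o, 'm, 'p, 'n) ocell \<Rightarrow>
    ((nat \<times> 'n) set \<Rightarrow> (nat \<times> 'n) set) set" where
  "corr_intertwiners \<Gamma> \<Delta> m n \<Lambda> \<Omega> =
     intertwiners (dunion (alg_sys \<Gamma> m)) (dunion (alg_sys \<Delta> n))
       (corr \<Gamma> \<Delta> m n \<Lambda>) (corr \<Gamma> \<Delta> m n \<Omega>)"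

primrec gamma_seq :: "('o, 'm) zcell \<Rightarrow> ('p, 'n) zcell \<Rightarrow> 'o \<Rightarrow>
    ('o, 'm, 'p, 'n) ocell \<Rightarrow> ('o, 'm, 'p, 'n) ocell \<Rightarrow> nat \<Rightarrow> 'n \<Rightarrow> nat \<Rightarrow> 'n" where
  "gamma_seq \<Gamma> \<Delta> m \<Lambda> \<Omega> k \<gamma> 0 = \<gamma>"
| "gamma_seq \<Gamma> \<Delta> m \<Lambda> \<Omega> k \<gamma> (Suc j) =
     conn \<Omega> (k + j + 1) (tower \<Gamma> m (k + j))
       \<cdot>\<^bsub>cat \<Delta> (k + j + 1)\<^esub> far (step \<Delta> (k + j + 1)) (gamma_seq \<Gamma> \<Delta> m \<Lambda> \<Omega> k \<gamma> j)
       \<cdot>\<^bsub>cat \<Delta> (k + j + 1)\<^esub> hadj (cat \<Delta> (k + j + 1)) (conn \<Lambda> (k + j + 1) (tower \<Gamma> m (k + j)))"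

text \<open>\<open>Phi \<Gamma> \<Delta> m n \<Lambda> \<Omega> k \<gamma>\<close> is \<open>\<Phi>\<^sub>\<gamma>\<close> for \<open>\<gamma>\<close> at level \<open>k\<close>,
  as an extensional function on the union.\<close>

definition Phi :: "('o, 'm) zcell \<Rightarrow> ('p, 'n) zcell \<Rightarrow> 'o \<Rightarrow> 'p \<Rightarrow>
    ('o, 'm, 'p, 'n) ocell \<Rightarrow> ('o, 'm, 'p, 'n) ocell \<Rightarrow> nat \<Rightarrow> 'n \<Rightarrow>
    (nat \<times> 'n) set \<Rightarrow> (nat \<times> 'n) set" where
  "Phi \<Gamma> \<Delta> m n \<Lambda> \<Omega> k \<gamma> =
     restrict
       (dmap k (corr_sys \<Gamma> \<Delta> m n \<Lambda>) (corr_sys \<Gamma> \<Delta> m n \<Omega>)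
         (\<lambda>i \<xi>. gamma_seq \<Gamma> \<Delta> m \<Lambda> \<Omega> k \<gamma> (i - k) \<cdot>\<^bsub>cat \<Delta> i\<^esub> \<xi>))
       (dunion (corr_sys \<Gamma> \<Delta> m n \<Lambda>))"

definition maps_level0_into :: "('o, 'm) zcell \<Rightarrow> ('p, 'n) zcell \<Rightarrow> 'o \<Rightarrow> 'p \<Rightarrow>
    ('o, 'm, 'p, 'n) ocell \<Rightarrow> ('o, 'm, 'p, 'n) ocell \<Rightarrow>
    ((nat \<times> 'n) set \<Rightarrow> (nat \<times> 'n) set) \<Rightarrow> nat \<Rightarrow> bool" where
  "maps_level0_into \<Gamma> \<Delta> m n \<Lambda> \<Omega> T l \<longleftrightarrow>
     T ` dlevel (corr_sys \<Gamma> \<Delta> m n \<Lambda>) 0 \<subseteq> dlevel (corr_sys \<Gamma> \<Delta> m n \<Omega>) l"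

end

theory Submission
  imports Defs "HOL-Computational_Algebra.Fundamental_Theorem_Algebra"
begin

text \<open>
  Call an object \<open>z\<close> generating if every identity \<open>1\<^sub>x\<close> is a finite sum \<open>\<Sum>\<^sub>i g\<^sub>if\<^sub>i\<close> of maps
  factoring through \<open>z\<close>. By semisimplicity \<open>m\<^sub>0\<close> and \<open>n\<^sub>0\<close> are generating, and bi-faithful
  functors preserve this: the counit of an adjunction with faithful adjoint is a split epimorphism.
  Writing \<open>1 = \<Sum>\<^sub>i f\<^sub>ih\<^sub>i\<close> on \<open>\<Lambda>\<^sub>0m\<^sub>0\<close> with \<open>f\<^sub>i \<in> H\<^sub>0\<close> and transporting this decomposition to
  level \<open>k\<close>, right linearity gives \<open>T\<xi> = \<Sum>\<^sub>i T(f\<^sub>i)h\<^sub>i\<xi>\<close> for \<open>\<xi> \<in> H\<^sub>k\<close>, so an intertwiner \<open>T\<close>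
  with \<open>T H\<^sub>0 \<subseteq> G\<^sub>k\<close> is \<open>\<Phi>\<^sub>\<gamma>\<close> for \<open>\<gamma> = \<Sum>\<^sub>i T(f\<^sub>i)h\<^sub>i\<close>. Left linearity makes \<open>\<gamma>\<close> commute
  with \<open>End(\<Gamma>\<^sub>k\<cdots>\<Gamma>\<^sub>1m\<^sub>0)\<close>, hence extend uniquely to a natural transformation, and the exchange
  relation, natural in its object, need only be checked at \<open>\<Gamma>\<^sub>k\<cdots>\<Gamma>\<^sub>1m\<^sub>0\<close>.
\<close>

section \<open>Morphisms with source and target\<close>

text \<open>Nothing in the axioms says that an object decomposes into simple ones: simplicity only
  means scalar endomorphisms, and subobjects exist only for projections already at hand. Projections
  must therefore be produced inside an abstract finite-dimensional endomorphism algebra. An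
  annihilating polynomial, a complex root of it and the implication from \<open>w* w = 0\<close> to
  \<open>w = 0\<close> take the place of the spectral theorem. The same implication inverts
  \<open>\<epsilon> \<epsilon>*\<close> for the counit of an adjunction. Generation is phrased by
  sums of morphisms instead of retracts of direct sums because such sums are preserved by functors,
  survive conjugation by the unitaries \<open>W\<close> and can be fed to an operator of which only
  linearity is known. It also explains why a bound on the image of \<open>H_0\<close> controls every
  later level: the generating vectors remain those of \<open>H_0\<close>, and only their
  coefficients change with the level.\<close>

text \<open>With \<open>src\<close> and \<open>tgt\<close> (unspecified outside \<open>arr C\<close>) the typing premises of the axioms
  become equations without schematic objects, which conditional rewriting can discharge.\<close>

definition arr :: "('o, 'm) ccat \<Rightarrow> 'm \<Rightarrow> bool" where
  "arr C f \<longleftrightarrow> (\<exists>x\<in>Obj C. \<exists>y\<in>Obj C. f \<in> Hom C x y)"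

definition src :: "('o, 'm) ccat \<Rightarrow> 'm \<Rightarrow> 'o" where
  "src C f = (THE x. x \<in> Obj C \<and> (\<exists>y\<in>Obj C. f \<in> Hom C x y))"

definition tgt :: "('o, 'm) ccat \<Rightarrow> 'm \<Rightarrow> 'o" where
  "tgt C f = (THE y. y \<in> Obj C \<and> (\<exists>x\<in>Obj C. f \<in> Hom C x y))"

abbreviation morph :: "('o, 'm) ccat \<Rightarrow> 'm \<Rightarrow> 'o \<Rightarrow> 'o \<Rightarrow> bool" where
  "morph C f x y \<equiv> arr C f \<and> src C f = x \<and> tgt C f = y"

context cstar_category
begin

text \<open>\<open>hom_disjoint\<close> makes both \<open>THE\<close> descriptions well defined. As
  a simp rule this eliminates \<open>Hom\<close> whenever the objects are known, so that later
  proofs handle \<open>arr\<close>, \<open>src\<close> and \<open>tgt\<close>.\<close>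

lemma hom_iff [simp]:
  assumes "x \<in> Obj C" "y \<in> Obj C"
  shows "f \<in> Hom C x y \<longleftrightarrow> morph C f x y"
proof
  assume f: "f \<in> Hom C x y"
  have "src C f = x" "tgt C f = y"
    unfolding src_def tgt_def using hom_disjoint f assms by (blast intro: the_equality)+
  then show "morph C f x y" using f assms by (auto simp: arr_def)
next
  assume m: "morph C f x y"
  then obtain x' y' where xy: "x' \<in> Obj C" "y' \<in> Obj C" "f \<in> Hom C x' y'"
    by (auto simp: arr_def)
  have "src C f = x'" "tgt C f = y'"
    unfolding src_def tgt_def using hom_disjoint xy by (blast intro: the_equality)+
  with m xy show "f \<in> Hom C x y" by simp
qed

lemma src_obj [simp]: "arr C f \<Longrightarrow> src C f \<in> Obj C"
  by (metis arr_def hom_iff)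

lemma tgt_obj [simp]: "arr C f \<Longrightarrow> tgt C f \<in> Obj C"
  by (metis arr_def hom_iff)

lemma arr_hom: "arr C f \<Longrightarrow> f \<in> Hom C (src C f) (tgt C f)"
  by simp

lemma morph_objs: "morph C f x y \<Longrightarrow> x \<in> Obj C \<and> y \<in> Obj C"
  by auto

lemma morph_ident [simp]:
  assumes "x \<in> Obj C"
  shows "arr C (ident C x)" "src C (ident C x) = x" "tgt C (ident C x) = x"
  using id_in[OF assms] assms by auto

lemma morph_cmp [simp]:
  assumes "arr C f" "arr C g" "src C g = tgt C f"
  shows "arr C (g \<cdot> f)" "src C (g \<cdot> f) = src C f" "tgt C (g \<cdot> f) = tgt C g"
  using cmp_in[of "src C f" "tgt C f" "tgt C g" f g] assms src_obj[of f] tgt_obj[of f] tgt_obj[of g]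
  by auto

lemma cmp_ident [simp]: "\<lbrakk>arr C f; src C f = x\<rbrakk> \<Longrightarrow> f \<cdot> ident C x = f"
  using cmp_id_right[OF _ _ arr_hom] by auto

lemma ident_cmp [simp]: "\<lbrakk>arr C f; tgt C f = x\<rbrakk> \<Longrightarrow> ident C x \<cdot> f = f"
  using cmp_id_left[OF _ _ arr_hom] by auto

lemma assoc [simp]:
  assumes "arr C f" "arr C g" "arr C h" "src C g = tgt C f" "src C h = tgt C g"
  shows "(h \<cdot> g) \<cdot> f = h \<cdot> (g \<cdot> f)"
  using cmp_assoc[of "src C f" "tgt C f" "tgt C g" "tgt C h" f g h] assms
    src_obj[of f] tgt_obj[of f] tgt_obj[of g] tgt_obj[of h] by auto

lemma morph_zero [simp]:
  assumes "x \<in> Obj C" "y \<in> Obj C"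
  shows "arr C (hzero C x y)" "src C (hzero C x y) = x" "tgt C (hzero C x y) = y"
  using zero_in[OF assms] assms by auto

lemma morph_add [simp]:
  assumes "arr C f" "arr C g" "src C g = src C f" "tgt C g = tgt C f"
  shows "arr C (hadd C f g)" "src C (hadd C f g) = src C f" "tgt C (hadd C f g) = tgt C f"
  using add_in[of "src C f" "tgt C f" f g] assms src_obj[of f] tgt_obj[of f] by auto

lemma morph_scale [simp]:
  assumes "arr C f"
  shows "arr C (hscale C c f)" "src C (hscale C c f) = src C f" "tgt C (hscale C c f) = tgt C f"
  using scale_in[of "src C f" "tgt C f" f] assms src_obj[of f] tgt_obj[of f] by auto

lemma morph_adj [simp]:
  assumes "arr C f"
  shows "arr C (hadj C f)" "src C (hadj C f) = tgt C f" "tgt C (hadj C f) = src C f"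
  using adj_in[of "src C f" "tgt C f" f] assms src_obj[of f] tgt_obj[of f] by auto

lemma adj_adj_arr [simp]: "arr C f \<Longrightarrow> hadj C (hadj C f) = f"
  using adj_adj[OF _ _ arr_hom] by auto

lemma adj_cmp_arr [simp]:
  "\<lbrakk>arr C f; arr C g; src C g = tgt C f\<rbrakk> \<Longrightarrow> hadj C (g \<cdot> f) = hadj C f \<cdot> hadj C g"
  using adj_cmp[of "src C f" "tgt C f" "tgt C g" f g] src_obj[of f] tgt_obj[of f] tgt_obj[of g]
  by auto

lemma adj_add_arr [simp]:
  "\<lbrakk>arr C f; arr C g; src C g = src C f; tgt C g = tgt C f\<rbrakk>
    \<Longrightarrow> hadj C (hadd C f g) = hadd C (hadj C f) (hadj C g)"
  using adj_add[of "src C f" "tgt C f" f g] src_obj[of f] tgt_obj[of f] by auto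

lemma adj_scale_arr [simp]: "arr C f \<Longrightarrow> hadj C (hscale C a f) = hscale C (cnj a) (hadj C f)"
  using adj_scale[OF _ _ arr_hom] by auto

lemma add_comm:
  "\<lbrakk>arr C f; arr C g; src C g = src C f; tgt C g = tgt C f\<rbrakk> \<Longrightarrow> hadd C f g = hadd C g f"
  using add_commute[of "src C f" "tgt C f" f g] src_obj[of f] tgt_obj[of f] by auto

lemma add_assoc_arr:
  "\<lbrakk>arr C f; arr C g; arr C h; src C g = src C f; tgt C g = tgt C f; src C h = src C f;
    tgt C h = tgt C f\<rbrakk> \<Longrightarrow> hadd C (hadd C f g) h = hadd C f (hadd C g h)"
  using add_assoc[of "src C f" "tgt C f" f g h] src_obj[of f] tgt_obj[of f] by auto

lemma add_left_comm:
  assumes "arr C f" "arr C g" "arr C h" "src C g = src C f" "tgt C g = tgt C f" "src C h = src C f"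
    "tgt C h = tgt C f"
  shows "hadd C f (hadd C g h) = hadd C g (hadd C f h)"
  using add_assoc_arr[of f g h] add_assoc_arr[of g f h] add_comm[of f g] assms by simp

lemma add_zero_right [simp]:
  "\<lbrakk>arr C f; src C f = x; tgt C f = y\<rbrakk> \<Longrightarrow> hadd C f (hzero C x y) = f"
  using add_zero[OF _ _ arr_hom] by auto

lemma add_zero_left [simp]:
  "\<lbrakk>arr C f; src C f = x; tgt C f = y\<rbrakk> \<Longrightarrow> hadd C (hzero C x y) f = f"
  using add_comm[of f "hzero C x y"] by auto

lemma add_neg [simp]: "arr C f \<Longrightarrow> hadd C f (hscale C (- 1) f) = hzero C (src C f) (tgt C f)"
  using add_minus[OF _ _ arr_hom] by auto

lemma scale_one_arr [simp]: "arr C f \<Longrightarrow> hscale C 1 f = f"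
  using scale_one[OF _ _ arr_hom] by auto

lemma scale_scale_arr [simp]: "arr C f \<Longrightarrow> hscale C a (hscale C b f) = hscale C (a * b) f"
  using scale_scale[OF _ _ arr_hom] by auto

lemma scale_add_coeff: "arr C f \<Longrightarrow> hscale C (a + b) f = hadd C (hscale C a f) (hscale C b f)"
  using scale_add_left[OF _ _ arr_hom] by auto

lemma scale_add_arr [simp]:
  "\<lbrakk>arr C f; arr C g; src C g = src C f; tgt C g = tgt C f\<rbrakk>
    \<Longrightarrow> hscale C a (hadd C f g) = hadd C (hscale C a f) (hscale C a g)"
  using scale_add_right[of "src C f" "tgt C f" f g] src_obj[of f] tgt_obj[of f] by auto

lemma scale_zero_coeff [simp]: "arr C f \<Longrightarrow> hscale C 0 f = hzero C (src C f) (tgt C f)"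
  using scale_add_coeff[of f 1 "- 1"] by simp

lemma scale_zero [simp]:
  assumes "x \<in> Obj C" "y \<in> Obj C" shows "hscale C a (hzero C x y) = hzero C x y"
  using scale_scale_arr[of "hzero C x y" a 0] scale_zero_coeff[of "hzero C x y"] assms by simp

lemma cmp_add_l [simp]:
  "\<lbrakk>arr C f; arr C g; arr C h; src C g = tgt C f; src C h = tgt C f; tgt C h = tgt C g\<rbrakk>
    \<Longrightarrow> hadd C g h \<cdot> f = hadd C (g \<cdot> f) (h \<cdot> f)"
  using cmp_add_left[of "src C f" "tgt C f" "tgt C g" f g h]
    src_obj[of f] tgt_obj[of f] tgt_obj[of g] by auto

lemma cmp_add_r [simp]:
  "\<lbrakk>arr C f; arr C g; arr C h; src C g = src C f; tgt C g = tgt C f; src C h = tgt C f\<rbrakk>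
    \<Longrightarrow> h \<cdot> hadd C f g = hadd C (h \<cdot> f) (h \<cdot> g)"
  using cmp_add_right[of "src C f" "tgt C f" "tgt C h" f g h]
    src_obj[of f] tgt_obj[of f] tgt_obj[of h] by auto

lemma cmp_scale_l [simp]:
  "\<lbrakk>arr C f; arr C g; src C g = tgt C f\<rbrakk> \<Longrightarrow> hscale C a g \<cdot> f = hscale C a (g \<cdot> f)"
  using cmp_scale_left[of "src C f" "tgt C f" "tgt C g" f g]
    src_obj[of f] tgt_obj[of f] tgt_obj[of g] by auto

lemma cmp_scale_r [simp]:
  "\<lbrakk>arr C f; arr C g; src C g = tgt C f\<rbrakk> \<Longrightarrow> g \<cdot> hscale C a f = hscale C a (g \<cdot> f)"
  using cmp_scale_right[of "src C f" "tgt C f" "tgt C g" f g]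
    src_obj[of f] tgt_obj[of f] tgt_obj[of g] by auto

lemma cmp_zero [simp]:
  assumes "arr C g" "src C g = y" "x \<in> Obj C"
  shows "g \<cdot> hzero C x y = hzero C x (tgt C g)"
  using cmp_scale_r[of "hzero C x y" g 0] assms by auto

lemma zero_cmp [simp]:
  assumes "arr C f" "tgt C f = y" "z \<in> Obj C"
  shows "hzero C y z \<cdot> f = hzero C (src C f) z"
  using cmp_scale_l[of f "hzero C y z" 0] assms by auto

lemma adj_zero [simp]: "\<lbrakk>x \<in> Obj C; y \<in> Obj C\<rbrakk> \<Longrightarrow> hadj C (hzero C x y) = hzero C y x"
  using adj_scale_arr[of "hzero C x y" 0] by simp

text \<open>Apply the involution to \<open>1* 1 = 1*\<close>: the right side becomes
  \<open>1\<close>, while the left side is again \<open>1* 1 = 1*\<close>.\<close>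

lemma adj_ident [simp]:
  assumes "x \<in> Obj C" shows "hadj C (ident C x) = ident C x"
proof -
  have "hadj C (hadj C (ident C x) \<cdot> ident C x) = hadj C (ident C x) \<cdot> hadj C (hadj C (ident C x))"
    using assms by (rule_tac adj_cmp_arr) simp_all
  then show ?thesis using assms by simp
qed

lemma eq_of_diff_zero:
  assumes f: "morph C f x y" and g: "morph C g x y"
    and diff: "hadd C f (hscale C (- 1) g) = hzero C x y"
  shows "f = g"
proof -
  have "hadd C (hscale C (- 1) g) g = hzero C x y"
    using add_comm[of g "hscale C (- 1) g"] add_neg[of g] g by simp
  then have "f = hadd C f (hadd C (hscale C (- 1) g) g)"
    using f by simp
  also have "\<dots> = hadd C (hadd C f (hscale C (- 1) g)) g"
    using f g by (simp add: add_assoc_arr)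
  also have "\<dots> = g" using diff g by simp
  finally show ?thesis .
qed

lemma eq_neg_of_add_zero:
  assumes "morph C f x y" "morph C g x y" "hadd C f g = hzero C x y"
  shows "f = hscale C (- 1) g"
  by (rule eq_of_diff_zero[of _ x y]) (use assms in auto)

lemma scale_eq_zero:
  assumes "arr C f" "hscale C a f = hzero C (src C f) (tgt C f)" "a \<noteq> 0"
  shows "f = hzero C (src C f) (tgt C f)"
  using arg_cong[OF assms(2), of "hscale C (inverse a)"] assms(1,3) by simp

text \<open>Positivity enters here, through the C*-identity: the norm of \<open>w* w\<close> is the
  square of the norm of \<open>w\<close>. The later cancellation arguments rest on it.\<close>

lemma adj_cmp_self_zero:
  assumes "arr C w" "hadj C w \<cdot> w = hzero C (src C w) (src C w)"
  shows "w = hzero C (src C w) (tgt C w)"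
proof -
  have "hnorm C (hadj C w \<cdot> w) = 0"
    using norm_eq_zero[of "src C w" "src C w" "hadj C w \<cdot> w"] assms by simp
  then have "hnorm C w = 0"
    using cstar_identity[of "src C w" "tgt C w" w] assms by simp
  then show ?thesis
    using norm_eq_zero[of "src C w" "tgt C w" w] assms by simp
qed

end

section \<open>Finite-dimensional morphism spaces\<close>

text \<open>Gaussian elimination on the unknowns \<open>I\<close>: a pivot \<open>p\<close> for
  equation \<open>n\<close> is removed, \<open>N\<close> is the system that remains, and
  \<open>p\<close> is recovered by back substitution. It is stated for coefficients because morphism
  spaces are carrier sets, not vector space types.\<close>

lemma homogeneous_system_nontrivial:
  fixes M :: "'i \<Rightarrow> nat \<Rightarrow> 'k::field"
  assumes "finite I" "card I > n"
  shows "\<exists>c. (\<exists>i\<in>I. c i \<noteq> 0) \<and> (\<forall>j<n. (\<Sum>i\<in>I. c i * M i j) = 0)"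
  using assms
proof (induction n arbitrary: I M)
  case 0
  then obtain i where "i \<in> I" by fastforce
  then show ?case by (intro exI[of _ "\<lambda>_. 1"]) auto
next
  case (Suc n)
  show ?case
  proof (cases "\<forall>i\<in>I. M i n = 0")
    case True
    obtain c where "\<exists>i\<in>I. c i \<noteq> 0" "\<forall>j<n. (\<Sum>i\<in>I. c i * M i j) = 0"
      using Suc.IH[OF Suc.prems(1), of M] Suc.prems(2) by auto
    with True show ?thesis by (intro exI[of _ c]) (auto simp: less_Suc_eq)
  next
    case False
    then obtain p where p: "p \<in> I" "M p n \<noteq> 0" by auto
    define J where "J = I - {p}"
    define N where "N i j = M i j - M i n / M p n * M p j" for i j
    have "finite J" "card J > n" using Suc.prems p by (auto simp: J_def)
    from Suc.IH[OF this, of N] obtain c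
      where c: "\<exists>i\<in>J. c i \<noteq> 0" "\<forall>j<n. (\<Sum>i\<in>J. c i * N i j) = 0" by blast
    \<comment> \<open>The value at \<open>p\<close> is forced by equation \<open>n\<close>;
      substituting it turns the sums with \<open>M\<close> into sums with \<open>N\<close>.\<close>
    define d where "d = c(p := - (\<Sum>i\<in>J. c i * M i n) / M p n)"
    have split: "(\<Sum>i\<in>I. d i * M i j) = d p * M p j + (\<Sum>i\<in>J. c i * M i j)" for j
    proof -
      have "(\<Sum>i\<in>I. d i * M i j) = d p * M p j + (\<Sum>i\<in>J. d i * M i j)"
        unfolding J_def using Suc.prems(1) p(1) by (rule sum.remove)
      also have "(\<Sum>i\<in>J. d i * M i j) = (\<Sum>i\<in>J. c i * M i j)"
        by (rule sum.cong) (auto simp: d_def J_def)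
      finally show ?thesis .
    qed
    have "(\<Sum>i\<in>I. d i * M i j) = (\<Sum>i\<in>J. c i * N i j)" for j
    proof -
      have "(\<Sum>i\<in>J. c i * N i j) =
        (\<Sum>i\<in>J. c i * M i j) - (\<Sum>i\<in>J. c i * M i n * (M p j / M p n))"
        by (simp add: N_def right_diff_distrib sum_subtractf mult.assoc)
      also have "(\<Sum>i\<in>J. c i * M i n * (M p j / M p n)) =
          (\<Sum>i\<in>J. c i * M i n) * (M p j / M p n)"
        by (rule sum_distrib_right[symmetric])
      finally show ?thesis unfolding split by (simp add: d_def)
    qed
    moreover have "(\<Sum>i\<in>J. c i * N i n) = 0" using p(2) by (simp add: N_def)
    moreover have "\<exists>i\<in>I. d i \<noteq> 0" using c(1) by (auto simp: d_def J_def)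
    ultimately show ?thesis using c(2) by (intro exI[of _ d]) (auto simp: less_Suc_eq)
  qed
qed

context cstar_category
begin

lemma hsum_Nil [simp]: "hsum C x y [] = hzero C x y"
  by (simp add: hsum_def)

lemma hsum_Cons [simp]: "hsum C x y (f # fs) = hadd C f (hsum C x y fs)"
  by (simp add: hsum_def)

lemma morph_hsum:
  assumes "x \<in> Obj C" "y \<in> Obj C" "\<And>f. f \<in> set fs \<Longrightarrow> morph C f x y"
  shows "morph C (hsum C x y fs) x y"
  using assms(3) by (induction fs) (use assms(1,2) in simp_all)

lemma add_add_swap:
  assumes "morph C a x y" "morph C b x y" "morph C c x y" "morph C d x y"
  shows "hadd C (hadd C a b) (hadd C c d) = hadd C (hadd C a c) (hadd C b d)"
  using assms add_left_comm[of b c d] by (simp add: add_assoc_arr)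

lemma hsum_add:
  assumes "x \<in> Obj C" "y \<in> Obj C"
    and "\<And>i. i \<in> set is \<Longrightarrow> morph C (f i) x y" "\<And>i. i \<in> set is \<Longrightarrow> morph C (g i) x y"
  shows "hadd C (hsum C x y (map f is)) (hsum C x y (map g is)) =
    hsum C x y (map (\<lambda>i. hadd C (f i) (g i)) is)"
  using assms(3,4)
proof (induction "is")
  case (Cons i "is")
  then show ?case
    using add_add_swap[of "f i" x y "hsum C x y (map f is)" "g i" "hsum C x y (map g is)"]
      morph_hsum[OF assms(1,2), of "map f is"] morph_hsum[OF assms(1,2), of "map g is"] by auto
qed (use assms(1,2) in simp)

lemma hsum_scale:
  assumes "x \<in> Obj C" "y \<in> Obj C" "\<And>i. i \<in> set is \<Longrightarrow> morph C (f i) x y"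
  shows "hscale C a (hsum C x y (map f is)) = hsum C x y (map (\<lambda>i. hscale C a (f i)) is)"
  using assms(3)
proof (induction "is")
  case (Cons i "is")
  have "morph C (hsum C x y (map f is)) x y"
    by (rule morph_hsum) (use assms(1,2) Cons.prems in auto)
  with Cons show ?case by simp
qed (use assms(1,2) in simp)

lemma hsum_cmp_left:
  assumes "x \<in> Obj C" "morph C b y z" "\<And>f. f \<in> set fs \<Longrightarrow> morph C f x y"
  shows "b \<cdot> hsum C x y fs = hsum C x z (map (\<lambda>f. b \<cdot> f) fs)"
  using assms(3)
proof (induction fs)
  case (Cons f fs)
  then show ?case using morph_hsum[of x y fs] morph_objs[OF assms(2)] assms(1,2) by auto
qed (use assms(1,2) in auto)

lemma hsum_zeros:
  assumes "x \<in> Obj C" "y \<in> Obj C" "\<And>f. f \<in> set fs \<Longrightarrow> f = hzero C x y"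
  shows "hsum C x y fs = hzero C x y"
  using assms(3)
proof (induction fs)
  case (Cons f fs)
  have "f = hzero C x y" by (rule Cons.prems) simp
  moreover have "hsum C x y fs = hzero C x y" by (rule Cons.IH) (rule Cons.prems, simp)
  ultimately show ?case using assms(1,2) by simp
qed simp

text \<open>The bound \<open>n\<close> is the length of a spanning list: \<open>n + 1\<close>
  coordinate vectors of length \<open>n\<close> satisfy a nontrivial linear relation. It is chosen
  before the family \<open>e\<close>, as needed for bounding the number of orthogonal
  idempotents.\<close>

lemma fin_dim_dependence:
  assumes xy: "x \<in> Obj C" "y \<in> Obj C" and fd: "fin_dim_hom C x y"
  shows "\<exists>n. \<forall>e. (\<forall>i\<le>n. morph C (e i) x y) \<longrightarrow>
    (\<exists>c. (\<exists>i\<le>n. c i \<noteq> 0) \<and> hsum C x y (map (\<lambda>i. hscale C (c i) (e i)) [0..<Suc n]) = hzero C x y)"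
proof -
  obtain bs where bs: "set bs \<subseteq> Hom C x y"
    and span: "\<And>f. f \<in> Hom C x y \<Longrightarrow>
      \<exists>cs. length cs = length bs \<and> f = hsum C x y (map2 (hscale C) cs bs)"
    using fd unfolding fin_dim_hom_def by blast
  define n where "n = length bs"
  \<comment> \<open>\<open>L\<close> maps coordinate vectors onto the morphism space. It need not be
    injective; relations between coordinates are only pushed forward.\<close>
  define L where "L c = hsum C x y (map (\<lambda>j. hscale C (c j) (bs ! j)) [0..<n])" for c
  have b: "morph C (bs ! j) x y" if "j < n" for j
  proof -
    have "bs ! j \<in> Hom C x y" using bs nth_mem[of j bs] that by (auto simp: n_def)
    then show ?thesis using xy by simp
  qed
  have L_add: "hadd C (L c) (L d) = L (\<lambda>j. c j + d j)" for c d
    unfolding L_def using xy b by (subst hsum_add) (auto simp: scale_add_coeff intro!: arg_cong[where f = "hsum C x y"])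
  have L_scale: "hscale C a (L c) = L (\<lambda>j. a * c j)" for a c
    unfolding L_def using xy b by (subst hsum_scale) (auto intro!: arg_cong[where f = "hsum C x y"])
  have L_zero: "L (\<lambda>_. 0) = hzero C x y"
    unfolding L_def using xy b by (intro hsum_zeros) auto
  have L_surj: "\<exists>c. f = L c" if f: "morph C f x y" for f
  proof -
    obtain cs where cs: "length cs = n" "f = hsum C x y (map2 (hscale C) cs bs)"
      using span[of f] f xy by (auto simp: n_def)
    have "map2 (hscale C) cs bs = map (\<lambda>j. hscale C (cs ! j) (bs ! j)) [0..<n]"
      using cs(1) by (intro nth_equalityI) (auto simp: n_def)
    with cs show ?thesis unfolding L_def by auto
  qed
  show ?thesis
  proof (intro exI[of _ n] allI impI)
    fix e assume e: "\<forall>i\<le>n. morph C (e i) x y"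
    have "\<forall>i. \<exists>c. i \<le> n \<longrightarrow> e i = L c" using L_surj e by blast
    from choice[OF this] obtain M where M: "\<And>i. i \<le> n \<Longrightarrow> e i = L (M i)" by blast
    obtain c where c: "\<exists>i\<in>{..n}. c i \<noteq> 0" "\<forall>j<n. (\<Sum>i\<in>{..n}. c i * M i j) = 0"
      using homogeneous_system_nontrivial[of "{..n}" n M] by auto
    have "hsum C x y (map (\<lambda>i. hscale C (c i) (e i)) is) = L (\<lambda>j. \<Sum>i\<leftarrow>is. c i * M i j)"
      if "set is \<subseteq> {..n}" for "is"
      using that by (induction "is") (auto simp: L_zero L_scale L_add M)
    from this[of "[0..<Suc n]"]
    have "hsum C x y (map (\<lambda>i. hscale C (c i) (e i)) [0..<Suc n]) =
      L (\<lambda>j. \<Sum>i\<in>{..n}. c i * M i j)"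
      by (simp add: sum_list_distinct_conv_sum_set atLeast0LessThan lessThan_Suc_atMost
          del: upt_Suc) 
    also have "\<dots> = L (\<lambda>_. 0)"
      unfolding L_def using c(2) by (intro arg_cong[where f = "hsum C x y"]) auto
    finally show "\<exists>c. (\<exists>i\<le>n. c i \<noteq> 0) \<and>
        hsum C x y (map (\<lambda>i. hscale C (c i) (e i)) [0..<Suc n]) = hzero C x y"
      using c(1) L_zero by (intro exI[of _ c]) auto
  qed
qed

end

section \<open>Projections in endomorphism algebras\<close>

text \<open>The polynomial with coefficients \<open>cs\<close>, constant term first, evaluated at
  \<open>b\<close>. Horner's form gives direct access to the lowest coefficient, which the
  construction of a pseudoinverse strips off or divides by.\<close>

primrec horner :: "('o, 'm) ccat \<Rightarrow> 'o \<Rightarrow> 'm \<Rightarrow> complex list \<Rightarrow> 'm" where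
  "horner C x b [] = hzero C x x"
| "horner C x b (c # cs) = hadd C (hscale C c (ident C x)) (b \<cdot>\<^bsub>C\<^esub> horner C x b cs)"

context cstar_category
begin

lemma morph_horner:
  assumes "morph C b x x" shows "morph C (horner C x b cs) x x"
  using morph_objs[OF assms] assms by (induction cs) auto

lemma horner_commute:
  assumes "morph C b x x" shows "horner C x b cs \<cdot> b = b \<cdot> horner C x b cs"
  using morph_objs[OF assms] assms morph_horner[OF assms] by (induction cs) auto

lemma horner_eq_hsum:
  assumes b: "morph C b x x"
  shows "horner C x b (map c [0..<m]) =
    hsum C x x (map (\<lambda>i. hscale C (c i) (((\<cdot>) b ^^ i) (ident C x))) [0..<m])"
proof (induction m arbitrary: c)
  case 0
  then show ?case by simp
next
  case (Suc m)
  have x: "x \<in> Obj C" using morph_objs[OF b] by simp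
  have pow: "morph C (((\<cdot>) b ^^ i) (ident C x)) x x" for i
    using x b by (induction i) auto
  have "horner C x b (map c [0..<Suc m]) =
      hadd C (hscale C (c 0) (ident C x)) (b \<cdot> horner C x b (map (\<lambda>i. c (Suc i)) [0..<m]))"
    by (simp add: upt_conv_Cons map_Suc_upt[symmetric] comp_def del: upt_Suc)
  also have "b \<cdot> horner C x b (map (\<lambda>i. c (Suc i)) [0..<m]) =
      hsum C x x (map (\<lambda>i. b \<cdot> hscale C (c (Suc i)) (((\<cdot>) b ^^ i) (ident C x))) [0..<m])"
    unfolding Suc.IH using x b pow by (subst hsum_cmp_left) (auto simp: comp_def)
  also have "\<dots> = hsum C x x (map (\<lambda>i. hscale C (c (Suc i)) (((\<cdot>) b ^^ Suc i) (ident C x))) [0..<m])"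
    using x b pow by (intro arg_cong[where f = "hsum C x x"]) auto
  finally show ?case
    by (simp add: upt_conv_Cons map_Suc_upt[symmetric] comp_def del: upt_Suc)
qed

text \<open>Among the powers \<open>1, b, ..., b^n\<close> there is a linear relation once the
  endomorphism space is spanned by \<open>n\<close> elements.\<close>

lemma annihilating_polynomial:
  assumes b: "morph C b x x" and fd: "fin_dim_hom C x x"
  shows "\<exists>cs. (\<exists>c\<in>set cs. c \<noteq> 0) \<and> horner C x b cs = hzero C x x"
proof -
  have x: "x \<in> Obj C" using morph_objs[OF b] by simp
  have pow: "morph C (((\<cdot>) b ^^ i) (ident C x)) x x" for i
    using x b by (induction i) auto
  obtain n where n: "\<And>e. (\<forall>i\<le>n. morph C (e i) x x) \<Longrightarrow>
    \<exists>c. (\<exists>i\<le>n. c i \<noteq> 0) \<and> hsum C x x (map (\<lambda>i. hscale C (c i) (e i)) [0..<Suc n]) = hzero C x x"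
    using fin_dim_dependence[OF x x fd] by blast
  from n[of "\<lambda>i. ((\<cdot>) b ^^ i) (ident C x)"] pow obtain c i
    where "i \<le> n" "c i \<noteq> 0" "horner C x b (map c [0..<Suc n]) = hzero C x x"
    unfolding horner_eq_hsum[OF b] by blast
  then show ?thesis
    by (intro exI[of _ "map c [0..<Suc n]"]) (auto simp del: upt_Suc)
qed

text \<open>For self-adjoint \<open>b\<close>, \<open>b\<^sup>2z = 0\<close> implies \<open>bz = 0\<close> by the C*-identity, so trailing zero
  coefficients of an annihilating polynomial may be cancelled; \<open>1 - bs\<close> is then the
  projection onto the kernel of \<open>b\<close>.\<close>

lemma selfadjoint_pseudoinverse:
  assumes b: "morph C b x x" "hadj C b = b" and fd: "fin_dim_hom C x x"
  shows "\<exists>s. morph C s x x \<and> s \<cdot> b = b \<cdot> s \<and> b \<cdot> (b \<cdot> s) = b"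
proof -
  have x: "x \<in> Obj C" using morph_objs[OF b(1)] by simp
  \<comment> \<open>Induction on \<open>b p(b) = 0\<close> and not on \<open>p(b) = 0\<close>: with
    the spare factor \<open>b\<close>, a zero lowest coefficient gives \<open>b (b r) = 0\<close>,
    from which one \<open>b\<close> can be cancelled while the hypothesis keeps its form.\<close>
  have "\<exists>s. morph C s x x \<and> s \<cdot> b = b \<cdot> s \<and> b \<cdot> (b \<cdot> s) = b"
    if "\<exists>c\<in>set cs. c \<noteq> 0" "b \<cdot> horner C x b cs = hzero C x x" for cs
    using that
  proof (induction cs)
    case (Cons c cs)
    let ?r = "horner C x b cs"
    have r: "morph C ?r x x" "?r \<cdot> b = b \<cdot> ?r"
      using morph_horner[OF b(1)] horner_commute[OF b(1)] by auto
    show ?case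
    proof (cases "c = 0")
      case True
      have "b \<cdot> (b \<cdot> ?r) = hzero C x x" using Cons.prems(2) True x b r by simp
      then have "b \<cdot> ?r = hzero C x x"
        using adj_cmp_self_zero[of "b \<cdot> ?r"] b r x by simp
      with Cons True show ?thesis by auto
    next
      case False
      \<comment> \<open>Nonzero lowest coefficient: \<open>c b + b (b r) = 0\<close> is solved for
        \<open>b\<close>, so \<open>s = - r / c\<close> works; it commutes with \<open>b\<close> as
        a polynomial in \<open>b\<close>.\<close>
      have "hadd C (hscale C c b) (b \<cdot> (b \<cdot> ?r)) = hzero C x x"
        using Cons.prems(2) x b r by simp
      then have "hscale C c b = hscale C (- 1) (b \<cdot> (b \<cdot> ?r))"
        using b r by (intro eq_neg_of_add_zero[of _ x x]) auto
      from arg_cong[OF this, of "hscale C (inverse c)"]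
      have "b = hscale C (- inverse c) (b \<cdot> (b \<cdot> ?r))"
        using False b r by simp
      then show ?thesis
        using b r by (intro exI[of _ "hscale C (- inverse c) ?r"]) auto
    qed
  qed simp
  moreover obtain cs where "\<exists>c\<in>set cs. c \<noteq> 0" "horner C x b cs = hzero C x x"
    using annihilating_polynomial[OF b(1) fd] by blast
  ultimately show ?thesis using x b by auto
qed

text \<open>For a pseudoinverse \<open>s\<close>, the difference \<open>b s - 1\<close> is
  annihilated by \<open>b\<close>, hence zero by cancellation.\<close>

lemma selfadjoint_cancellable_invertible:
  assumes b: "morph C b x x" "hadj C b = b" and fd: "fin_dim_hom C x x"
    and cancel: "\<And>a. morph C a x x \<Longrightarrow> b \<cdot> a = hzero C x x \<Longrightarrow> a = hzero C x x"
  shows "\<exists>s. morph C s x x \<and> b \<cdot> s = ident C x"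
proof -
  have x: "x \<in> Obj C" using morph_objs[OF b(1)] by simp
  obtain s where s: "morph C s x x" "b \<cdot> (b \<cdot> s) = b"
    using selfadjoint_pseudoinverse[OF b fd] by blast
  let ?d = "hadd C (b \<cdot> s) (hscale C (- 1) (ident C x))"
  have "b \<cdot> ?d = hzero C x x" using b s x by simp
  moreover have "morph C ?d x x" using b s x by simp
  ultimately have "?d = hzero C x x" by (rule cancel[rotated])
  then have "b \<cdot> s = ident C x"
    using b(1) s(1) x by (intro eq_of_diff_zero[of "b \<cdot> s" x x]) simp_all
  with s show ?thesis by blast
qed

section \<open>Library polynomials evaluated at endomorphisms, eigenvalues and kernel
  projections\<close>

lemma horner_coeffs_pCons:
  assumes "morph C b x x"
  shows "horner C x b (coeffs (pCons c p)) =
    hadd C (hscale C c (ident C x)) (b \<cdot> horner C x b (coeffs p))"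
proof -
  have "x \<in> Obj C" using morph_objs[OF assms] by simp
  \<comment> \<open>Library coefficient lists carry no trailing zeros. Only \<open>c = 0\<close>,
    \<open>p = 0\<close> deviates from the recursion of \<open>horner\<close>, and there both sides
    vanish.\<close>
  moreover have "coeffs (pCons c p) = c # coeffs p" if "\<not> (c = 0 \<and> p = 0)"
    using that by (auto simp: cCons_def)
  ultimately show ?thesis
    using assms by (cases "c = 0 \<and> p = 0") (simp_all del: coeffs_pCons_eq_cCons)
qed

lemma horner_coeffs_Poly:
  assumes "morph C b x x" shows "horner C x b (coeffs (Poly cs)) = horner C x b cs"
  by (induction cs) (simp_all add: horner_coeffs_pCons[OF assms] del: coeffs_Poly coeffs_pCons_eq_cCons)

lemma horner_coeffs_smult:
  assumes b: "morph C b x x"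
  shows "horner C x b (coeffs (smult a p)) = hscale C a (horner C x b (coeffs p))"
proof -
  have "x \<in> Obj C" using morph_objs[OF assms] by simp
  then show ?thesis
    using b morph_horner[OF b] by (induction p) (auto simp: horner_coeffs_pCons[OF b] simp del: coeffs_pCons_eq_cCons coeffs_smult)
qed

lemma horner_coeffs_add:
  assumes b: "morph C b x x"
  shows "horner C x b (coeffs (p + q)) =
    hadd C (horner C x b (coeffs p)) (horner C x b (coeffs q))"
proof -
  have x: "x \<in> Obj C" using morph_objs[OF assms] by simp
  show ?thesis
  proof (induction p q rule: poly_induct2)
    case (pCons c p d q)
    then show ?case
      using x b morph_horner[OF b] 
        add_add_swap[of "hscale C c (ident C x)" x x "hscale C d (ident C x)"
          "b \<cdot> horner C x b (coeffs p)" "b \<cdot> horner C x b (coeffs q)"]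
      by (auto simp: horner_coeffs_pCons[OF b] scale_add_coeff simp del: coeffs_pCons_eq_cCons coeffs_smult)
  qed (use x in auto)
qed

text \<open>Descent on an annihilating polynomial: a root \<open>l\<close> gives
  \<open>p = (X - l) q\<close> and \<open>(b - l) q(b) = 0\<close>. Either \<open>q(b)\<close> is
  nonzero and is the eigenvector, for left multiplication by \<open>b\<close>, or \<open>q\<close>
  annihilates \<open>b\<close> and has smaller degree. A nonzero constant cannot annihilate because
  \<open>1\<close> is nonzero.\<close>

lemma eigenvector:
  assumes b: "morph C b x x" and fd: "fin_dim_hom C x x" and nz: "ident C x \<noteq> hzero C x x"
  shows "\<exists>l w. morph C w x x \<and> w \<noteq> hzero C x x \<and> b \<cdot> w = hscale C l w"
proof -
  have x: "x \<in> Obj C" using morph_objs[OF b] by simp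
  have "\<exists>l w. morph C w x x \<and> w \<noteq> hzero C x x \<and> b \<cdot> w = hscale C l w"
    if "p \<noteq> 0" "horner C x b (coeffs p) = hzero C x x" for p
    using that
  proof (induction "degree p" arbitrary: p rule: less_induct)
    case less
    show ?case
    proof (cases "degree p = 0")
      case True
      then obtain c where c: "p = [:c:]" using degree_eq_zeroE by blast
      with less.prems have "c \<noteq> 0" by simp
      with less.prems(2) c nz x b scale_eq_zero[of "ident C x" c] show ?thesis by simp
    next
      case False
      then obtain l where "poly p l = 0"
        using fundamental_theorem_of_algebra[of p] constant_degree[of p] by auto
      then obtain q where q: "p = [:- l, 1:] * q" by (auto simp: poly_eq_0_iff_dvd)
      with less.prems have q0: "q \<noteq> 0" by auto
      then have dq: "degree q < degree p" unfolding q by (subst degree_mult_eq) auto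
      let ?w = "horner C x b (coeffs q)"
      have w: "morph C ?w x x" using morph_horner[OF b] .
      have "p = smult (- l) q + pCons 0 q" using q by simp
      then have "horner C x b (coeffs p) =
          hadd C (hscale C (- l) ?w) (b \<cdot> ?w)"
        using b w x
        by (simp only: horner_coeffs_add[OF b] horner_coeffs_smult[OF b] horner_coeffs_pCons[OF b])
          simp
      with less.prems(2) have "hscale C (- l) ?w = hscale C (- 1) (b \<cdot> ?w)"
        using b w by (intro eq_neg_of_add_zero[of _ x x]) auto
      from arg_cong[OF this, of "hscale C (- 1)"] have "b \<cdot> ?w = hscale C l ?w" using w b by simp
      then show ?thesis using less.hyps[OF dq q0] w by blast
    qed
  qed
  moreover obtain cs where cs: "\<exists>c\<in>set cs. c \<noteq> 0" "horner C x b cs = hzero C x x"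
    using annihilating_polynomial[OF b fd] by blast
  moreover have "Poly cs \<noteq> 0"
    using cs(1) Poly_eq_0 by (metis in_set_replicate)
  ultimately show ?thesis using horner_coeffs_Poly[OF b, of cs] by metis
qed

lemma selfadjoint_kernel_projection:
  assumes b: "morph C b x x" "hadj C b = b" and fd: "fin_dim_hom C x x"
  shows "\<exists>e. morph C e x x \<and> e \<cdot> e = e \<and> hadj C e = e \<and> b \<cdot> e = hzero C x x \<and>
    (\<forall>w. morph C w x x \<longrightarrow> b \<cdot> w = hzero C x x \<longrightarrow> e \<cdot> w = w)"
proof -
  have x: "x \<in> Obj C" using morph_objs[OF b(1)] by simp
  obtain s where s: "morph C s x x" "s \<cdot> b = b \<cdot> s" "b \<cdot> (b \<cdot> s) = b"
    using selfadjoint_pseudoinverse[OF b fd] by blast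
  define e where "e = hadd C (ident C x) (hscale C (- 1) (s \<cdot> b))"
  have e: "morph C e x x" using x b s by (simp add: e_def)
  have be: "b \<cdot> e = hzero C x x" using x b s by (simp add: e_def)
  have fixed: "e \<cdot> w = w" if "morph C w x x" "b \<cdot> w = hzero C x x" for w
  proof -
    have "e \<cdot> w = hadd C w (hscale C (- 1) (s \<cdot> (b \<cdot> w)))"
      using x b(1) s(1) that(1) by (simp add: e_def)
    then show ?thesis using x s(1) that by simp
  qed
  have ee: "e \<cdot> e = e" using fixed e be by blast
  \<comment> \<open>\<open>s\<close> is not known to be self-adjoint. Moving its adjoint past
    \<open>b\<close> gives \<open>e* e = e\<close>, whose left side is self-adjoint; hence so is
    \<open>e\<close>.\<close>
  have "b \<cdot> hadj C s = hadj C s \<cdot> b"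
    using arg_cong[OF s(2), of "hadj C"] b s(1) by simp
  then have "hadj C e = hadd C (ident C x) (hscale C (- 1) (hadj C s \<cdot> b))"
    using x b s(1) by (simp add: e_def adj_ident)
  then have "hadj C e \<cdot> e = hadd C e (hscale C (- 1) (hadj C s \<cdot> (b \<cdot> e)))"
    using x b(1) s(1) e by simp
  then have adj: "hadj C e \<cdot> e = e" using x s(1) e be by simp
  have "hadj C e = hadj C (hadj C e \<cdot> e)" using adj by simp
  also have "\<dots> = hadj C e \<cdot> e" using e by simp
  also note adj
  finally have "hadj C e = e" .
  with e ee be fixed show ?thesis by blast
qed

text \<open>A nonscalar self-adjoint \<open>h\<close> has a real eigenvalue \<open>l\<close>. The
  projection onto the kernel of \<open>h - l\<close> fixes an eigenvector, so it is not
  \<open>0\<close>; and \<open>h - l\<close> is nonzero, so it is not \<open>1\<close>.\<close>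

lemma nonscalar_projection:
  assumes x: "x \<in> Obj C" and fd: "fin_dim_hom C x x" and nz: "ident C x \<noteq> hzero C x x"
    and a: "morph C a x x" "\<And>c. a \<noteq> hscale C c (ident C x)"
  shows "\<exists>e. morph C e x x \<and> e \<cdot> e = e \<and> hadj C e = e \<and> e \<noteq> hzero C x x \<and> e \<noteq> ident C x"
proof -
  \<comment> \<open>Up to scalars these are the real and imaginary parts of \<open>a\<close>; if
    both were scalar, \<open>a\<close> would be.\<close>
  let ?r = "hadd C a (hadj C a)" and ?i = "hscale C \<i> (hadd C a (hscale C (- 1) (hadj C a)))"
  have "\<exists>h. morph C h x x \<and> hadj C h = h \<and> (\<forall>c. h \<noteq> hscale C c (ident C x))"
  proof (rule ccontr)
    assume *: "\<not> ?thesis"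
    have "hadj C ?r = ?r" "hadj C ?i = ?i"
      using a(1) add_comm[of a "hadj C a"] add_comm[of "hscale C \<i> a" "hscale C (- \<i>) (hadj C a)"]
      by simp_all
    moreover have "morph C ?r x x" "morph C ?i x x" using a(1) by simp_all
    ultimately obtain c d where cd: "?r = hscale C c (ident C x)" "?i = hscale C d (ident C x)"
      using * by metis
    have "hadd C ?r (hscale C (- \<i>) ?i) = hscale C 2 a"
      using a(1) add_add_swap[of a x x "hadj C a" a "hscale C (- 1) (hadj C a)"]
        scale_add_coeff[of a 1 1] by simp
    then have "hscale C 2 a = hscale C (c + - \<i> * d) (ident C x)"
      unfolding cd using x by (simp add: scale_add_coeff[symmetric])
    from arg_cong[OF this, of "hscale C (1 / 2)"] show False using a x by simp
  qed
  then obtain h where h: "morph C h x x" "hadj C h = h" "\<And>c. h \<noteq> hscale C c (ident C x)"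
    by blast
  obtain l w where w: "morph C w x x" "w \<noteq> hzero C x x" "h \<cdot> w = hscale C l w"
    using eigenvector[OF h(1) fd nz] by blast
  have ww: "hadj C w \<cdot> w \<noteq> hzero C x x" using adj_cmp_self_zero[of w] w by auto
  \<comment> \<open>\<open>w* h w\<close> is self-adjoint and equals \<open>l w* w\<close>, while
    \<open>w* w\<close> is nonzero. So \<open>l\<close> is real, and \<open>h - l\<close> is
    self-adjoint.\<close>
  have "hscale C (cnj l) (hadj C w \<cdot> w) = hadj C (hadj C w \<cdot> (h \<cdot> w))"
    using w by simp
  also have "\<dots> = hadj C w \<cdot> (h \<cdot> w)" using w(1) h(1,2) by simp
  also have "\<dots> = hscale C l (hadj C w \<cdot> w)" using w by simp
  finally have "hscale C (l - cnj l) (hadj C w \<cdot> w) = hzero C x x"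
    using w scale_add_coeff[of "hadj C w \<cdot> w" l "- cnj l"]
      scale_scale_arr[of "hadj C w \<cdot> w" "- 1" "cnj l"] add_neg[of "hscale C l (hadj C w \<cdot> w)"]
    by (simp del: scale_scale_arr)
  with ww w(1) have "l - cnj l = 0"
    using scale_eq_zero[of "hadj C w \<cdot> w" "l - cnj l"] by auto
  then have l: "cnj l = l" by simp
  define b where "b = hadd C h (hscale C (- l) (ident C x))"
  have b: "morph C b x x" "hadj C b = b" using x h l by (simp_all add: b_def)
  have bw: "b \<cdot> w = hzero C x x"
    using x w h(1) scale_add_coeff[of w l "- l"] by (simp add: b_def)
  have "b \<noteq> hzero C x x"
  proof
    assume "b = hzero C x x"
    then have "h = hscale C (- 1) (hscale C (- l) (ident C x))"
      using x h unfolding b_def by (intro eq_neg_of_add_zero[of _ x x]) auto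
    with h(3)[of l] x show False by simp
  qed
  obtain e where e: "morph C e x x" "e \<cdot> e = e" "hadj C e = e" "b \<cdot> e = hzero C x x"
    and fixed: "\<And>w. morph C w x x \<Longrightarrow> b \<cdot> w = hzero C x x \<Longrightarrow> e \<cdot> w = w"
    using selfadjoint_kernel_projection[OF b fd] by blast
  have "e \<noteq> hzero C x x" using fixed[OF w(1) bw] w x by auto
  moreover have "e \<noteq> ident C x" using e(4) b \<open>b \<noteq> hzero C x x\<close> by auto
  ultimately show ?thesis using e by blast
qed

end

section \<open>Objects generating a category\<close>

text \<open>Statements about finite sums \<open>\<Sum>\<^sub>i g\<^sub>if\<^sub>i\<close> become inductions over this closure;
  a closure of pairs records the image of such a sum under a map that is only known on the
  summands.\<close>

inductive_set addspan :: "('a \<Rightarrow> 'a \<Rightarrow> 'a) \<Rightarrow> 'a set \<Rightarrow> 'a set"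
  for add :: "'a \<Rightarrow> 'a \<Rightarrow> 'a" and G :: "'a set" where
  base: "a \<in> G \<Longrightarrow> a \<in> addspan add G"
| add: "\<lbrakk>a \<in> addspan add G; b \<in> addspan add G\<rbrakk> \<Longrightarrow> add a b \<in> addspan add G"

lemma addspan_least:
  assumes "G \<subseteq> addspan add G'" shows "addspan add G \<subseteq> addspan add G'"
proof
  fix a assume "a \<in> addspan add G"
  then show "a \<in> addspan add G'"
    by induction (use assms addspan.add in auto)
qed

text \<open>\<open>P\<close> is a typing invariant: in the applications \<open>\<phi>\<close> is
  additive only on morphisms with the right source and target, so typing is carried along the
  induction.\<close>

lemma addspan_image:
  assumes a: "a \<in> addspan add G"
    and base: "\<And>a. a \<in> G \<Longrightarrow> P a \<and> \<phi> a \<in> addspan add' G'"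
    and P_add: "\<And>a b. P a \<Longrightarrow> P b \<Longrightarrow> P (add a b)"
    and hom: "\<And>a b. P a \<Longrightarrow> P b \<Longrightarrow> \<phi> (add a b) = add' (\<phi> a) (\<phi> b)"
  shows "\<phi> a \<in> addspan add' G'"
proof -
  from a have "P a \<and> \<phi> a \<in> addspan add' G'"
    by induction (use base P_add hom addspan.add[of _ add'] in auto)
  then show ?thesis ..
qed

text \<open>In the presence of finite direct sums, this says that \<open>x\<close> is a retract of a
  finite multiple of \<open>z\<close>. The span contains no empty sum; a zero object is covered by
  the zero maps to and from \<open>z\<close>.\<close>

definition generates :: "('o, 'm) ccat \<Rightarrow> 'o \<Rightarrow> 'o \<Rightarrow> bool" where
  "generates C z x \<longleftrightarrow>
     ident C x \<in> addspan (hadd C) {g \<cdot>\<^bsub>C\<^esub> f | f g. morph C f x z \<and> morph C g z x}"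

context cstar_category
begin

text \<open>Summands \<open>q (g f) p\<close> are regrouped as \<open>(q g) (f p)\<close>. A
  decomposition of the identity of \<open>w\<close> thus becomes one of \<open>q p\<close>, both for
  transitivity and for orthogonal sums.\<close>

lemma addspan_sandwich:
  assumes a: "a \<in> addspan (hadd C) {g \<cdot> f | f g. morph C f w z \<and> morph C g z w}"
    and p: "morph C p x w" and q: "morph C q w x"
  shows "q \<cdot> (a \<cdot> p) \<in> addspan (hadd C) {g \<cdot> f | f g. morph C f x z \<and> morph C g z x}"
  using a
proof (rule addspan_image[where P = "\<lambda>a. morph C a w w"])
  fix a assume "a \<in> {g \<cdot> f | f g. morph C f w z \<and> morph C g z w}"
  then obtain f g where fg: "a = g \<cdot> f" "morph C f w z" "morph C g z w" by blast
  then have "q \<cdot> (a \<cdot> p) = (q \<cdot> g) \<cdot> (f \<cdot> p)" using p q by simp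
  moreover have "morph C (f \<cdot> p) x z" "morph C (q \<cdot> g) z x" using fg p q by simp_all
  ultimately have "q \<cdot> (a \<cdot> p) \<in> {g \<cdot> f | f g. morph C f x z \<and> morph C g z x}" by blast
  with fg show "morph C a w w \<and>
      q \<cdot> (a \<cdot> p) \<in> addspan (hadd C) {g \<cdot> f | f g. morph C f x z \<and> morph C g z x}"
    by (simp add: addspan.base)
qed (use p q in simp_all)

lemma generates_trans:
  assumes zw: "generates C z w" and wx: "generates C w x"
  shows "generates C z x"
proof -
  have "{g \<cdot> f | f g. morph C f x w \<and> morph C g w x} \<subseteq>
      addspan (hadd C) {g \<cdot> f | f g. morph C f x z \<and> morph C g z x}"
  proof
    fix a assume "a \<in> {g \<cdot> f | f g. morph C f x w \<and> morph C g w x}"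
    then obtain f g where fg: "a = g \<cdot> f" "morph C f x w" "morph C g w x" by blast
    have "g \<cdot> (ident C w \<cdot> f) \<in> addspan (hadd C) {g \<cdot> f | f g. morph C f x z \<and> morph C g z x}"
      using zw[unfolded generates_def] fg(2,3) by (rule addspan_sandwich)
    then show "a \<in> addspan (hadd C) {g \<cdot> f | f g. morph C f x z \<and> morph C g z x}"
      using fg by simp
  qed
  from addspan_least[OF this] show ?thesis using wx unfolding generates_def by blast
qed

lemma generates_retract:
  assumes "morph C f x w" "morph C g w x" "g \<cdot> f = ident C x"
  shows "generates C w x"
  unfolding generates_def assms(3)[symmetric] by (rule addspan.base) (use assms in blast)

lemma generates_zero_object:
  assumes "x \<in> Obj C" "z \<in> Obj C" "ident C x = hzero C x x"
  shows "generates C z x"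
  by (rule generates_retract[of "hzero C x z" x z "hzero C z x"]) (use assms in simp_all)

lemma generates_orthogonal_sum:
  assumes y: "generates C z y" "morph C u y x" and y': "generates C z y'" "morph C u' y' x"
    and sum: "hadd C (u \<cdot> hadj C u) (u' \<cdot> hadj C u') = ident C x"
  shows "generates C z x"
proof -
  have "u \<cdot> (ident C y \<cdot> hadj C u) \<in> addspan (hadd C) {g \<cdot> f | f g. morph C f x z \<and> morph C g z x}"
    by (rule addspan_sandwich[OF y(1)[unfolded generates_def]]) (use y(2) in simp_all)
  moreover have "u' \<cdot> (ident C y' \<cdot> hadj C u') \<in>
      addspan (hadd C) {g \<cdot> f | f g. morph C f x z \<and> morph C g z x}"
    by (rule addspan_sandwich[OF y'(1)[unfolded generates_def]]) (use y'(2) in simp_all)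
  ultimately have "hadd C (u \<cdot> (ident C y \<cdot> hadj C u)) (u' \<cdot> (ident C y' \<cdot> hadj C u')) \<in>
      addspan (hadd C) {g \<cdot> f | f g. morph C f x z \<and> morph C g z x}"
    by (rule addspan.add)
  then show ?thesis
    unfolding generates_def using y(2) y'(2) sum by simp
qed

text \<open>The maximal length of such a family measures the size of \<open>x\<close>; it takes the
  place of the dimension of the endomorphism algebra in the induction over subobjects.\<close>

definition orthogonal_idempotents :: "'o \<Rightarrow> nat \<Rightarrow> (nat \<Rightarrow> 'm) \<Rightarrow> bool" where
  "orthogonal_idempotents x n e \<longleftrightarrow> (\<forall>i<n. morph C (e i) x x \<and> e i \<noteq> hzero C x x \<and>
     (\<forall>j<n. e i \<cdot> e j = (if i = j then e i else hzero C x x)))"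

text \<open>Nonzero orthogonal idempotents are linearly independent: composing a relation with
  \<open>e p\<close> leaves only \<open>c p\<close> times \<open>e p\<close>.\<close>

lemma orthogonal_idempotents_bounded:
  assumes x: "x \<in> Obj C" and fd: "fin_dim_hom C x x"
  shows "\<exists>n. \<forall>e. \<not> orthogonal_idempotents x (Suc n) e"
proof -
  obtain n where n: "\<And>e. (\<forall>i\<le>n. morph C (e i) x x) \<Longrightarrow>
    \<exists>c. (\<exists>i\<le>n. c i \<noteq> 0) \<and> hsum C x x (map (\<lambda>i. hscale C (c i) (e i)) [0..<Suc n]) = hzero C x x"
    using fin_dim_dependence[OF x x fd] by blast
  have False if e: "orthogonal_idempotents x (Suc n) e" for e
  proof -
    have m: "morph C (e i) x x" "e i \<noteq> hzero C x x" if "i \<le> n" for i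
      using e that by (auto simp: orthogonal_idempotents_def)
    have ee: "e i \<cdot> e j = (if i = j then e i else hzero C x x)" if "i \<le> n" "j \<le> n" for i j
      using e that by (auto simp: orthogonal_idempotents_def)
    obtain c p where c: "p \<le> n" "c p \<noteq> 0"
        "hsum C x x (map (\<lambda>i. hscale C (c i) (e i)) [0..<Suc n]) = hzero C x x"
      using n[of e] m by blast
    have "hsum C x x (map (\<lambda>i. hscale C (c i) (e i)) is) \<cdot> e p =
        (if p \<in> set is then hscale C (c p) (e p) else hzero C x x)"
      if "set is \<subseteq> {..n}" "distinct is" for "is"
      using that
    proof (induction "is")
      case (Cons i "is")
      have "morph C (hsum C x x (map (\<lambda>i. hscale C (c i) (e i)) is)) x x"
        by (rule morph_hsum[OF x x]) (use Cons.prems m in auto)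
      with Cons show ?case using x m c(1) ee[of i p] by auto
    qed (use x m c(1) in simp)
    from this[of "[0..<Suc n]"] have "hzero C x x \<cdot> e p = hscale C (c p) (e p)"
      using c by (simp add: subset_iff del: upt_Suc)
    then have "hscale C (c p) (e p) = hzero C x x" using x m[OF c(1)] by simp
    then show False using scale_eq_zero[of "e p" "c p"] m[OF c(1)] c(2) by simp
  qed
  then show ?thesis by blast
qed

text \<open>Conjugating by \<open>u\<close> carries the family to \<open>x\<close>, and
  \<open>1 - u u*\<close> is orthogonal to all of it and nonzero since \<open>u\<close> is not
  unitary. The gain of one makes the splitting into subobjects terminate.\<close>

lemma orthogonal_idempotents_subobject:
  assumes u: "morph C u y x" "hadj C u \<cdot> u = ident C y" "u \<cdot> hadj C u \<noteq> ident C x"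
    and e: "orthogonal_idempotents y n e"
  shows "\<exists>e'. orthogonal_idempotents x (Suc n) e'"
proof -
  have xy: "x \<in> Obj C" "y \<in> Obj C" using morph_objs[OF u(1)] by auto
  have uu: "hadj C u \<cdot> (u \<cdot> f) = f" if "morph C f z y" for f z
    using assoc[of f u "hadj C u"] u that by simp
  define p where "p = hadd C (ident C x) (hscale C (- 1) (u \<cdot> hadj C u))"
  have p: "morph C p x x" using xy u(1) by (simp add: p_def)
  have p0: "p \<noteq> hzero C x x"
    using eq_of_diff_zero[of "ident C x" x x "u \<cdot> hadj C u"] u xy by (auto simp: p_def)
  have pu: "p \<cdot> (u \<cdot> f) = hzero C z x" if "morph C f z y" for f z
    using that xy u uu[of "hadj C u" x] uu[OF that] morph_objs[OF that] by (simp add: p_def)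
  have up: "hadj C u \<cdot> p = hzero C x y"
    using xy u uu[of "hadj C u" x] by (simp add: p_def)
  have pp: "p \<cdot> p = p"
    using pu[of "hadj C u" x] xy u(1) p by (subst (2) p_def) simp
  have m: "morph C (e i) y y" "e i \<noteq> hzero C y y" if "i < n" for i
    using e that by (auto simp: orthogonal_idempotents_def)
  have ee: "e i \<cdot> e j = (if i = j then e i else hzero C y y)" if "i < n" "j < n" for i j
    using e that by (auto simp: orthogonal_idempotents_def)
  define e' where "e' i = (if i < n then u \<cdot> (e i \<cdot> hadj C u) else p)" for i
  have nz: "u \<cdot> (e i \<cdot> hadj C u) \<noteq> hzero C x x" if "i < n" for i
  proof
    assume "u \<cdot> (e i \<cdot> hadj C u) = hzero C x x"
    then have "hadj C u \<cdot> ((u \<cdot> (e i \<cdot> hadj C u)) \<cdot> u) = hzero C y y"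
      using xy u(1) by simp
    then have "e i = hzero C y y"
      using m[OF that] u uu[of "e i" y] by simp
    with m[OF that] show False by simp
  qed
  have "orthogonal_idempotents x (Suc n) e'"
    unfolding orthogonal_idempotents_def
  proof (intro allI impI)
    fix i assume i: "i < Suc n"
    have "morph C (e' i) x x" using m[of i] u(1) p by (simp add: e'_def)
    moreover have "e' i \<noteq> hzero C x x" using nz[of i] p0 by (simp add: e'_def)
    moreover have "e' i \<cdot> e' j = (if i = j then e' i else hzero C x x)" if j: "j < Suc n" for j
    proof (cases "i < n"; cases "j < n")
      assume "i < n" "j < n"
      note ij = m[OF \<open>i < n\<close>] m[OF \<open>j < n\<close>] ee[OF \<open>i < n\<close> \<open>j < n\<close>]
      have "(u \<cdot> (e i \<cdot> hadj C u)) \<cdot> (u \<cdot> (e j \<cdot> hadj C u)) = u \<cdot> (e i \<cdot> (e j \<cdot> hadj C u))"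
        using ij(1,3) u(1) uu[of "e j \<cdot> hadj C u" x] by simp
      also have "\<dots> = u \<cdot> ((e i \<cdot> e j) \<cdot> hadj C u)" using ij(1,3) u(1) by simp
      also have "\<dots> = (if i = j then u \<cdot> (e i \<cdot> hadj C u) else hzero C x x)"
        unfolding ij(5) using ij(1) u(1) xy by simp
      finally show ?thesis using \<open>i < n\<close> \<open>j < n\<close> by (simp add: e'_def)
    next
      assume "i < n" "\<not> j < n"
      then show ?thesis using m[of i] u(1) p up xy j by (simp add: e'_def)
    next
      assume "\<not> i < n" "j < n"
      then show ?thesis using m[of j] u(1) p pu[of "e j \<cdot> hadj C u" x] xy i by (simp add: e'_def)
    next
      assume "\<not> i < n" "\<not> j < n"
      then show ?thesis using i j pp by (simp add: e'_def)
    qed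
    ultimately show "morph C (e' i) x x \<and> e' i \<noteq> hzero C x x \<and>
        (\<forall>j<Suc n. e' i \<cdot> e' j = (if i = j then e' i else hzero C x x))"
      by blast
  qed
  then show ?thesis by blast
qed

end

section \<open>The sum of the simple objects generates\<close>

context finite_semisimple
begin

text \<open>\<open>x\<close> is isomorphic to some \<open>v\<close> in \<open>V\<close>, which is a
  retract of \<open>z\<close> through its structure isometry \<open>u\<close>.\<close>

lemma dsum_generates_simple:
  assumes V: "simple_reps C V" and z: "is_dsum_set C V z" and x: "simple_obj C x"
  shows "generates C z x"
proof -
  obtain v where v: "v \<in> V" "isomorphic C x v"
    using V x by (auto simp: simple_reps_def)
  have obj: "x \<in> Obj C" "v \<in> Obj C"
    using V x v by (auto simp: simple_reps_def simple_obj_def)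
  obtain f g where fg: "morph C f x v" "morph C g v x" "g \<cdot> f = ident C x"
    using v(2) obj unfolding isomorphic_def by auto
  obtain vs us where vs: "set vs = V" "z \<in> Obj C"
    and us: "\<And>i. i < length vs \<Longrightarrow> us ! i \<in> Hom C (vs ! i) z"
    "\<And>i j. i < length vs \<Longrightarrow> j < length vs \<Longrightarrow> hadj C (us ! i) \<cdot> us ! j =
            (if i = j then ident C (vs ! i) else hzero C (vs ! j) (vs ! i))"
    using z unfolding is_dsum_set_def is_dsum_def by blast
  obtain i where i: "i < length vs" "vs ! i = v" using v(1) vs(1) by (metis in_set_conv_nth)
  define u where "u = us ! i"
  have u: "morph C u v z" "hadj C u \<cdot> u = ident C v"
    using us(1)[OF i(1)] us(2)[OF i(1) i(1)] i(2) obj vs(2) by (auto simp: u_def)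
  show ?thesis
  proof (rule generates_retract)
    show "morph C (u \<cdot> f) x z" "morph C (g \<cdot> hadj C u) z x" using u fg by simp_all
    have "hadj C u \<cdot> (u \<cdot> f) = f" using assoc[of f u "hadj C u"] u fg by simp
    then show "(g \<cdot> hadj C u) \<cdot> (u \<cdot> f) = ident C x" using u(1) fg by simp
  qed
qed

text \<open>A nonzero object that is not simple is split by a projection \<open>e\<close> and its
  complement \<open>d\<close> into two proper subobjects. Each admits only strictly shorter families
  of orthogonal idempotents, so induction applies to both.\<close>

lemma dsum_generates:
  assumes V: "simple_reps C V" and z: "is_dsum_set C V z" and x: "x \<in> Obj C"
  shows "generates C z x"
proof -
  have z_obj: "z \<in> Obj C" using z by (auto simp: is_dsum_set_def is_dsum_def)
  have "generates C z x" if "x \<in> Obj C" "\<forall>e. \<not> orthogonal_idempotents x (Suc n) e" for x n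
    using that
  proof (induction n arbitrary: x)
    case 0
    \<comment> \<open>At bound \<open>0\<close> there is no nonzero idempotent at all, so
      \<open>1\<close> itself vanishes.\<close>
    have "ident C x = hzero C x x"
    proof (rule ccontr)
      assume "ident C x \<noteq> hzero C x x"
      then have "orthogonal_idempotents x (Suc 0) (\<lambda>_. ident C x)"
        using 0(1) by (simp add: orthogonal_idempotents_def)
      with 0(2) show False by blast
    qed
    with 0 z_obj show ?case by (intro generates_zero_object)
  next
    case (Suc n)
    have fd: "fin_dim_hom C x x" using fin_dim Suc.prems(1) by blast
    consider "ident C x = hzero C x x" | "simple_obj C x"
      | a where "ident C x \<noteq> hzero C x x" "morph C a x x" "\<And>c. a \<noteq> hscale C c (ident C x)"
    proof (cases "ident C x = hzero C x x \<or> simple_obj C x")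
      case False
      then have nz: "ident C x \<noteq> hzero C x x" "Hom C x x \<noteq> range (\<lambda>c. hscale C c (ident C x))"
        using Suc.prems(1) by (auto simp: simple_obj_def)
      moreover have "range (\<lambda>c. hscale C c (ident C x)) \<subseteq> Hom C x x"
        using Suc.prems(1) by auto
      ultimately obtain a where "a \<in> Hom C x x" "a \<notin> range (\<lambda>c. hscale C c (ident C x))" by blast
      then show ?thesis using that(3)[of a] nz(1) Suc.prems(1) by auto
    qed (use that in blast)
    then show ?case
    proof cases
      case 1 with Suc.prems z_obj show ?thesis by (intro generates_zero_object)
    next
      case 2 with V z show ?thesis by (rule dsum_generates_simple)
    next
      case 3
      obtain e where e: "morph C e x x" "e \<cdot> e = e" "hadj C e = e" "e \<noteq> hzero C x x" "e \<noteq> ident C x"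
        using nonscalar_projection[OF Suc.prems(1) fd 3] by blast
      define d where "d = hadd C (ident C x) (hscale C (- 1) e)"
      have d: "morph C d x x" "d \<cdot> d = d" "hadj C d = d" 
        using e(1-3) Suc.prems(1) by (simp_all add: d_def)
      have sum: "hadd C e d = ident C x"
        using e(1) Suc.prems(1) add_left_comm[of e "ident C x" "hscale C (- 1) e"] by (simp add: d_def)
      \<comment> \<open>Both ranges must be proper for the bound to drop; for \<open>d\<close> this
        is where \<open>e\<close> being nonzero enters.\<close>
      have "d \<noteq> ident C x"
      proof
        assume "d = ident C x"
        then have "e \<cdot> d = e" using e(1) by simp
        moreover have "e \<cdot> d = hzero C x x" using e(1,2) Suc.prems(1) by (simp add: d_def)
        ultimately show False using e(4) by simp
      qed
      have sub: "\<exists>y u. generates C z y \<and> morph C u y x \<and> u \<cdot> hadj C u = p"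
        if p: "morph C p x x" "p \<cdot> p = p" "hadj C p = p" "p \<noteq> ident C x" for p
      proof -
        have "p \<in> Hom C x x" using p(1) Suc.prems(1) by simp
        from subobjects[OF Suc.prems(1) this p(2,3)] obtain y u where yu: "y \<in> Obj C"
            "u \<in> Hom C y x" "hadj C u \<cdot> u = ident C y" "u \<cdot> hadj C u = p"
          by blast
        then have u: "morph C u y x" using Suc.prems(1) by simp
        have "generates C z y"
          using Suc.IH[OF yu(1)] orthogonal_idempotents_subobject[OF u yu(3)] yu(4) p(4) Suc.prems(2)
          by blast
        with u yu(4) show ?thesis by blast
      qed
      obtain y u where yu: "generates C z y" "morph C u y x" "u \<cdot> hadj C u = e"
        using sub[OF e(1-3,5)] by blast
      obtain y' u' where yu': "generates C z y'" "morph C u' y' x" "u' \<cdot> hadj C u' = d"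
        using sub[OF d \<open>d \<noteq> ident C x\<close>] by blast
      show ?thesis
        using generates_orthogonal_sum[OF yu(1,2) yu'(1,2)] yu(3) yu'(3) sum by simp
    qed
  qed
  moreover obtain n where "\<forall>e. \<not> orthogonal_idempotents x (Suc n) e"
    using orthogonal_idempotents_bounded[OF x fin_dim[OF x x]] by blast
  ultimately show ?thesis using x by blast
qed

end

section \<open>Functors\<close>

locale cstar_functor = S: cstar_category C + T: cstar_category D + star_functor C D F
  for C :: "('o, 'm) ccat" and D :: "('p, 'n) ccat" and F :: "('o, 'm, 'p, 'n) fctr"
begin

lemma far_morph [simp]:
  assumes "arr C f"
  shows "arr D (far F f)" "src D (far F f) = fob F (src C f)" "tgt D (far F f) = fob F (tgt C f)"
  using far_in[of "src C f" "tgt C f" f] fob_in[of "src C f"] fob_in[of "tgt C f"] assms by auto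

declare fob_in [simp] far_id [simp]

lemma far_cmp_arr [simp]:
  "\<lbrakk>arr C f; arr C g; src C g = tgt C f\<rbrakk> \<Longrightarrow> far F (g \<cdot>\<^bsub>C\<^esub> f) = far F g \<cdot>\<^bsub>D\<^esub> far F f"
  using far_cmp[of "src C f" "tgt C f" "tgt C g" f g]
    S.src_obj[of f] S.tgt_obj[of f] S.tgt_obj[of g] by auto

lemma far_add_arr [simp]:
  "\<lbrakk>arr C f; arr C g; src C g = src C f; tgt C g = tgt C f\<rbrakk>
    \<Longrightarrow> far F (hadd C f g) = hadd D (far F f) (far F g)"
  using far_add[of "src C f" "tgt C f" f g] S.src_obj[of f] S.tgt_obj[of f] by auto

lemma far_scale_arr [simp]: "arr C f \<Longrightarrow> far F (hscale C a f) = hscale D a (far F f)"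
  using far_scale[OF _ _ S.arr_hom] by auto

lemma far_adj_arr [simp]: "arr C f \<Longrightarrow> far F (hadj C f) = hadj D (far F f)"
  using far_adj[OF _ _ S.arr_hom] by auto

lemma far_zero [simp]:
  assumes "x \<in> Obj C" "y \<in> Obj C" shows "far F (hzero C x y) = hzero D (fob F x) (fob F y)"
  using far_scale_arr[of "hzero C x y" 0] assms by simp

lemma faithful_inj:
  assumes "faithful C F" "morph C f x y" "morph C g x y" "far F f = far F g"
  shows "f = g"
proof -
  have "x \<in> Obj C" "y \<in> Obj C" using S.morph_objs[OF assms(2)] by simp_all
  then show ?thesis using assms unfolding faithful_def inj_on_def by (metis S.hom_iff)
qed

lemma generates_image:
  assumes "generates C z x"
  shows "generates D (fob F z) (fob F x)"
proof -
  have "far F (ident C x) \<in> addspan (hadd D)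
      {g \<cdot>\<^bsub>D\<^esub> f | f g. morph D f (fob F x) (fob F z) \<and> morph D g (fob F z) (fob F x)}"
    using assms[unfolded generates_def]
  proof (rule addspan_image[where P = "\<lambda>a. morph C a x x"])
    fix a assume "a \<in> {g \<cdot>\<^bsub>C\<^esub> f | f g. morph C f x z \<and> morph C g z x}"
    then obtain f g where fg: "a = g \<cdot>\<^bsub>C\<^esub> f" "morph C f x z" "morph C g z x" by blast
    then have "far F a = far F g \<cdot>\<^bsub>D\<^esub> far F f" "morph D (far F f) (fob F x) (fob F z)"
        "morph D (far F g) (fob F z) (fob F x)"
      by simp_all
    then have "far F a \<in> {g \<cdot>\<^bsub>D\<^esub> f | f g.
        morph D f (fob F x) (fob F z) \<and> morph D g (fob F z) (fob F x)}" by blast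
    with fg show "morph C a x x \<and> far F a \<in> addspan (hadd D)
        {g \<cdot>\<^bsub>D\<^esub> f | f g. morph D f (fob F x) (fob F z) \<and> morph D g (fob F z) (fob F x)}"
      by (simp add: addspan.base)
  qed simp_all
  moreover have "x \<in> Obj C"
  proof -
    have "\<exists>f g. morph C f x z \<and> morph C g z x"
      using assms[unfolded generates_def] by (induction rule: addspan.induct) auto
    then show ?thesis by auto
  qed
  ultimately show ?thesis unfolding generates_def by simp
qed

text \<open>Faithfulness of the adjoint \<open>G\<close> says that the counit is an epimorphism
  \<open>\<epsilon>\<^sub>y : F (G y) \<rightarrow> y\<close>, so \<open>\<epsilon>\<^sub>y\<epsilon>\<^sub>y\<^sup>*\<close> is cancellable, hence invertible.\<close>

lemma adjoint_retract:
  assumes fd: "fin_dim_hom D y y" and y: "y \<in> Obj D"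
    and adj: "is_adjoint C D F G" and faithful: "faithful D G"
  shows "\<exists>z\<in>Obj C. \<exists>f g. morph D f y (fob F z) \<and> morph D g (fob F z) y \<and> g \<cdot>\<^bsub>D\<^esub> f = ident D y"
proof -
  interpret G: cstar_functor D C G
    using adj S.cstar_category_axioms T.cstar_category_axioms
    by (simp add: is_adjoint_def cstar_functor_def)
  obtain \<eta> \<epsilon> where \<eta>: "\<eta> \<in> NT C C fid (fcomp G F)" and \<epsilon>: "\<epsilon> \<in> NT D D (fcomp F G) fid"
    and triangle: "far G (\<epsilon> y) \<cdot>\<^bsub>C\<^esub> \<eta> (fob G y) = ident C (fob G y)"
    using adj y unfolding is_adjoint_def by blast
  define z where "z = fob G y"
  have z: "z \<in> Obj C" using y by (simp add: z_def)
  have \<epsilon>y: "morph D (\<epsilon> y) (fob F z) y"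
    using \<epsilon> y z unfolding NT_def by (auto simp: fcomp_def fid_def z_def dest!: PiE_mem)
  have \<eta>z: "morph C (\<eta> z) z (fob G (fob F z))"
    using \<eta> z unfolding NT_def by (auto simp: fcomp_def fid_def dest!: PiE_mem)
  \<comment> \<open>Transposition along the adjunction: by the triangle identity
    \<open>G a = G (a \<epsilon>_y) \<eta>_z\<close>, which vanishes, and \<open>G\<close> is
    faithful.\<close>
  have epi: "a = hzero D y y" if a: "morph D a y y" "a \<cdot>\<^bsub>D\<^esub> \<epsilon> y = hzero D (fob F z) y" for a
  proof -
    have "far G a = far G (a \<cdot>\<^bsub>D\<^esub> \<epsilon> y) \<cdot>\<^bsub>C\<^esub> \<eta> z"
      using a(1) \<epsilon>y \<eta>z triangle by (simp add: z_def)
    also have "\<dots> = far G (hzero D y y)"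
      unfolding a(2) using y z \<eta>z by (simp add: z_def)
    finally show ?thesis using G.faithful_inj[OF faithful a(1)] y by simp
  qed
  have "\<exists>s. morph D s y y \<and> (\<epsilon> y \<cdot>\<^bsub>D\<^esub> hadj D (\<epsilon> y)) \<cdot>\<^bsub>D\<^esub> s = ident D y"
  proof (rule T.selfadjoint_cancellable_invertible[OF _ _ fd])
    fix a assume a: "morph D a y y" "(\<epsilon> y \<cdot>\<^bsub>D\<^esub> hadj D (\<epsilon> y)) \<cdot>\<^bsub>D\<^esub> a = hzero D y y"
    \<comment> \<open>\<open>\<epsilon> \<epsilon>* a = 0\<close> gives \<open>w* w = 0\<close> for
      \<open>w = \<epsilon>* a\<close>; hence \<open>a* \<epsilon> = 0\<close>, to which the
      epimorphism property applies.\<close>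
    have "hadj D (hadj D (\<epsilon> y) \<cdot>\<^bsub>D\<^esub> a) \<cdot>\<^bsub>D\<^esub> (hadj D (\<epsilon> y) \<cdot>\<^bsub>D\<^esub> a) =
        hadj D a \<cdot>\<^bsub>D\<^esub> ((\<epsilon> y \<cdot>\<^bsub>D\<^esub> hadj D (\<epsilon> y)) \<cdot>\<^bsub>D\<^esub> a)"
      using a(1) \<epsilon>y by simp
    also have "\<dots> = hzero D y y" unfolding a(2) using a(1) y by simp
    finally have "hadj D (\<epsilon> y) \<cdot>\<^bsub>D\<^esub> a = hzero D y (fob F z)"
      using T.adj_cmp_self_zero[of "hadj D (\<epsilon> y) \<cdot>\<^bsub>D\<^esub> a"] a(1) \<epsilon>y by simp
    from arg_cong[OF this, of "hadj D"] have "hadj D a \<cdot>\<^bsub>D\<^esub> \<epsilon> y = hzero D (fob F z) y"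
      using a(1) \<epsilon>y y z by simp
    then have "hadj D a = hzero D y y" using a(1) by (intro epi) auto
    from arg_cong[OF this, of "hadj D"] show "a = hzero D y y" using a(1) y by simp
  qed (use \<epsilon>y in simp_all)
  then obtain s where s: "morph D s y y" "(\<epsilon> y \<cdot>\<^bsub>D\<^esub> hadj D (\<epsilon> y)) \<cdot>\<^bsub>D\<^esub> s = ident D y" by blast
  \<comment> \<open>The section is \<open>\<epsilon>* s\<close>, where \<open>s\<close> is a right
    inverse of \<open>\<epsilon> \<epsilon>*\<close>.\<close>
  show ?thesis
    by (rule bexI[OF _ z], rule exI[of _ "hadj D (\<epsilon> y) \<cdot>\<^bsub>D\<^esub> s"], rule exI[of _ "\<epsilon> y"])
      (use s \<epsilon>y in simp)
qed

end

locale bi_faithful_functor =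
  C: finite_semisimple C + D: finite_semisimple D
  for C :: "('o, 'm) ccat" and D :: "('p, 'n) ccat" and F :: "('o, 'm, 'p, 'n) fctr" +
  assumes bi_faithful: "bi_faithful C D F"
begin

sublocale cstar_functor C D F
  using bi_faithful C.cstar_category_axioms D.cstar_category_axioms
  by (simp add: bi_faithful_def cstar_functor_def)

lemma far_inj: "\<lbrakk>far F f = far F g; morph C f x y; morph C g x y\<rbrakk> \<Longrightarrow> f = g"
  using faithful_inj bi_faithful unfolding bi_faithful_def by blast

text \<open>The faithful adjoint makes every \<open>y\<close> a retract of some \<open>F x\<close>,
  and \<open>F\<close> carries a decomposition through \<open>z\<close> to one through
  \<open>F z\<close>.\<close>

lemma generates_step:
  assumes gen: "\<And>x. x \<in> Obj C \<Longrightarrow> generates C z x" and y: "y \<in> Obj D"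
  shows "generates D (fob F z) y"
proof -
  obtain G where G: "is_adjoint C D F G" "faithful D G"
    using bi_faithful unfolding bi_faithful_def by blast
  obtain x f g where x: "x \<in> Obj C" "morph D f y (fob F x)" "morph D g (fob F x) y"
      "g \<cdot>\<^bsub>D\<^esub> f = ident D y"
    using adjoint_retract[OF D.fin_dim[OF y y] y G] by blast
  show ?thesis
    using D.generates_trans[OF generates_image[OF gen[OF x(1)]] D.generates_retract[OF x(2-4)]] .
qed

end

lemma NT_naturality:
  "\<lbrakk>\<eta> \<in> NT C D F G; x \<in> Obj C; y \<in> Obj C; f \<in> Hom C x y\<rbrakk> \<Longrightarrow> \<eta> y \<cdot>\<^bsub>D\<^esub> far F f = far G f \<cdot>\<^bsub>D\<^esub> \<eta> x"
  by (simp add: NT_def)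

lemma NT_component: "\<lbrakk>\<eta> \<in> NT C D F G; x \<in> Obj C\<rbrakk> \<Longrightarrow> \<eta> x \<in> Hom D (fob F x) (fob G x)"
  by (auto simp: NT_def)

section \<open>Unions of increasing sequences\<close>

text \<open>Injective inclusions embed each stage into the union, so that equality of classes can be
  decided at any common level. In the application they come from faithfulness of the step functors
  and, for correspondences, unitarity of \<open>W\<close>.\<close>

locale dsystem =
  fixes S :: "'a dsys"
  assumes incl_stage: "a \<in> stage S k \<Longrightarrow> incl S k a \<in> stage S (Suc k)"
    and incl_inj: "\<lbrakk>a \<in> stage S k; b \<in> stage S k; incl S k a = incl S k b\<rbrakk> \<Longrightarrow> a = b"
begin

lemma transport_stage: "a \<in> stage S k \<Longrightarrow> transport S k j a \<in> stage S (k + j)"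
  by (induction j) (auto intro: incl_stage)

lemma transport_inj:
  "\<lbrakk>a \<in> stage S k; b \<in> stage S k; transport S k j a = transport S k j b\<rbrakk> \<Longrightarrow> a = b"
  by (induction j) (auto dest: incl_inj[OF transport_stage transport_stage])

lemma transport_add: "transport S k (i + j) a = transport S (k + i) j (transport S k i a)"
  by (induction j) (simp_all add: add.assoc)

text \<open>Pairs that are identified meet at some later level, and injectivity pulls the equation
  back to level \<open>k + j\<close>.\<close>

lemma dclass_eq_iff:
  assumes "a \<in> stage S k" "b \<in> stage S (k + j)"
  shows "dclass S k a = dclass S (k + j) b \<longleftrightarrow> transport S k j a = b"
proof
  assume "dclass S k a = dclass S (k + j) b"
  moreover have "(k + j, b) \<in> dclass S (k + j) b" using assms(2) by (auto simp: dclass_def)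
  ultimately have "(k + j, b) \<in> dclass S k a" by simp
  then obtain n where n: "n \<ge> k + j"
      "transport S k (n - k) a = transport S (k + j) (n - (k + j)) b"
    unfolding dclass_def by auto
  have "n - k = j + (n - (k + j))" using n(1) by simp
  then have "transport S k (n - k) a = transport S (k + j) (n - (k + j)) (transport S k j a)"
    by (simp only: transport_add)
  with n(2) show "transport S k j a = b"
    using transport_inj[OF transport_stage[OF assms(1)] assms(2)] by metis
next
  assume b: "transport S k j a = b"
  have "(l, c) \<in> dclass S k a \<longleftrightarrow> (l, c) \<in> dclass S (k + j) b" for l c
  proof
    assume "(l, c) \<in> dclass S k a"
    then obtain n where c: "c \<in> stage S l" and n: "n \<ge> max k l"
        "transport S k (n - k) a = transport S l (n - l) c" by (auto simp: dclass_def)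
    \<comment> \<open>The meeting level \<open>n\<close> need not lie above \<open>k + j\<close>;
      level \<open>n + j\<close> does.\<close>
    have "transport S k (n + j - k) a = transport S (k + j) (n + j - (k + j)) b"
    proof -
      have "n + j - k = j + (n + j - (k + j))" using n(1) by simp
      then show ?thesis unfolding b[symmetric] by (simp only: transport_add)
    qed
    moreover have "transport S k (n + j - k) a = transport S l (n + j - l) c"
    proof -
      have "n + j - k = (n - k) + j" "n + j - l = (n - l) + j" "k + (n - k) = l + (n - l)"
        using n(1) by simp_all
      then show ?thesis by (simp only: transport_add n(2))
    qed
    ultimately show "(l, c) \<in> dclass S (k + j) b"
      using c n(1) unfolding dclass_def by (auto intro!: exI[of _ "n + j"])
  next
    assume "(l, c) \<in> dclass S (k + j) b"
    then obtain n where c: "c \<in> stage S l" and n: "n \<ge> max (k + j) l"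
        "transport S (k + j) (n - (k + j)) b = transport S l (n - l) c" by (auto simp: dclass_def)
    have "n - k = j + (n - (k + j))" using n(1) by simp
    then have "transport S k (n - k) a = transport S l (n - l) c"
      unfolding n(2)[symmetric] b[symmetric] by (simp only: transport_add)
    then show "(l, c) \<in> dclass S k a"
      using c n(1) unfolding dclass_def by (auto intro!: exI[of _ n])
  qed
  then show "dclass S k a = dclass S (k + j) b" by auto
qed

lemma dclass_inj: "\<lbrakk>dclass S k a = dclass S k b; a \<in> stage S k; b \<in> stage S k\<rbrakk> \<Longrightarrow> a = b"
  using dclass_eq_iff[of a k b 0] by simp

lemma dclass_transport: "a \<in> stage S k \<Longrightarrow> dclass S (k + j) (transport S k j a) = dclass S k a"
  using dclass_eq_iff transport_stage by metis

lemma dlevel_mono: "k \<le> l \<Longrightarrow> dlevel S k \<subseteq> dlevel S l"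
  unfolding dlevel_def
proof clarify
  fix a assume "k \<le> l" "a \<in> stage S k"
  then show "dclass S k a \<in> dclass S l ` stage S l"
    using dclass_transport[of a k "l - k"] transport_stage[of a k "l - k"]
    by (intro image_eqI[of _ _ "transport S k (l - k) a"]) auto
qed

text \<open>The form with all late levels above a given \<open>k\<close> lets several elements be
  represented at one common level, where an operator defined from level \<open>k\<close> on can be
  evaluated.\<close>

lemma dunion_rep:
  assumes "X \<in> dunion S"
  shows "\<exists>l. \<forall>j\<ge>l. \<exists>a\<in>stage S (k + j). X = dclass S (k + j) a"
proof -
  obtain l where l: "X \<in> dlevel S l" using assms by (auto simp: dunion_def)
  have "\<exists>a\<in>stage S (k + j). X = dclass S (k + j) a" if "l \<le> j" for j
  proof -
    have "X \<in> dlevel S (k + j)" using l dlevel_mono[of l "k + j"] that by auto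
    then show ?thesis by (auto simp: dlevel_def)
  qed
  then show ?thesis by blast
qed

lemma dclass_in_dunion: "a \<in> stage S k \<Longrightarrow> dclass S k a \<in> dunion S"
  by (auto simp: dunion_def dlevel_def)

lemma dclass_common_level:
  assumes "a \<in> stage S k" "a' \<in> stage S l" "dclass S k a = dclass S l a'" "k \<le> n" "l \<le> n"
  shows "transport S k (n - k) a = transport S l (n - l) a'"
proof -
  have "dclass S n (transport S k (n - k) a) = dclass S n (transport S l (n - l) a')"
    using dclass_transport[OF assms(1), of "n - k"] dclass_transport[OF assms(2), of "n - l"] assms
    by simp
  then show ?thesis
    using transport_stage[OF assms(1), of "n - k"] transport_stage[OF assms(2), of "n - l"] assms(4,5)
    by (auto dest: dclass_inj)
qed

end

text \<open>\<open>dmap\<close> and \<open>dmap2\<close> are defined by \<open>THE\<close> and have their intended values only for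
  levelwise operations that commute with the inclusions.\<close>

lemma dmap_eq:
  assumes S: "dsystem S" and T: "dsystem T"
    and f: "\<And>k a. \<lbrakk>K \<le> k; a \<in> stage S k\<rbrakk> \<Longrightarrow> f k a \<in> stage T k \<and> f (Suc k) (incl S k a) = incl T k (f k a)"
    and k: "K \<le> k" "a \<in> stage S k"
  shows "dmap K S T f (dclass S k a) = dclass T k (f k a)"
proof -
  interpret S: dsystem S by fact
  interpret T: dsystem T by fact
  have comm: "f (i + j) (transport S i j c) = transport T i j (f i c)" if "K \<le> i" "c \<in> stage S i" for i j c
    by (induction j) (use that f S.transport_stage in auto)
  have uniq: "dclass T l (f l b) = dclass T k (f k a)"
    if l: "K \<le> l" "b \<in> stage S l" "dclass S k a = dclass S l b" for l b
  proof -
    define n where "n = max k l"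
    have "transport S k (n - k) a = transport S l (n - l) b"
      using S.dclass_common_level[OF k(2) l(2,3)] by (simp add: n_def)
    then have "f (k + (n - k)) (transport S k (n - k) a) = f (l + (n - l)) (transport S l (n - l) b)"
      by (simp add: n_def)
    then have "transport T k (n - k) (f k a) = transport T l (n - l) (f l b)"
      using comm k l by simp
    then show ?thesis
      using T.dclass_transport[of "f k a" k "n - k"] T.dclass_transport[of "f l b" l "n - l"] f k l
      by (simp add: n_def)
  qed
  show ?thesis unfolding dmap_def
    by (rule the_equality) (use k uniq in blast)+
qed

lemma dmap2_eq:
  assumes S: "dsystem S" and T: "dsystem T" and U: "dsystem U"
    and f: "\<And>k a b. \<lbrakk>a \<in> stage S k; b \<in> stage T k\<rbrakk> \<Longrightarrow>
      f k a b \<in> stage U k \<and> f (Suc k) (incl S k a) (incl T k b) = incl U k (f k a b)"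
    and k: "a \<in> stage S k" "b \<in> stage T k"
  shows "dmap2 S T U f (dclass S k a) (dclass T k b) = dclass U k (f k a b)"
proof -
  interpret S: dsystem S by fact
  interpret T: dsystem T by fact
  interpret U: dsystem U by fact
  have comm: "f (i + j) (transport S i j c) (transport T i j d) = transport U i j (f i c d)"
    if "c \<in> stage S i" "d \<in> stage T i" for i j c d
    by (induction j) (use that f S.transport_stage T.transport_stage in auto)
  have uniq: "dclass U l (f l c d) = dclass U k (f k a b)"
    if l: "c \<in> stage S l" "d \<in> stage T l" "dclass S k a = dclass S l c" "dclass T k b = dclass T l d"
    for l c d
  proof -
    define n where "n = max k l"
    have "transport S k (n - k) a = transport S l (n - l) c"
      "transport T k (n - k) b = transport T l (n - l) d"
      using S.dclass_common_level[OF k(1) l(1,3)] T.dclass_common_level[OF k(2) l(2,4)]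
      by (simp_all add: n_def)
    then have "f (k + (n - k)) (transport S k (n - k) a) (transport T k (n - k) b) =
        f (l + (n - l)) (transport S l (n - l) c) (transport T l (n - l) d)"
      by (simp add: n_def)
    then have "transport U k (n - k) (f k a b) = transport U l (n - l) (f l c d)"
      using comm k l by simp
    then show ?thesis
      using U.dclass_transport[of "f k a b" k "n - k"] U.dclass_transport[of "f l c d" l "n - l"] f k l
      by (simp add: n_def)
  qed
  show ?thesis unfolding dmap2_def
    by (rule the_equality) (use k uniq in blast)+
qed

section \<open>Natural transformations on a generated category\<close>

lemma cstar_functor_fcomp:
  assumes "cstar_functor C D F" "cstar_functor D E G"
  shows "cstar_functor C E (fcomp G F)"
proof -
  interpret F: cstar_functor C D F by fact
  interpret G: cstar_functor D E G by fact
  show ?thesis by unfold_locales (simp_all add: fcomp_def)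
qed

locale functor_pair = F: cstar_functor C D F + G: cstar_functor C D G
  for C :: "('o, 'm) ccat" and D :: "('p, 'n) ccat"
    and F :: "('o, 'm, 'p, 'n) fctr" and G :: "('o, 'm, 'p, 'n) fctr"
begin

lemma NT_morph:
  assumes "\<eta> \<in> NT C D F G" "x \<in> Obj C" shows "morph D (\<eta> x) (fob F x) (fob G x)"
  using NT_component[OF assms] assms(2) by simp

lemma NT_natural:
  assumes "\<eta> \<in> NT C D F G" "arr C f"
  shows "\<eta> (tgt C f) \<cdot>\<^bsub>D\<^esub> far F f = far G f \<cdot>\<^bsub>D\<^esub> \<eta> (src C f)"
  using NT_naturality[OF assms(1) _ _ F.S.arr_hom[OF assms(2)]] assms(2) by simp

text \<open>On a summand \<open>g f\<close> through \<open>z\<close>,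
  \<open>p x F(g f) = G(g) (p z) F(f)\<close> depends on \<open>p\<close> only through
  \<open>p z\<close>. The families are plain functions because the two sides of the exchange
  relation, to which this is applied, are not given as extensional ones.\<close>

lemma natural_eqI:
  assumes gen: "generates C z x" and obj: "x \<in> Obj C" "z \<in> Obj C"
    and p: "\<And>x. x \<in> Obj C \<Longrightarrow> morph D (p x) (fob F x) (fob G x)"
      "\<And>f. arr C f \<Longrightarrow> p (tgt C f) \<cdot>\<^bsub>D\<^esub> far F f = far G f \<cdot>\<^bsub>D\<^esub> p (src C f)"
    and q: "\<And>x. x \<in> Obj C \<Longrightarrow> morph D (q x) (fob F x) (fob G x)"
      "\<And>f. arr C f \<Longrightarrow> q (tgt C f) \<cdot>\<^bsub>D\<^esub> far F f = far G f \<cdot>\<^bsub>D\<^esub> q (src C f)"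
    and eq: "p z = q z"
  shows "p x = q x"
proof -
  have "morph C (ident C x) x x \<and> p x \<cdot>\<^bsub>D\<^esub> far F (ident C x) = q x \<cdot>\<^bsub>D\<^esub> far F (ident C x)"
    using gen[unfolded generates_def]
  proof (induction rule: addspan.induct)
    case (base a)
    then obtain f g where fg: "a = g \<cdot>\<^bsub>C\<^esub> f" "morph C f x z" "morph C g z x" by blast
    have "p x \<cdot>\<^bsub>D\<^esub> far F g = q x \<cdot>\<^bsub>D\<^esub> far F g"
      using p(2)[of g] q(2)[of g] fg(3) eq by simp
    then have "(p x \<cdot>\<^bsub>D\<^esub> far F g) \<cdot>\<^bsub>D\<^esub> far F f = (q x \<cdot>\<^bsub>D\<^esub> far F g) \<cdot>\<^bsub>D\<^esub> far F f"
      by simp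
    then show ?case using fg p(1)[OF obj(1)] q(1)[OF obj(1)] by simp
  next
    case (add a b)
    then show ?case using p(1)[OF obj(1)] q(1)[OF obj(1)] by simp
  qed
  then show ?thesis using obj p(1)[OF obj(1)] q(1)[OF obj(1)] by simp
qed

text \<open>The component at \<open>x\<close> of the extension is \<open>\<Sum>\<^sub>i G(g\<^sub>i) \<gamma> F(f\<^sub>i)\<close> for a decomposition
  \<open>1\<^sub>x = \<Sum>\<^sub>i g\<^sub>i f\<^sub>i\<close> through \<open>z\<close>.\<close>

lemma natural_extension:
  assumes gen: "\<And>x. x \<in> Obj C \<Longrightarrow> generates C z x" and z: "z \<in> Obj C"
    and \<gamma>: "morph D \<gamma> (fob F z) (fob G z)"
    and comm: "\<And>\<alpha>. morph C \<alpha> z z \<Longrightarrow> \<gamma> \<cdot>\<^bsub>D\<^esub> far F \<alpha> = far G \<alpha> \<cdot>\<^bsub>D\<^esub> \<gamma>"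
  shows "\<exists>!\<eta>. \<eta> \<in> NT C D F G \<and> \<eta> z = \<gamma>"
proof -
  \<comment> \<open>The candidate value at \<open>x\<close> depends a priori on the decomposition,
    so it is kept as a relation between partial sums \<open>a\<close> of the identity and the
    corresponding sums \<open>b\<close>.\<close>
  define R where "R x = addspan (\<lambda>(a, b) (c, d). (hadd C a c, hadd D b d))
    {(g \<cdot>\<^bsub>C\<^esub> f, far G g \<cdot>\<^bsub>D\<^esub> (\<gamma> \<cdot>\<^bsub>D\<^esub> far F f)) | f g. morph C f x z \<and> morph C g z x}" for x
  have R: "morph C a x x \<and> morph D b (fob F x) (fob G x) \<and>
      (\<forall>p q. morph C p z x \<longrightarrow> morph C q x z \<longrightarrow>
        far G q \<cdot>\<^bsub>D\<^esub> (b \<cdot>\<^bsub>D\<^esub> far F p) = \<gamma> \<cdot>\<^bsub>D\<^esub> far F (q \<cdot>\<^bsub>C\<^esub> (a \<cdot>\<^bsub>C\<^esub> p)))"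
    if "x \<in> Obj C" "(a, b) \<in> R x" for x a b
    using that(2) unfolding R_def
  proof (induction "(a, b)" arbitrary: a b rule: addspan.induct)
    case base
    then obtain f g where fg: "a = g \<cdot>\<^bsub>C\<^esub> f" "b = far G g \<cdot>\<^bsub>D\<^esub> (\<gamma> \<cdot>\<^bsub>D\<^esub> far F f)"
        "morph C f x z" "morph C g z x" by blast
    have "far G q \<cdot>\<^bsub>D\<^esub> (b \<cdot>\<^bsub>D\<^esub> far F p) = \<gamma> \<cdot>\<^bsub>D\<^esub> far F (q \<cdot>\<^bsub>C\<^esub> (a \<cdot>\<^bsub>C\<^esub> p))"
      if pq: "morph C p z x" "morph C q x z" for p q
    proof -
      have "far G q \<cdot>\<^bsub>D\<^esub> (b \<cdot>\<^bsub>D\<^esub> far F p) = (far G (q \<cdot>\<^bsub>C\<^esub> g) \<cdot>\<^bsub>D\<^esub> \<gamma>) \<cdot>\<^bsub>D\<^esub> far F (f \<cdot>\<^bsub>C\<^esub> p)"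
        using pq fg \<gamma> by simp
      \<comment> \<open>\<open>q g\<close> is an endomorphism of \<open>z\<close>: here the
        commutation hypothesis enters, and it makes the sandwich of \<open>b\<close> depend on
        \<open>a\<close> alone.\<close>
      also have "far G (q \<cdot>\<^bsub>C\<^esub> g) \<cdot>\<^bsub>D\<^esub> \<gamma> = \<gamma> \<cdot>\<^bsub>D\<^esub> far F (q \<cdot>\<^bsub>C\<^esub> g)"
        using comm[of "q \<cdot>\<^bsub>C\<^esub> g"] pq fg by simp
      finally show ?thesis using pq fg \<gamma> by simp
    qed
    with fg \<gamma> show ?case by simp
  next
    case (add u v)
    obtain a1 b1 a2 b2 where uv: "u = (a1, b1)" "v = (a2, b2)" by (metis surj_pair)
    have ab: "a = hadd C a1 a2" "b = hadd D b1 b2" using add.hyps(5) uv by simp_all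
    show ?case unfolding ab using add.hyps(2)[OF uv(1)] add.hyps(4)[OF uv(2)] \<gamma> by simp
  qed
  have "\<exists>b. (ident C x, b) \<in> R x" if x: "x \<in> Obj C" for x
    using gen[OF x, unfolded generates_def]
  proof (induction rule: addspan.induct)
    case (base a)
    then obtain f g where fg: "a = g \<cdot>\<^bsub>C\<^esub> f" "morph C f x z" "morph C g z x" by blast
    then have "(a, far G g \<cdot>\<^bsub>D\<^esub> (\<gamma> \<cdot>\<^bsub>D\<^esub> far F f)) \<in> R x"
      unfolding R_def by (intro addspan.base) blast
    then show ?case ..
  next
    case (add a b)
    then obtain c d where "(a, c) \<in> R x" "(b, d) \<in> R x" by blast
    from addspan.add[OF this[unfolded R_def]] show ?case unfolding R_def by auto
  qed
  then have "\<forall>x. \<exists>b. x \<in> Obj C \<longrightarrow> (ident C x, b) \<in> R x" by blast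
  from choice[OF this] obtain b where b: "\<And>x. x \<in> Obj C \<Longrightarrow> (ident C x, b x) \<in> R x" by blast
  have b_morph: "morph D (b x) (fob F x) (fob G x)" if "x \<in> Obj C" for x
    using R[OF that b[OF that]] by blast
  have b_mid: "far G q \<cdot>\<^bsub>D\<^esub> (b x \<cdot>\<^bsub>D\<^esub> far F p) = \<gamma> \<cdot>\<^bsub>D\<^esub> far F (q \<cdot>\<^bsub>C\<^esub> p)"
    if "morph C p z x" "morph C q x z" for p q x
  proof -
    have x: "x \<in> Obj C" using that by auto
    show ?thesis using R[OF x b[OF x]] that x by simp
  qed
  \<comment> \<open>Morphisms from \<open>F x\<close> to \<open>G x'\<close> are determined by their
    sandwiches between maps out of and into \<open>z\<close>: the decomposition of the identity of
    \<open>x\<close> removes the right factor, that of \<open>x'\<close> the left one.\<close>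
  have separate: "c = d"
    if cd: "morph D c (fob F x) (fob G x')" "morph D d (fob F x) (fob G x')"
      and x: "x \<in> Obj C" "x' \<in> Obj C"
      and eq: "\<And>p q. morph C p z x \<Longrightarrow> morph C q x' z \<Longrightarrow>
        far G q \<cdot>\<^bsub>D\<^esub> (c \<cdot>\<^bsub>D\<^esub> far F p) = far G q \<cdot>\<^bsub>D\<^esub> (d \<cdot>\<^bsub>D\<^esub> far F p)" for c d x x'
  proof -
    have right: "far G q \<cdot>\<^bsub>D\<^esub> c = far G q \<cdot>\<^bsub>D\<^esub> d" if q: "morph C q x' z" for q
    proof -
      have "morph C (ident C x) x x \<and>
          far G q \<cdot>\<^bsub>D\<^esub> (c \<cdot>\<^bsub>D\<^esub> far F (ident C x)) = far G q \<cdot>\<^bsub>D\<^esub> (d \<cdot>\<^bsub>D\<^esub> far F (ident C x))"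
        using gen[OF x(1), unfolded generates_def]
      proof (induction rule: addspan.induct)
        case (base a)
        then obtain f g where fg: "a = g \<cdot>\<^bsub>C\<^esub> f" "morph C f x z" "morph C g z x" by blast
        have "(far G q \<cdot>\<^bsub>D\<^esub> (c \<cdot>\<^bsub>D\<^esub> far F g)) \<cdot>\<^bsub>D\<^esub> far F f =
            (far G q \<cdot>\<^bsub>D\<^esub> (d \<cdot>\<^bsub>D\<^esub> far F g)) \<cdot>\<^bsub>D\<^esub> far F f"
          using eq[OF fg(3) q] by simp
        then show ?case using fg q cd by simp
      next
        case (add a b)
        then show ?case using cd q by simp
      qed
      then show ?thesis using x cd q by simp
    qed
    have "morph C (ident C x') x' x' \<and> far G (ident C x') \<cdot>\<^bsub>D\<^esub> c = far G (ident C x') \<cdot>\<^bsub>D\<^esub> d"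
      using gen[OF x(2), unfolded generates_def]
    proof (induction rule: addspan.induct)
      case (base a)
      then obtain f g where fg: "a = g \<cdot>\<^bsub>C\<^esub> f" "morph C f x' z" "morph C g z x'" by blast
      then show ?case using right[OF fg(2)] cd by simp
    next
      case (add a b)
      then show ?case using cd by simp
    qed
    then show ?thesis using x cd by simp
  qed
  \<comment> \<open>Both sides have the sandwich \<open>\<gamma> F(q f p)\<close>.\<close>
  have natural: "b y \<cdot>\<^bsub>D\<^esub> far F f = far G f \<cdot>\<^bsub>D\<^esub> b x"
    if xy: "x \<in> Obj C" "y \<in> Obj C" and f: "morph C f x y" for x y f
  proof (rule separate[OF _ _ xy])
    fix p q assume pq: "morph C p z x" "morph C q y z"
    have "far G q \<cdot>\<^bsub>D\<^esub> (b y \<cdot>\<^bsub>D\<^esub> far F (f \<cdot>\<^bsub>C\<^esub> p)) = \<gamma> \<cdot>\<^bsub>D\<^esub> far F (q \<cdot>\<^bsub>C\<^esub> (f \<cdot>\<^bsub>C\<^esub> p))"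
      using pq f by (intro b_mid) simp_all
    also have "\<dots> = far G (q \<cdot>\<^bsub>C\<^esub> f) \<cdot>\<^bsub>D\<^esub> (b x \<cdot>\<^bsub>D\<^esub> far F p)"
      using pq f b_mid[of p x "q \<cdot>\<^bsub>C\<^esub> f"] by simp
    finally show "far G q \<cdot>\<^bsub>D\<^esub> ((b y \<cdot>\<^bsub>D\<^esub> far F f) \<cdot>\<^bsub>D\<^esub> far F p) =
        far G q \<cdot>\<^bsub>D\<^esub> ((far G f \<cdot>\<^bsub>D\<^esub> b x) \<cdot>\<^bsub>D\<^esub> far F p)"
      using pq f b_morph[OF xy(1)] b_morph[OF xy(2)] by simp
  qed (use f b_morph[OF xy(1)] b_morph[OF xy(2)] in simp_all)
  have bz: "b z = \<gamma>"
    using b_mid[of "ident C z" z "ident C z"] b_morph[OF z] z \<gamma> by simp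
  show ?thesis
  proof (rule ex1I[of _ "restrict b (Obj C)"])
    have "\<forall>x\<in>Obj C. \<forall>y\<in>Obj C. \<forall>f\<in>Hom C x y.
        restrict b (Obj C) y \<cdot>\<^bsub>D\<^esub> far F f = far G f \<cdot>\<^bsub>D\<^esub> restrict b (Obj C) x"
    proof (intro ballI)
      fix x y f assume "x \<in> Obj C" "y \<in> Obj C" "f \<in> Hom C x y"
      then show "restrict b (Obj C) y \<cdot>\<^bsub>D\<^esub> far F f = far G f \<cdot>\<^bsub>D\<^esub> restrict b (Obj C) x"
        using natural[of x y f] by simp
    qed
    moreover have "restrict b (Obj C) \<in> (\<Pi>\<^sub>E x\<in>Obj C. Hom D (fob F x) (fob G x))"
      using b_morph by simp
    ultimately show "restrict b (Obj C) \<in> NT C D F G \<and> restrict b (Obj C) z = \<gamma>"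
      using bz z by (simp add: NT_def)
    fix \<eta> assume \<eta>: "\<eta> \<in> NT C D F G \<and> \<eta> z = \<gamma>"
    show "\<eta> = restrict b (Obj C)"
    proof (rule extensionalityI[of _ "Obj C"])
      show "\<eta> \<in> extensional (Obj C)" using \<eta> by (auto simp: NT_def PiE_def)
      fix x assume x: "x \<in> Obj C"
      have "\<eta> x = b x"
        using gen[OF x] x z NT_morph NT_natural \<eta> b_morph natural bz
        by (intro natural_eqI[of z x \<eta> b]) auto
      with x show "\<eta> x = restrict b (Obj C) x" by simp
    qed simp
  qed
qed

end

section \<open>The correspondence of a 1-cell\<close>

text \<open>What is retained of the sum of the simple objects is that it generates, the form in
  which semisimplicity propagates up the tower.\<close>

locale generated_zero_cell =
  fixes \<Gamma> :: "('o, 'm) zcell" and m :: 'o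
  assumes zero_cell: "zero_cell \<Gamma>" and base_obj [simp]: "m \<in> Obj (cat \<Gamma> 0)"
    and base_generates: "x \<in> Obj (cat \<Gamma> 0) \<Longrightarrow> generates (cat \<Gamma> 0) m x"
begin

sublocale Cat: finite_semisimple "cat \<Gamma> k" for k
  using zero_cell by (simp add: zero_cell_def)

sublocale Step: bi_faithful_functor "cat \<Gamma> k" "cat \<Gamma> (Suc k)" "step \<Gamma> (Suc k)" for k
proof -
  have "\<forall>k\<ge>1. bi_faithful (cat \<Gamma> (k - 1)) (cat \<Gamma> k) (step \<Gamma> k)"
    using zero_cell by (simp add: zero_cell_def)
  from this[rule_format, of "Suc k"]
  show "bi_faithful_functor (cat \<Gamma> k) (cat \<Gamma> (Suc k)) (step \<Gamma> (Suc k))"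
    using Cat.finite_semisimple_axioms
    by (simp add: bi_faithful_functor_def bi_faithful_functor_axioms_def)
qed

lemma tower_obj [simp]: "tower \<Gamma> m k \<in> Obj (cat \<Gamma> k)"
  by (induction k) simp_all

lemma tower_generates: "x \<in> Obj (cat \<Gamma> k) \<Longrightarrow> generates (cat \<Gamma> k) (tower \<Gamma> m k) x"
  by (induction k arbitrary: x) (simp_all add: base_generates Step.generates_step)

lemma stage_alg [simp]:
  "a \<in> stage (alg_sys \<Gamma> m) k \<longleftrightarrow> morph (cat \<Gamma> k) a (tower \<Gamma> m k) (tower \<Gamma> m k)"
  by (simp add: alg_sys_def)

lemma incl_alg [simp]: "incl (alg_sys \<Gamma> m) k = far (step \<Gamma> (Suc k))"
  by (simp add: alg_sys_def)

sublocale Alg: dsystem "alg_sys \<Gamma> m"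
  by unfold_locales (auto dest: Step.far_inj)

end

locale generated_one_cell =
  Dom: generated_zero_cell \<Gamma> m + Cod: generated_zero_cell \<Delta> n
  for \<Gamma> :: "('o, 'm) zcell" and \<Delta> :: "('p, 'n) zcell" and m :: 'o and n :: 'p +
  fixes \<Lambda> :: "('o, 'm, 'p, 'n) ocell"
  assumes one_cell: "one_cell \<Gamma> \<Delta> \<Lambda>"
begin

sublocale Fun: bi_faithful_functor "cat \<Gamma> k" "cat \<Delta> k" "fun1 \<Lambda> k" for k
  using one_cell Dom.Cat.finite_semisimple_axioms Cod.Cat.finite_semisimple_axioms
  by (simp add: one_cell_def bi_faithful_functor_def bi_faithful_functor_axioms_def)

abbreviation corr_obj :: "nat \<Rightarrow> 'p" where
  "corr_obj k \<equiv> fob (fun1 \<Lambda> k) (tower \<Gamma> m k)"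

abbreviation H :: "'n dsys" where "H \<equiv> corr_sys \<Gamma> \<Delta> m n \<Lambda>"

lemma conn_unitary:
  "natural_unitary (cat \<Gamma> k) (cat \<Delta> (Suc k)) (fcomp (step \<Delta> (Suc k)) (fun1 \<Lambda> k))
     (fcomp (fun1 \<Lambda> (Suc k)) (step \<Gamma> (Suc k))) (conn \<Lambda> (Suc k))"
proof -
  have "\<forall>k\<ge>1. natural_unitary (cat \<Gamma> (k - 1)) (cat \<Delta> k)
      (fcomp (step \<Delta> k) (fun1 \<Lambda> (k - 1))) (fcomp (fun1 \<Lambda> k) (step \<Gamma> k)) (conn \<Lambda> k)"
    using one_cell by (simp add: one_cell_def)
  from this[rule_format, of "Suc k"] show ?thesis by simp
qed

lemma conn_morph [simp]:
  assumes "x \<in> Obj (cat \<Gamma> k)"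
  shows "arr (cat \<Delta> (Suc k)) (conn \<Lambda> (Suc k) x)"
    "src (cat \<Delta> (Suc k)) (conn \<Lambda> (Suc k) x) = fob (step \<Delta> (Suc k)) (fob (fun1 \<Lambda> k) x)"
    "tgt (cat \<Delta> (Suc k)) (conn \<Lambda> (Suc k) x) = fob (fun1 \<Lambda> (Suc k)) (fob (step \<Gamma> (Suc k)) x)"
proof -
  have "conn \<Lambda> (Suc k) x \<in> Hom (cat \<Delta> (Suc k)) (fob (step \<Delta> (Suc k)) (fob (fun1 \<Lambda> k) x))
      (fob (fun1 \<Lambda> (Suc k)) (fob (step \<Gamma> (Suc k)) x))"
    using conn_unitary[of k] NT_component[OF _ assms]
    unfolding natural_unitary_def fcomp_def by fastforce
  then show "arr (cat \<Delta> (Suc k)) (conn \<Lambda> (Suc k) x)"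
    "src (cat \<Delta> (Suc k)) (conn \<Lambda> (Suc k) x) = fob (step \<Delta> (Suc k)) (fob (fun1 \<Lambda> k) x)"
    "tgt (cat \<Delta> (Suc k)) (conn \<Lambda> (Suc k) x) = fob (fun1 \<Lambda> (Suc k)) (fob (step \<Gamma> (Suc k)) x)"
    using assms by simp_all
qed

lemma conn_natural:
  assumes "arr (cat \<Gamma> k) f"
  shows "conn \<Lambda> (Suc k) (tgt (cat \<Gamma> k) f) \<cdot>\<^bsub>cat \<Delta> (Suc k)\<^esub> far (step \<Delta> (Suc k)) (far (fun1 \<Lambda> k) f) =
    far (fun1 \<Lambda> (Suc k)) (far (step \<Gamma> (Suc k)) f)
      \<cdot>\<^bsub>cat \<Delta> (Suc k)\<^esub> conn \<Lambda> (Suc k) (src (cat \<Gamma> k) f)"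
  using conn_unitary[of k]
    NT_naturality[OF _ Dom.Cat.src_obj[OF assms] Dom.Cat.tgt_obj[OF assms] Dom.Cat.arr_hom[OF assms]]
  unfolding natural_unitary_def by (fastforce simp: fcomp_def)

lemma conn_inverse [simp]:
  assumes "x \<in> Obj (cat \<Gamma> k)"
  shows "hadj (cat \<Delta> (Suc k)) (conn \<Lambda> (Suc k) x) \<cdot>\<^bsub>cat \<Delta> (Suc k)\<^esub> conn \<Lambda> (Suc k) x =
      ident (cat \<Delta> (Suc k)) (fob (step \<Delta> (Suc k)) (fob (fun1 \<Lambda> k) x))"
    "conn \<Lambda> (Suc k) x \<cdot>\<^bsub>cat \<Delta> (Suc k)\<^esub> hadj (cat \<Delta> (Suc k)) (conn \<Lambda> (Suc k) x) =
      ident (cat \<Delta> (Suc k)) (fob (fun1 \<Lambda> (Suc k)) (fob (step \<Gamma> (Suc k)) x))"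
  using conn_unitary[of k] assms by (simp_all add: natural_unitary_def fcomp_def)

lemma conn_inverse_cmp [simp]:
  assumes "x \<in> Obj (cat \<Gamma> k)" "arr (cat \<Delta> (Suc k)) f"
    "tgt (cat \<Delta> (Suc k)) f = fob (step \<Delta> (Suc k)) (fob (fun1 \<Lambda> k) x)"
  shows "hadj (cat \<Delta> (Suc k)) (conn \<Lambda> (Suc k) x) \<cdot>\<^bsub>cat \<Delta> (Suc k)\<^esub>
      (conn \<Lambda> (Suc k) x \<cdot>\<^bsub>cat \<Delta> (Suc k)\<^esub> f) = f"
  using Cod.Cat.assoc[of "Suc k" f "conn \<Lambda> (Suc k) x" "hadj (cat \<Delta> (Suc k)) (conn \<Lambda> (Suc k) x)"] assms
  by simp

lemma stage_corr [simp]: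
  "\<xi> \<in> stage H k \<longleftrightarrow> morph (cat \<Delta> k) \<xi> (tower \<Delta> n k) (corr_obj k)"
  by (simp add: corr_sys_def)

lemma incl_corr [simp]:
  "incl H k \<xi> = conn \<Lambda> (Suc k) (tower \<Gamma> m k) \<cdot>\<^bsub>cat \<Delta> (Suc k)\<^esub> far (step \<Delta> (Suc k)) \<xi>"
  by (simp add: corr_sys_def)

sublocale Corr: dsystem H
proof
  fix \<xi> \<zeta> k assume m: "\<xi> \<in> stage H k" "\<zeta> \<in> stage H k" and eq: "incl H k \<xi> = incl H k \<zeta>"
  have "far (step \<Delta> (Suc k)) \<xi> = far (step \<Delta> (Suc k)) \<zeta>"
    using arg_cong[OF eq, of "\<lambda>f. hadj (cat \<Delta> (Suc k)) (conn \<Lambda> (Suc k) (tower \<Gamma> m k)) \<cdot>\<^bsub>cat \<Delta> (Suc k)\<^esub> f"] m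
    by simp
  then show "\<xi> = \<zeta>" using m by (auto dest: Cod.Step.far_inj)
qed simp

abbreviation correspondence where "correspondence \<equiv> corr \<Gamma> \<Delta> m n \<Lambda>"

lemma vecs_corr [simp]: "vecs correspondence = dunion H"
  by (simp add: corr_def Let_def)

lemma vadd_corr:
  assumes "\<xi> \<in> stage H k" "\<zeta> \<in> stage H k"
  shows "vadd correspondence (dclass H k \<xi>) (dclass H k \<zeta>) = dclass H k (hadd (cat \<Delta> k) \<xi> \<zeta>)"
proof -
  have "dmap2 H H H (\<lambda>k. hadd (cat \<Delta> k)) (dclass H k \<xi>) (dclass H k \<zeta>) =
      dclass H k (hadd (cat \<Delta> k) \<xi> \<zeta>)"
    using Corr.dsystem_axioms Corr.dsystem_axioms Corr.dsystem_axioms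
    by (rule dmap2_eq) (use assms in simp_all)
  then show ?thesis by (simp add: corr_def Let_def)
qed

lemma vscale_corr:
  assumes "\<xi> \<in> stage H k"
  shows "vscale correspondence c (dclass H k \<xi>) = dclass H k (hscale (cat \<Delta> k) c \<xi>)"
proof -
  have "dmap 0 H H (\<lambda>k. hscale (cat \<Delta> k) c) (dclass H k \<xi>) = dclass H k (hscale (cat \<Delta> k) c \<xi>)"
    using Corr.dsystem_axioms Corr.dsystem_axioms by (rule dmap_eq) (use assms in simp_all)
  then show ?thesis by (simp add: corr_def Let_def)
qed

text \<open>Compatibility of the left action with the inclusions is the naturality of
  \<open>W\<close> at \<open>\<alpha>\<close>.\<close>

lemma lact_corr:
  assumes "\<alpha> \<in> stage (alg_sys \<Gamma> m) k" "\<xi> \<in> stage H k"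
  shows "lact correspondence (dclass (alg_sys \<Gamma> m) k \<alpha>) (dclass H k \<xi>) =
    dclass H k (far (fun1 \<Lambda> k) \<alpha> \<cdot>\<^bsub>cat \<Delta> k\<^esub> \<xi>)"
proof -
  have "dmap2 (alg_sys \<Gamma> m) H H (\<lambda>k \<alpha> \<xi>. far (fun1 \<Lambda> k) \<alpha> \<cdot>\<^bsub>cat \<Delta> k\<^esub> \<xi>)
      (dclass (alg_sys \<Gamma> m) k \<alpha>) (dclass H k \<xi>) = dclass H k (far (fun1 \<Lambda> k) \<alpha> \<cdot>\<^bsub>cat \<Delta> k\<^esub> \<xi>)"
    using Dom.Alg.dsystem_axioms Corr.dsystem_axioms Corr.dsystem_axioms
  proof (rule dmap2_eq)
    fix k \<alpha> \<xi> assume a: "\<alpha> \<in> stage (alg_sys \<Gamma> m) k" and \<xi>: "\<xi> \<in> stage H k"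
    have nat: "conn \<Lambda> (Suc k) (tower \<Gamma> m k) \<cdot>\<^bsub>cat \<Delta> (Suc k)\<^esub> far (step \<Delta> (Suc k)) (far (fun1 \<Lambda> k) \<alpha>) =
      far (fun1 \<Lambda> (Suc k)) (far (step \<Gamma> (Suc k)) \<alpha>) \<cdot>\<^bsub>cat \<Delta> (Suc k)\<^esub> conn \<Lambda> (Suc k) (tower \<Gamma> m k)"
      using conn_natural[of k \<alpha>] a by simp
    have "(conn \<Lambda> (Suc k) (tower \<Gamma> m k) \<cdot>\<^bsub>cat \<Delta> (Suc k)\<^esub> far (step \<Delta> (Suc k)) (far (fun1 \<Lambda> k) \<alpha>))
        \<cdot>\<^bsub>cat \<Delta> (Suc k)\<^esub> far (step \<Delta> (Suc k)) \<xi> =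
      far (fun1 \<Lambda> (Suc k)) (far (step \<Gamma> (Suc k)) \<alpha>) \<cdot>\<^bsub>cat \<Delta> (Suc k)\<^esub>
        (conn \<Lambda> (Suc k) (tower \<Gamma> m k) \<cdot>\<^bsub>cat \<Delta> (Suc k)\<^esub> far (step \<Delta> (Suc k)) \<xi>)"
      unfolding nat using a \<xi> by simp
    then show "far (fun1 \<Lambda> k) \<alpha> \<cdot>\<^bsub>cat \<Delta> k\<^esub> \<xi> \<in> stage H k \<and>
        far (fun1 \<Lambda> (Suc k)) (incl (alg_sys \<Gamma> m) k \<alpha>) \<cdot>\<^bsub>cat \<Delta> (Suc k)\<^esub> incl H k \<xi> =
        incl H k (far (fun1 \<Lambda> k) \<alpha> \<cdot>\<^bsub>cat \<Delta> k\<^esub> \<xi>)"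
      using a \<xi> by simp
  qed (use assms in simp_all)
  then show ?thesis by (simp add: corr_def Let_def)
qed

lemma ract_corr:
  assumes "\<xi> \<in> stage H k" "\<beta> \<in> stage (alg_sys \<Delta> n) k"
  shows "ract correspondence (dclass H k \<xi>) (dclass (alg_sys \<Delta> n) k \<beta>) =
    dclass H k (\<xi> \<cdot>\<^bsub>cat \<Delta> k\<^esub> \<beta>)"
proof -
  have "dmap2 H (alg_sys \<Delta> n) H (\<lambda>k \<xi> \<beta>. \<xi> \<cdot>\<^bsub>cat \<Delta> k\<^esub> \<beta>)
      (dclass H k \<xi>) (dclass (alg_sys \<Delta> n) k \<beta>) = dclass H k (\<xi> \<cdot>\<^bsub>cat \<Delta> k\<^esub> \<beta>)"
    using Corr.dsystem_axioms Cod.Alg.dsystem_axioms Corr.dsystem_axioms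
    by (rule dmap2_eq) (use assms in simp_all)
  then show ?thesis by (simp add: corr_def Let_def)
qed

lemma inner_corr:
  assumes "\<xi> \<in> stage H k" "\<zeta> \<in> stage H k"
  shows "inner correspondence (dclass H k \<xi>) (dclass H k \<zeta>) =
    dclass (alg_sys \<Delta> n) k (hadj (cat \<Delta> k) \<zeta> \<cdot>\<^bsub>cat \<Delta> k\<^esub> \<xi>)"
proof -
  have "dmap2 H H (alg_sys \<Delta> n) (\<lambda>k \<xi> \<zeta>. hadj (cat \<Delta> k) \<zeta> \<cdot>\<^bsub>cat \<Delta> k\<^esub> \<xi>)
      (dclass H k \<xi>) (dclass H k \<zeta>) = dclass (alg_sys \<Delta> n) k (hadj (cat \<Delta> k) \<zeta> \<cdot>\<^bsub>cat \<Delta> k\<^esub> \<xi>)"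
    using Corr.dsystem_axioms Corr.dsystem_axioms Cod.Alg.dsystem_axioms
    by (rule dmap2_eq) (use assms in simp_all)
  then show ?thesis by (simp add: corr_def Let_def)
qed

text \<open>\<open>H\<^sub>k\<close> is finitely generated over \<open>B\<^sub>k\<close> by the image of \<open>H\<^sub>0\<close>, for every \<open>k\<close>.\<close>

lemma lifted_generation:
  "ident (cat \<Delta> k) (corr_obj k) \<in> addspan (hadd (cat \<Delta> k))
    {transport H 0 k \<xi> \<cdot>\<^bsub>cat \<Delta> k\<^esub> h | \<xi> h. \<xi> \<in> stage H 0 \<and> morph (cat \<Delta> k) h (corr_obj k) (tower \<Delta> n k)}"
proof (induction k)
  case 0
  have "{g \<cdot>\<^bsub>cat \<Delta> 0\<^esub> f | f g. morph (cat \<Delta> 0) f (corr_obj 0) n \<and> morph (cat \<Delta> 0) g n (corr_obj 0)} =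
      {transport H 0 0 \<xi> \<cdot>\<^bsub>cat \<Delta> 0\<^esub> h | \<xi> h. \<xi> \<in> stage H 0 \<and> morph (cat \<Delta> 0) h (corr_obj 0) (tower \<Delta> n 0)}"
    by auto
  then show ?case
    using Cod.base_generates[of "corr_obj 0"] by (simp add: generates_def)
next
  case (Suc k)
  let ?W = "conn \<Lambda> (Suc k) (tower \<Gamma> m k)"
  \<comment> \<open>Applying the step functor and conjugating by the unitary \<open>W\<close>
    carries the identity to the identity and a summand \<open>\<xi> h\<close> to the inclusion of
    \<open>\<xi>\<close> times \<open>\<Delta>(h) W*\<close>, so the vectors stay lifted from
    \<open>H_0\<close>.\<close>
  let ?\<phi> = "\<lambda>a. ?W \<cdot>\<^bsub>cat \<Delta> (Suc k)\<^esub> (far (step \<Delta> (Suc k)) a \<cdot>\<^bsub>cat \<Delta> (Suc k)\<^esub> hadj (cat \<Delta> (Suc k)) ?W)"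
  have "?\<phi> (ident (cat \<Delta> k) (corr_obj k)) \<in> addspan (hadd (cat \<Delta> (Suc k)))
    {transport H 0 (Suc k) \<xi> \<cdot>\<^bsub>cat \<Delta> (Suc k)\<^esub> h | \<xi> h.
      \<xi> \<in> stage H 0 \<and> morph (cat \<Delta> (Suc k)) h (corr_obj (Suc k)) (tower \<Delta> n (Suc k))}"
    using Suc.IH
  proof (rule addspan_image[where P = "\<lambda>a. morph (cat \<Delta> k) a (corr_obj k) (corr_obj k)"])
    fix a assume "a \<in> {transport H 0 k \<xi> \<cdot>\<^bsub>cat \<Delta> k\<^esub> h | \<xi> h.
        \<xi> \<in> stage H 0 \<and> morph (cat \<Delta> k) h (corr_obj k) (tower \<Delta> n k)}"
    then obtain \<xi> h where a: "a = transport H 0 k \<xi> \<cdot>\<^bsub>cat \<Delta> k\<^esub> h" "\<xi> \<in> stage H 0"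
        "morph (cat \<Delta> k) h (corr_obj k) (tower \<Delta> n k)" by blast
    have \<xi>: "morph (cat \<Delta> k) (transport H 0 k \<xi>) (tower \<Delta> n k) (corr_obj k)"
      using Corr.transport_stage[OF a(2), of k] by simp
    have "?\<phi> a = transport H 0 (Suc k) \<xi> \<cdot>\<^bsub>cat \<Delta> (Suc k)\<^esub>
        (far (step \<Delta> (Suc k)) h \<cdot>\<^bsub>cat \<Delta> (Suc k)\<^esub> hadj (cat \<Delta> (Suc k)) ?W)"
      using a(1,3) \<xi> by simp
    moreover have "morph (cat \<Delta> (Suc k)) (far (step \<Delta> (Suc k)) h \<cdot>\<^bsub>cat \<Delta> (Suc k)\<^esub> hadj (cat \<Delta> (Suc k)) ?W)
        (corr_obj (Suc k)) (tower \<Delta> n (Suc k))"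
      using a(3) by simp
    ultimately have "?\<phi> a \<in> {transport H 0 (Suc k) \<xi> \<cdot>\<^bsub>cat \<Delta> (Suc k)\<^esub> h | \<xi> h.
      \<xi> \<in> stage H 0 \<and> morph (cat \<Delta> (Suc k)) h (corr_obj (Suc k)) (tower \<Delta> n (Suc k))}"
      using a(2) by blast
    moreover have "morph (cat \<Delta> k) a (corr_obj k) (corr_obj k)" using a(1,3) \<xi> by simp
    ultimately show "morph (cat \<Delta> k) a (corr_obj k) (corr_obj k) \<and> ?\<phi> a \<in> addspan (hadd (cat \<Delta> (Suc k)))
        {transport H 0 (Suc k) \<xi> \<cdot>\<^bsub>cat \<Delta> (Suc k)\<^esub> h | \<xi> h.
          \<xi> \<in> stage H 0 \<and> morph (cat \<Delta> (Suc k)) h (corr_obj (Suc k)) (tower \<Delta> n (Suc k))}"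
      by (blast intro: addspan.base)
  qed simp_all
  then show ?case by simp
qed

text \<open>By the decomposition of the identity, \<open>f\<close> is the sum of the
  \<open>(f \<xi>_i) h_i\<close> with \<open>\<xi>_i\<close> lifted from \<open>H_0\<close>.
  Uniqueness at level \<open>k\<close> reduces to this.\<close>

lemma eq_on_lifted:
  assumes f: "morph (cat \<Delta> k) f (corr_obj k) y" and g: "morph (cat \<Delta> k) g (corr_obj k) y"
    and eq: "\<And>\<xi>. \<xi> \<in> stage H 0 \<Longrightarrow>
      f \<cdot>\<^bsub>cat \<Delta> k\<^esub> transport H 0 k \<xi> = g \<cdot>\<^bsub>cat \<Delta> k\<^esub> transport H 0 k \<xi>"
  shows "f = g"
proof -
  have "morph (cat \<Delta> k) (ident (cat \<Delta> k) (corr_obj k)) (corr_obj k) (corr_obj k) \<and>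
      f \<cdot>\<^bsub>cat \<Delta> k\<^esub> ident (cat \<Delta> k) (corr_obj k) = g \<cdot>\<^bsub>cat \<Delta> k\<^esub> ident (cat \<Delta> k) (corr_obj k)"
    using lifted_generation[of k]
  proof (induction rule: addspan.induct)
    case (base a)
    then obtain \<xi> h where a: "a = transport H 0 k \<xi> \<cdot>\<^bsub>cat \<Delta> k\<^esub> h" "\<xi> \<in> stage H 0"
        "morph (cat \<Delta> k) h (corr_obj k) (tower \<Delta> n k)" by blast
    have \<xi>: "morph (cat \<Delta> k) (transport H 0 k \<xi>) (tower \<Delta> n k) (corr_obj k)"
      using Corr.transport_stage[OF a(2), of k] by simp
    have "(f \<cdot>\<^bsub>cat \<Delta> k\<^esub> transport H 0 k \<xi>) \<cdot>\<^bsub>cat \<Delta> k\<^esub> h = (g \<cdot>\<^bsub>cat \<Delta> k\<^esub> transport H 0 k \<xi>) \<cdot>\<^bsub>cat \<Delta> k\<^esub> h"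
      using eq[OF a(2)] by simp
    then show ?case using f g a(1,3) \<xi> by simp
  next
    case (add a b)
    then show ?case using f g by simp
  qed
  then show ?thesis using f g by simp
qed

end

section \<open>Intertwiners and natural transformations\<close>

locale one_cell_pair =
  Src: generated_one_cell \<Gamma> \<Delta> m n \<Lambda> + Tgt: generated_one_cell \<Gamma> \<Delta> m n \<Omega>
  for \<Gamma> :: "('o, 'm) zcell" and \<Delta> :: "('p, 'n) zcell" and m :: 'o and n :: 'p
    and \<Lambda> :: "('o, 'm, 'p, 'n) ocell" and \<Omega> :: "('o, 'm, 'p, 'n) ocell"
begin

abbreviation gseq where "gseq \<equiv> gamma_seq \<Gamma> \<Delta> m \<Lambda> \<Omega>"

abbreviation Phi_op where "Phi_op \<equiv> Phi \<Gamma> \<Delta> m n \<Lambda> \<Omega>"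

abbreviation corr_morph :: "nat \<Rightarrow> 'n \<Rightarrow> bool" where
  "corr_morph k \<gamma> \<equiv> morph (cat \<Delta> k) \<gamma> (Src.corr_obj k) (Tgt.corr_obj k)"

sublocale Pair: functor_pair "cat \<Gamma> k" "cat \<Delta> k" "fun1 \<Lambda> k" "fun1 \<Omega> k" for k
  by unfold_locales

lemma gseq_morph:
  assumes "corr_morph k \<gamma>"
  shows "corr_morph (k + j) (gseq k \<gamma> j)"
  using assms by (induction j) simp_all

text \<open>The factor \<open>W*\<close> in \<open>\<gamma>_{j+1}\<close> cancels the
  \<open>W\<close> of the inclusion of \<open>H_{k+j}\<close>; this is what makes
  \<open>\<Phi>_\<gamma>\<close> well defined.\<close>

lemma gseq_incl:
  assumes "corr_morph k \<gamma>" "\<xi> \<in> stage Src.H (k + j)"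
  shows "gseq k \<gamma> (Suc j) \<cdot>\<^bsub>cat \<Delta> (Suc (k + j))\<^esub> incl Src.H (k + j) \<xi> =
    incl Tgt.H (k + j) (gseq k \<gamma> j \<cdot>\<^bsub>cat \<Delta> (k + j)\<^esub> \<xi>)"
  using gseq_morph[OF assms(1), of j] assms(2) by simp

lemma gseq_shift: "gseq (Suc k) (gseq k \<gamma> 1) j = gseq k \<gamma> (Suc j)"
  by (induction j) simp_all

lemma Phi_dclass:
  assumes \<gamma>: "corr_morph k \<gamma>" and \<xi>: "\<xi> \<in> stage Src.H (k + j)"
  shows "Phi_op k \<gamma> (dclass Src.H (k + j) \<xi>) =
    dclass Tgt.H (k + j) (gseq k \<gamma> j \<cdot>\<^bsub>cat \<Delta> (k + j)\<^esub> \<xi>)"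
proof -
  have "dmap k Src.H Tgt.H (\<lambda>i \<xi>. gseq k \<gamma> (i - k) \<cdot>\<^bsub>cat \<Delta> i\<^esub> \<xi>) (dclass Src.H (k + j) \<xi>) =
      dclass Tgt.H (k + j) (gseq k \<gamma> (k + j - k) \<cdot>\<^bsub>cat \<Delta> (k + j)\<^esub> \<xi>)"
    using Src.Corr.dsystem_axioms Tgt.Corr.dsystem_axioms
  proof (rule dmap_eq)
    fix i \<zeta> assume i: "k \<le> i" and \<zeta>: "\<zeta> \<in> stage Src.H i"
    obtain l where l: "i = k + l" using i le_Suc_ex by blast
    show "gseq k \<gamma> (i - k) \<cdot>\<^bsub>cat \<Delta> i\<^esub> \<zeta> \<in> stage Tgt.H i \<and>
        gseq k \<gamma> (Suc i - k) \<cdot>\<^bsub>cat \<Delta> (Suc i)\<^esub> incl Src.H i \<zeta> =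
        incl Tgt.H i (gseq k \<gamma> (i - k) \<cdot>\<^bsub>cat \<Delta> i\<^esub> \<zeta>)"
    proof
      show "gseq k \<gamma> (i - k) \<cdot>\<^bsub>cat \<Delta> i\<^esub> \<zeta> \<in> stage Tgt.H i"
        using gseq_morph[OF \<gamma>, of l] \<zeta> by (simp add: l)
      have "Suc (k + l) - k = Suc l" "k + l - k = l" by simp_all
      then show "gseq k \<gamma> (Suc i - k) \<cdot>\<^bsub>cat \<Delta> (Suc i)\<^esub> incl Src.H i \<zeta> =
          incl Tgt.H i (gseq k \<gamma> (i - k) \<cdot>\<^bsub>cat \<Delta> i\<^esub> \<zeta>)"
        using gseq_incl[OF \<gamma>, of \<zeta> l] \<zeta> unfolding l by (simp only:)
    qed
  qed (use \<xi> in simp_all)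
  then show ?thesis
    unfolding Phi_def using Src.Corr.dclass_in_dunion[OF \<xi>] by simp
qed

lemma Phi_eqI:
  assumes ext: "T \<in> extensional (dunion Src.H)" and \<gamma>: "corr_morph k \<gamma>"
    and T: "\<And>j \<xi>. \<xi> \<in> stage Src.H (k + j) \<Longrightarrow>
      T (dclass Src.H (k + j) \<xi>) = dclass Tgt.H (k + j) (gseq k \<gamma> j \<cdot>\<^bsub>cat \<Delta> (k + j)\<^esub> \<xi>)"
  shows "T = Phi_op k \<gamma>"
proof (rule extensionalityI[OF ext])
  show "Phi_op k \<gamma> \<in> extensional (dunion Src.H)" by (simp add: Phi_def)
  fix X assume "X \<in> dunion Src.H"
  from Src.Corr.dunion_rep[OF this, of k]
  obtain l \<xi> where "\<xi> \<in> stage Src.H (k + l)" "X = dclass Src.H (k + l) \<xi>" by blast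
  then show "T X = Phi_op k \<gamma> X" using T Phi_dclass[OF \<gamma>] by simp
qed

lemma Phi_extensional: "Phi_op k \<gamma> \<in> extensional (dunion Src.H)"
  by (simp add: Phi_def)

text \<open>The sequence started at \<open>\<gamma>_1\<close> is the tail of the one started at
  \<open>\<gamma>\<close>, so the level attached to an operator can be raised.\<close>

lemma Phi_shift:
  assumes \<gamma>: "corr_morph k \<gamma>"
  shows "Phi_op k \<gamma> = Phi_op (Suc k) (gseq k \<gamma> 1)"
proof (rule Phi_eqI[OF Phi_extensional])
  show "corr_morph (Suc k) (gseq k \<gamma> 1)" using gseq_morph[OF \<gamma>, of 1] by simp
  fix j \<xi> assume "\<xi> \<in> stage Src.H (Suc k + j)"
  then have "\<xi> \<in> stage Src.H (k + Suc j)" by (simp only: add_Suc_right add_Suc)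
  from Phi_dclass[OF \<gamma> this]
  show "Phi_op k \<gamma> (dclass Src.H (Suc k + j) \<xi>) = dclass Tgt.H (Suc k + j)
      (gseq (Suc k) (gseq k \<gamma> 1) j \<cdot>\<^bsub>cat \<Delta> (Suc k + j)\<^esub> \<xi>)"
    by (simp only: gseq_shift add_Suc_right add_Suc)
qed

lemma gseq_lift:
  assumes \<gamma>: "corr_morph k \<gamma>" and \<xi>: "\<xi> \<in> stage Src.H k"
  shows "gseq k \<gamma> j \<cdot>\<^bsub>cat \<Delta> (k + j)\<^esub> transport Src.H k j \<xi> =
    transport Tgt.H k j (\<gamma> \<cdot>\<^bsub>cat \<Delta> k\<^esub> \<xi>)"
proof (induction j)
  case (Suc j)
  show ?case
    using gseq_incl[OF \<gamma> Src.Corr.transport_stage[OF \<xi>, of j]] Suc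
    by (simp only: transport.simps add_Suc_right)
qed simp

text \<open>Classes are injective on level \<open>k\<close>, so the operator determines
  \<open>\<gamma> \<xi>\<close> for every \<open>\<xi>\<close> lifted from \<open>H_0\<close>, and
  these determine \<open>\<gamma>\<close>.\<close>

lemma Phi_inj:
  assumes \<gamma>: "corr_morph k \<gamma>" "corr_morph k \<gamma>'" and eq: "Phi_op k \<gamma> = Phi_op k \<gamma>'"
  shows "\<gamma> = \<gamma>'"
proof (rule Src.eq_on_lifted[OF \<gamma>])
  fix \<xi> assume "\<xi> \<in> stage Src.H 0"
  from Src.Corr.transport_stage[OF this, of k]
  have \<xi>: "transport Src.H 0 k \<xi> \<in> stage Src.H (k + 0)" by simp
  have "dclass Tgt.H k (\<gamma> \<cdot>\<^bsub>cat \<Delta> k\<^esub> transport Src.H 0 k \<xi>) =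
      dclass Tgt.H k (\<gamma>' \<cdot>\<^bsub>cat \<Delta> k\<^esub> transport Src.H 0 k \<xi>)"
    using Phi_dclass[OF \<gamma>(1) \<xi>] Phi_dclass[OF \<gamma>(2) \<xi>] eq by simp
  then show "\<gamma> \<cdot>\<^bsub>cat \<Delta> k\<^esub> transport Src.H 0 k \<xi> = \<gamma>' \<cdot>\<^bsub>cat \<Delta> k\<^esub> transport Src.H 0 k \<xi>"
    by (rule Tgt.Corr.dclass_inj) (use \<gamma> \<xi> in simp_all)
qed

text \<open>The recursion commutes with adjoints once \<open>\<Lambda>\<close> and
  \<open>\<Omega>\<close> are exchanged. Hence the operator of \<open>\<gamma>*\<close> is the
  adjoint of \<open>\<Phi>_\<gamma>\<close>.\<close>

lemma gseq_adjoint: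
  assumes \<gamma>: "corr_morph k \<gamma>"
  shows "gamma_seq \<Gamma> \<Delta> m \<Omega> \<Lambda> k (hadj (cat \<Delta> k) \<gamma>) j = hadj (cat \<Delta> (k + j)) (gseq k \<gamma> j)"
proof (induction j)
  case (Suc j)
  then show ?case using gseq_morph[OF \<gamma>, of j] by simp
qed simp

text \<open>Right linearity and the adjoint, given by \<open>\<gamma>*\<close>, hold for any
  \<open>\<gamma>\<close>. Left linearity is the real condition; commutation is required at all
  levels because \<open>\<alpha>\<close> of level \<open>k + j\<close> meets
  \<open>\<gamma>_j\<close>.\<close>

lemma Phi_intertwiner:
  assumes \<gamma>: "corr_morph k \<gamma>"
    and comm: "\<And>j \<alpha>. \<alpha> \<in> stage (alg_sys \<Gamma> m) (k + j) \<Longrightarrow>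
      gseq k \<gamma> j \<cdot>\<^bsub>cat \<Delta> (k + j)\<^esub> far (fun1 \<Lambda> (k + j)) \<alpha> =
      far (fun1 \<Omega> (k + j)) \<alpha> \<cdot>\<^bsub>cat \<Delta> (k + j)\<^esub> gseq k \<gamma> j"
  shows "Phi_op k \<gamma> \<in> corr_intertwiners \<Gamma> \<Delta> m n \<Lambda> \<Omega>"
proof -
  interpret Rev: one_cell_pair \<Gamma> \<Delta> m n \<Omega> \<Lambda> by unfold_locales
  note gm = gseq_morph[OF \<gamma>]
  let ?T = "Phi_op k \<gamma>" and ?S = "Rev.Phi_op k (hadj (cat \<Delta> k) \<gamma>)"
  note T = Phi_dclass[OF \<gamma>]
  have \<gamma>': "Rev.corr_morph k (hadj (cat \<Delta> k) \<gamma>)" using \<gamma> by simp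
  note S = Rev.Phi_dclass[OF \<gamma>', unfolded gseq_adjoint[OF \<gamma>]]
  show ?thesis
    unfolding corr_intertwiners_def intertwiners_def Src.vecs_corr Tgt.vecs_corr
  proof (intro CollectI conjI ballI allI)
    show "?T \<in> dunion Src.H \<rightarrow>\<^sub>E dunion Tgt.H"
    proof (rule PiE_I)
      fix X assume "X \<in> dunion Src.H"
      then obtain j \<xi> where X: "\<xi> \<in> stage Src.H (k + j)" "X = dclass Src.H (k + j) \<xi>"
        using Src.Corr.dunion_rep[of X k] by blast
      show "?T X \<in> dunion Tgt.H"
        unfolding X(2) T[OF X(1)] by (rule Tgt.Corr.dclass_in_dunion) (use X(1) gm[of j] in simp)
    qed (simp add: Phi_def)
  next
    fix X Y assume "X \<in> dunion Src.H" "Y \<in> dunion Src.H"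
    then obtain j \<xi> \<zeta> where X: "\<xi> \<in> stage Src.H (k + j)" "X = dclass Src.H (k + j) \<xi>"
      and Y: "\<zeta> \<in> stage Src.H (k + j)" "Y = dclass Src.H (k + j) \<zeta>"
      using Src.Corr.dunion_rep[of X k] Src.Corr.dunion_rep[of Y k] by (metis nat_le_linear)
    have "hadd (cat \<Delta> (k + j)) \<xi> \<zeta> \<in> stage Src.H (k + j)" using X Y by simp
    note eqs = Src.vadd_corr[OF X(1) Y(1)] T[OF this] T[OF X(1)] T[OF Y(1)]
    show "?T (vadd Src.correspondence X Y) = vadd Tgt.correspondence (?T X) (?T Y)"
      unfolding X(2) Y(2) eqs by (subst Tgt.vadd_corr) (use X(1) Y(1) gm[of j] in simp_all)
  next
    fix c X assume "X \<in> dunion Src.H"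
    then obtain j \<xi> where X: "\<xi> \<in> stage Src.H (k + j)" "X = dclass Src.H (k + j) \<xi>"
      using Src.Corr.dunion_rep[of X k] by blast
    have "hscale (cat \<Delta> (k + j)) c \<xi> \<in> stage Src.H (k + j)" using X by simp
    note eqs = Src.vscale_corr[OF X(1)] T[OF this] T[OF X(1)]
    show "?T (vscale Src.correspondence c X) = vscale Tgt.correspondence c (?T X)"
      unfolding X(2) eqs by (subst Tgt.vscale_corr) (use X(1) gm[of j] in simp_all)
  next
    fix A X assume "A \<in> dunion (alg_sys \<Gamma> m)" "X \<in> dunion Src.H"
    then obtain j \<alpha> \<xi> where A: "\<alpha> \<in> stage (alg_sys \<Gamma> m) (k + j)" "A = dclass (alg_sys \<Gamma> m) (k + j) \<alpha>"
      and X: "\<xi> \<in> stage Src.H (k + j)" "X = dclass Src.H (k + j) \<xi>"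
      using Src.Dom.Alg.dunion_rep[of A k] Src.Corr.dunion_rep[of X k] by (metis nat_le_linear)
    have "far (fun1 \<Lambda> (k + j)) \<alpha> \<cdot>\<^bsub>cat \<Delta> (k + j)\<^esub> \<xi> \<in> stage Src.H (k + j)" using A X by simp
    note eqs = Src.lact_corr[OF A(1) X(1)] T[OF this] T[OF X(1)]
    have "(gseq k \<gamma> j \<cdot>\<^bsub>cat \<Delta> (k + j)\<^esub> far (fun1 \<Lambda> (k + j)) \<alpha>) \<cdot>\<^bsub>cat \<Delta> (k + j)\<^esub> \<xi> =
        far (fun1 \<Omega> (k + j)) \<alpha> \<cdot>\<^bsub>cat \<Delta> (k + j)\<^esub> (gseq k \<gamma> j \<cdot>\<^bsub>cat \<Delta> (k + j)\<^esub> \<xi>)"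
      unfolding comm[OF A(1)] using A(1) X(1) gm[of j] by simp
    then show "?T (lact Src.correspondence A X) = lact Tgt.correspondence A (?T X)"
      unfolding A(2) X(2) eqs by (subst Tgt.lact_corr) (use A(1) X(1) gm[of j] in simp_all)
  next
    fix X B assume "X \<in> dunion Src.H" "B \<in> dunion (alg_sys \<Delta> n)"
    then obtain j \<xi> \<beta> where X: "\<xi> \<in> stage Src.H (k + j)" "X = dclass Src.H (k + j) \<xi>"
      and B: "\<beta> \<in> stage (alg_sys \<Delta> n) (k + j)" "B = dclass (alg_sys \<Delta> n) (k + j) \<beta>"
      using Src.Cod.Alg.dunion_rep[of B k] Src.Corr.dunion_rep[of X k] by (metis nat_le_linear)
    have "\<xi> \<cdot>\<^bsub>cat \<Delta> (k + j)\<^esub> \<beta> \<in> stage Src.H (k + j)" using B X by simp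
    note eqs = Src.ract_corr[OF X(1) B(1)] T[OF this] T[OF X(1)]
    show "?T (ract Src.correspondence X B) = ract Tgt.correspondence (?T X) B"
      unfolding X(2) B(2) eqs by (subst Tgt.ract_corr) (use B(1) X(1) gm[of j] in simp_all)
  next
    have "?S \<in> dunion Tgt.H \<rightarrow> dunion Src.H"
    proof
      fix Y assume "Y \<in> dunion Tgt.H"
      then obtain j \<zeta> where Y: "\<zeta> \<in> stage Tgt.H (k + j)" "Y = dclass Tgt.H (k + j) \<zeta>"
        using Tgt.Corr.dunion_rep[of Y k] by blast
      show "?S Y \<in> dunion Src.H"
        unfolding Y(2) S[OF Y(1)] by (rule Src.Corr.dclass_in_dunion) (use Y(1) gm[of j] in simp)
    qed
    moreover have "inner Tgt.correspondence (?T X) Y = inner Src.correspondence X (?S Y)"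
      if XY: "X \<in> dunion Src.H" "Y \<in> dunion Tgt.H" for X Y
    proof -
      obtain j \<xi> \<zeta> where X: "\<xi> \<in> stage Src.H (k + j)" "X = dclass Src.H (k + j) \<xi>"
        and Y: "\<zeta> \<in> stage Tgt.H (k + j)" "Y = dclass Tgt.H (k + j) \<zeta>"
        using Src.Corr.dunion_rep[OF XY(1), of k] Tgt.Corr.dunion_rep[OF XY(2), of k]
        by (metis nat_le_linear)
      have "gseq k \<gamma> j \<cdot>\<^bsub>cat \<Delta> (k + j)\<^esub> \<xi> \<in> stage Tgt.H (k + j)"
        "hadj (cat \<Delta> (k + j)) (gseq k \<gamma> j) \<cdot>\<^bsub>cat \<Delta> (k + j)\<^esub> \<zeta> \<in> stage Src.H (k + j)"
        using X(1) Y(1) gm[of j] by simp_all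
      note eqs = Tgt.inner_corr[OF this(1) Y(1)] Src.inner_corr[OF X(1) this(2)] T[OF X(1)] S[OF Y(1)]
      show ?thesis unfolding X(2) Y(2) eqs using X(1) Y(1) gm[of j] by simp
    qed
    ultimately show "\<exists>S\<in>dunion Tgt.H \<rightarrow> dunion Src.H. \<forall>X\<in>dunion Src.H. \<forall>Y\<in>dunion Tgt.H.
        inner Tgt.correspondence (?T X) Y = inner Src.correspondence X (S Y)"
      by blast
  qed
qed

section \<open>From 2-cells to intertwiners\<close>

lemma NT_gseq:
  assumes \<eta>: "\<And>k. k \<ge> K \<Longrightarrow> \<eta> k \<in> nt_space \<Gamma> \<Delta> \<Lambda> \<Omega> k"
    and ex: "\<And>k. k \<ge> K \<Longrightarrow> exchange \<Gamma> \<Delta> \<Lambda> \<Omega> k (\<eta> k) (\<eta> (k + 1))" and k: "k \<ge> K"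
  shows "gseq k (\<eta> k (tower \<Gamma> m k)) j = \<eta> (k + j) (tower \<Gamma> m (k + j))"
proof (induction j)
  case (Suc j)
  let ?x = "tower \<Gamma> m (k + j)" and ?D = "cat \<Delta> (Suc (k + j))"
  have m: "corr_morph (k + j) (\<eta> (k + j) ?x)"
    "corr_morph (Suc (k + j)) (\<eta> (Suc (k + j)) (tower \<Gamma> m (Suc (k + j))))"
    using Pair.NT_morph \<eta>[of "k + j"] \<eta>[of "Suc (k + j)"] k unfolding nt_space_def by simp_all
  \<comment> \<open>Composed on the right with the adjoint of \<open>W\<close> for
    \<open>\<Lambda>\<close>, the exchange relation at the tower object is the recursion step of
    \<open>gseq\<close>.\<close>
  have e: "conn \<Omega> (Suc (k + j)) ?x \<cdot>\<^bsub>?D\<^esub> far (step \<Delta> (Suc (k + j))) (\<eta> (k + j) ?x) =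
      \<eta> (Suc (k + j)) (tower \<Gamma> m (Suc (k + j))) \<cdot>\<^bsub>?D\<^esub> conn \<Lambda> (Suc (k + j)) ?x"
    using ex[of "k + j"] k unfolding exchange_def by simp
  have "gseq k (\<eta> k (tower \<Gamma> m k)) (Suc j) =
      (conn \<Omega> (Suc (k + j)) ?x \<cdot>\<^bsub>?D\<^esub> far (step \<Delta> (Suc (k + j))) (\<eta> (k + j) ?x))
        \<cdot>\<^bsub>?D\<^esub> hadj ?D (conn \<Lambda> (Suc (k + j)) ?x)"
    by (simp add: Suc)
  also have "\<dots> = \<eta> (Suc (k + j)) (tower \<Gamma> m (Suc (k + j)))"
    unfolding e using m by simp
  finally show ?case by simp
qed simp

lemma two_cell_intertwiner:
  assumes \<eta>: "\<And>k. k \<ge> K \<Longrightarrow> \<eta> k \<in> nt_space \<Gamma> \<Delta> \<Lambda> \<Omega> k"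
    and ex: "\<And>k. k \<ge> K \<Longrightarrow> exchange \<Gamma> \<Delta> \<Lambda> \<Omega> k (\<eta> k) (\<eta> (k + 1))" and k: "k \<ge> K"
  shows "Phi_op k (\<eta> k (tower \<Gamma> m k)) \<in> corr_intertwiners \<Gamma> \<Delta> m n \<Lambda> \<Omega>"
proof (rule Phi_intertwiner)
  show "corr_morph k (\<eta> k (tower \<Gamma> m k))"
    using Pair.NT_morph \<eta>[OF k] unfolding nt_space_def by simp
  fix j \<alpha> assume "\<alpha> \<in> stage (alg_sys \<Gamma> m) (k + j)"
  moreover have "\<eta> (k + j) \<in> nt_space \<Gamma> \<Delta> \<Lambda> \<Omega> (k + j)" using \<eta>[of "k + j"] k by simp
  ultimately show "gseq k (\<eta> k (tower \<Gamma> m k)) j \<cdot>\<^bsub>cat \<Delta> (k + j)\<^esub> far (fun1 \<Lambda> (k + j)) \<alpha> =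
      far (fun1 \<Omega> (k + j)) \<alpha> \<cdot>\<^bsub>cat \<Delta> (k + j)\<^esub> gseq k (\<eta> k (tower \<Gamma> m k)) j"
    using Pair.NT_natural[of "\<eta> (k + j)" "k + j" \<alpha>] NT_gseq[OF \<eta> ex k]
    unfolding nt_space_def by simp
qed

lemma two_cell_independent:
  assumes \<eta>: "\<And>k. k \<ge> K \<Longrightarrow> \<eta> k \<in> nt_space \<Gamma> \<Delta> \<Lambda> \<Omega> k"
    and ex: "\<And>k. k \<ge> K \<Longrightarrow> exchange \<Gamma> \<Delta> \<Lambda> \<Omega> k (\<eta> k) (\<eta> (k + 1))" and k: "k \<ge> K"
  shows "Phi_op k (\<eta> k (tower \<Gamma> m k)) = Phi_op K (\<eta> K (tower \<Gamma> m K))"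
proof -
  have "Phi_op (K + j) (\<eta> (K + j) (tower \<Gamma> m (K + j))) = Phi_op K (\<eta> K (tower \<Gamma> m K))" for j
  proof (induction j)
    case (Suc j)
    have "corr_morph (K + j) (\<eta> (K + j) (tower \<Gamma> m (K + j)))"
      using Pair.NT_morph \<eta>[of "K + j"] unfolding nt_space_def by simp
    note shift = Phi_shift[OF this]
    have "gseq (K + j) (\<eta> (K + j) (tower \<Gamma> m (K + j))) 1 =
        \<eta> (K + j + 1) (tower \<Gamma> m (K + j + 1))"
      by (rule NT_gseq[where K = K]) (use \<eta> ex in simp_all)
    with shift Suc show ?case by (simp del: gamma_seq.simps)
  qed simp
  from this[of "k - K"] k show ?thesis by simp
qed

section \<open>From intertwiners to natural transformations\<close>

lemma intertwinerD:
  assumes "T \<in> corr_intertwiners \<Gamma> \<Delta> m n \<Lambda> \<Omega>"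
  shows "T \<in> extensional (dunion Src.H)"
    and "X \<in> dunion Src.H \<Longrightarrow> T X \<in> dunion Tgt.H"
    and "\<lbrakk>X \<in> dunion Src.H; Y \<in> dunion Src.H\<rbrakk>
      \<Longrightarrow> T (vadd Src.correspondence X Y) = vadd Tgt.correspondence (T X) (T Y)"
    and "\<lbrakk>A \<in> dunion (alg_sys \<Gamma> m); X \<in> dunion Src.H\<rbrakk>
      \<Longrightarrow> T (lact Src.correspondence A X) = lact Tgt.correspondence A (T X)"
    and "\<lbrakk>X \<in> dunion Src.H; B \<in> dunion (alg_sys \<Delta> n)\<rbrakk>
      \<Longrightarrow> T (ract Src.correspondence X B) = ract Tgt.correspondence (T X) B"
  using assms unfolding corr_intertwiners_def intertwiners_def by (auto simp: PiE_def)

text \<open>\<open>H_0\<close> is finitely generated over \<open>B_0\<close>: the image of each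
  generator lies in some \<open>G_l\<close>, and the largest such \<open>l\<close> serves for all of
  \<open>H_0\<close>. This makes the minimum \<open>K_T\<close> exist.\<close>

lemma intertwiner_bounded:
  assumes T: "T \<in> corr_intertwiners \<Gamma> \<Delta> m n \<Lambda> \<Omega>"
  shows "\<exists>l. maps_level0_into \<Gamma> \<Delta> m n \<Lambda> \<Omega> T l"
proof -
  let ?y = "Src.corr_obj 0" and ?D = "cat \<Delta> 0"
  \<comment> \<open>The induction is over partial sums \<open>a\<close> of the identity, with
    \<open>T\<close> evaluated on \<open>a \<xi>\<close>; the full sum gives
    \<open>T \<xi>\<close>.\<close>
  have "morph ?D (ident ?D ?y) ?y ?y \<and> (\<exists>l. \<forall>\<xi>\<in>stage Src.H 0.
      T (dclass Src.H 0 (ident ?D ?y \<cdot>\<^bsub>?D\<^esub> \<xi>)) \<in> dlevel Tgt.H l)"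
    using Src.lifted_generation[of 0]
  proof (induction rule: addspan.induct)
    case (base a)
    then obtain \<zeta> h where a: "a = \<zeta> \<cdot>\<^bsub>?D\<^esub> h" "\<zeta> \<in> stage Src.H 0" "morph ?D h ?y n" by auto
    have "T (dclass Src.H 0 \<zeta>) \<in> dunion Tgt.H"
      using intertwinerD(2)[OF T] Src.Corr.dclass_in_dunion[OF a(2)] by blast
    then obtain l t where t: "t \<in> stage Tgt.H l" "T (dclass Src.H 0 \<zeta>) = dclass Tgt.H l t"
      using Tgt.Corr.dunion_rep[of _ 0] by fastforce
    have "T (dclass Src.H 0 (a \<cdot>\<^bsub>?D\<^esub> \<xi>)) \<in> dlevel Tgt.H l" if \<xi>: "\<xi> \<in> stage Src.H 0" for \<xi>
    proof -
      have h\<xi>: "h \<cdot>\<^bsub>?D\<^esub> \<xi> \<in> stage (alg_sys \<Delta> n) 0" using \<xi> a(3) by simp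
      \<comment> \<open>The coefficient \<open>h \<xi>\<close> lies in \<open>B_0\<close> and is
        moved to the level \<open>l\<close> of \<open>t\<close>, where the right action on
        \<open>G\<close> can be computed.\<close>
      define b where "b = transport (alg_sys \<Delta> n) 0 l (h \<cdot>\<^bsub>?D\<^esub> \<xi>)"
      have b: "b \<in> stage (alg_sys \<Delta> n) l"
          "dclass (alg_sys \<Delta> n) 0 (h \<cdot>\<^bsub>?D\<^esub> \<xi>) = dclass (alg_sys \<Delta> n) l b"
        using Src.Cod.Alg.transport_stage[OF h\<xi>, of l] Src.Cod.Alg.dclass_transport[OF h\<xi>, of l]
        by (simp_all add: b_def)
      have "dclass Src.H 0 (a \<cdot>\<^bsub>?D\<^esub> \<xi>) =
          ract Src.correspondence (dclass Src.H 0 \<zeta>) (dclass (alg_sys \<Delta> n) 0 (h \<cdot>\<^bsub>?D\<^esub> \<xi>))"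
        unfolding Src.ract_corr[OF a(2) h\<xi>] using a \<xi> by simp
      then have "T (dclass Src.H 0 (a \<cdot>\<^bsub>?D\<^esub> \<xi>)) =
          ract Tgt.correspondence (T (dclass Src.H 0 \<zeta>)) (dclass (alg_sys \<Delta> n) 0 (h \<cdot>\<^bsub>?D\<^esub> \<xi>))"
        using intertwinerD(5)[OF T Src.Corr.dclass_in_dunion[OF a(2)]
            Src.Cod.Alg.dclass_in_dunion[OF h\<xi>]] by simp
      also have "\<dots> = dclass Tgt.H l (t \<cdot>\<^bsub>cat \<Delta> l\<^esub> b)"
        unfolding t(2) b(2) by (rule Tgt.ract_corr[OF t(1) b(1)])
      finally show ?thesis using t(1) b(1) by (auto simp: dlevel_def)
    qed
    moreover have "morph ?D a ?y ?y" using a by simp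
    ultimately show ?case by blast
  next
    case (add a b)
    then obtain l l' where l: "\<And>\<xi>. \<xi> \<in> stage Src.H 0 \<Longrightarrow> T (dclass Src.H 0 (a \<cdot>\<^bsub>?D\<^esub> \<xi>)) \<in> dlevel Tgt.H l"
        "\<And>\<xi>. \<xi> \<in> stage Src.H 0 \<Longrightarrow> T (dclass Src.H 0 (b \<cdot>\<^bsub>?D\<^esub> \<xi>)) \<in> dlevel Tgt.H l'"
      by blast
    have "T (dclass Src.H 0 (hadd ?D a b \<cdot>\<^bsub>?D\<^esub> \<xi>)) \<in> dlevel Tgt.H (max l l')"
      if \<xi>: "\<xi> \<in> stage Src.H 0" for \<xi>
    proof -
      have ab: "a \<cdot>\<^bsub>?D\<^esub> \<xi> \<in> stage Src.H 0" "b \<cdot>\<^bsub>?D\<^esub> \<xi> \<in> stage Src.H 0" using \<xi> add by simp_all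
      have "T (dclass Src.H 0 (a \<cdot>\<^bsub>?D\<^esub> \<xi>)) \<in> dlevel Tgt.H (max l l')"
        "T (dclass Src.H 0 (b \<cdot>\<^bsub>?D\<^esub> \<xi>)) \<in> dlevel Tgt.H (max l l')"
        using subsetD[OF Tgt.Corr.dlevel_mono[OF max.cobounded1] l(1)[OF \<xi>]]
          subsetD[OF Tgt.Corr.dlevel_mono[OF max.cobounded2] l(2)[OF \<xi>]] .
      then obtain s t where st: "s \<in> stage Tgt.H (max l l')" "t \<in> stage Tgt.H (max l l')"
          "T (dclass Src.H 0 (a \<cdot>\<^bsub>?D\<^esub> \<xi>)) = dclass Tgt.H (max l l') s"
          "T (dclass Src.H 0 (b \<cdot>\<^bsub>?D\<^esub> \<xi>)) = dclass Tgt.H (max l l') t"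
        unfolding dlevel_def by blast
      have "T (dclass Src.H 0 (hadd ?D a b \<cdot>\<^bsub>?D\<^esub> \<xi>)) =
          T (vadd Src.correspondence (dclass Src.H 0 (a \<cdot>\<^bsub>?D\<^esub> \<xi>)) (dclass Src.H 0 (b \<cdot>\<^bsub>?D\<^esub> \<xi>)))"
        unfolding Src.vadd_corr[OF ab] using \<xi> add by simp
      also have "\<dots> = vadd Tgt.correspondence (T (dclass Src.H 0 (a \<cdot>\<^bsub>?D\<^esub> \<xi>)))
          (T (dclass Src.H 0 (b \<cdot>\<^bsub>?D\<^esub> \<xi>)))"
        by (intro intertwinerD(3)[OF T] Src.Corr.dclass_in_dunion ab)
      also have "\<dots> = dclass Tgt.H (max l l') (hadd (cat \<Delta> (max l l')) s t)"
        unfolding st(3,4) by (rule Tgt.vadd_corr[OF st(1,2)])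
      finally show ?thesis using st(1,2) by (auto simp: dlevel_def)
    qed
    moreover have "morph ?D (hadd ?D a b) ?y ?y" using add by simp
    ultimately show ?case by blast
  qed
  then obtain l where l: "\<And>\<xi>. \<xi> \<in> stage Src.H 0 \<Longrightarrow>
      T (dclass Src.H 0 (ident ?D ?y \<cdot>\<^bsub>?D\<^esub> \<xi>)) \<in> dlevel Tgt.H l" by blast
  have "T (dclass Src.H 0 \<xi>) \<in> dlevel Tgt.H l" if "\<xi> \<in> stage Src.H 0" for \<xi>
    using l[OF that] that by simp
  then have "maps_level0_into \<Gamma> \<Delta> m n \<Lambda> \<Omega> T l"
    unfolding maps_level0_into_def dlevel_def[of Src.H] by blast
  then show ?thesis ..
qed

text \<open>With \<open>1 = \<Sum>\<^sub>i f\<^sub>i h\<^sub>i\<close>, where the \<open>f\<^sub>i\<close> are lifted from \<open>H\<^sub>0\<close>,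
  \<open>B\<close>-linearity forces \<open>T\<xi> = \<Sum>\<^sub>i T(f\<^sub>i) h\<^sub>i \<xi>\<close> on \<open>H\<^sub>k\<close>.\<close>

lemma intertwiner_levelwise:
  assumes T: "T \<in> corr_intertwiners \<Gamma> \<Delta> m n \<Lambda> \<Omega>"
    and k: "maps_level0_into \<Gamma> \<Delta> m n \<Lambda> \<Omega> T k"
  shows "\<exists>\<gamma>. corr_morph k \<gamma> \<and>
    (\<forall>\<xi>\<in>stage Src.H k. T (dclass Src.H k \<xi>) = dclass Tgt.H k (\<gamma> \<cdot>\<^bsub>cat \<Delta> k\<^esub> \<xi>))"
proof -
  let ?y = "Src.corr_obj k" and ?D = "cat \<Delta> k"
  have "morph ?D (ident ?D ?y) ?y ?y \<and> (\<exists>\<gamma>. corr_morph k \<gamma> \<and> (\<forall>\<xi>\<in>stage Src.H k.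
      T (dclass Src.H k (ident ?D ?y \<cdot>\<^bsub>?D\<^esub> \<xi>)) = dclass Tgt.H k (\<gamma> \<cdot>\<^bsub>?D\<^esub> \<xi>)))"
    using Src.lifted_generation[of k]
  proof (induction rule: addspan.induct)
    case (base a)
    then obtain \<zeta> h where a: "a = transport Src.H 0 k \<zeta> \<cdot>\<^bsub>?D\<^esub> h" "\<zeta> \<in> stage Src.H 0"
        "morph ?D h ?y (tower \<Delta> n k)" by blast
    define f where "f = transport Src.H 0 k \<zeta>"
    have f: "f \<in> stage Src.H k" "dclass Src.H k f = dclass Src.H 0 \<zeta>"
      using Src.Corr.transport_stage[OF a(2), of k] Src.Corr.dclass_transport[OF a(2), of k]
      by (simp_all add: f_def)
    \<comment> \<open>The hypothesis on \<open>H_0\<close> is applied to the generator; its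
      coefficient \<open>h \<xi>\<close> already lies in \<open>B_k\<close>, so the product stays at
      level \<open>k\<close>.\<close>
    have "T (dclass Src.H 0 \<zeta>) \<in> dlevel Tgt.H k"
      using k a(2) unfolding maps_level0_into_def dlevel_def[of Src.H] by blast
    then obtain t where t: "t \<in> stage Tgt.H k" "T (dclass Src.H k f) = dclass Tgt.H k t"
      unfolding f(2) by (auto simp: dlevel_def)
    have "T (dclass Src.H k (a \<cdot>\<^bsub>?D\<^esub> \<xi>)) = dclass Tgt.H k ((t \<cdot>\<^bsub>?D\<^esub> h) \<cdot>\<^bsub>?D\<^esub> \<xi>)"
      if \<xi>: "\<xi> \<in> stage Src.H k" for \<xi>
    proof -
      have h\<xi>: "h \<cdot>\<^bsub>?D\<^esub> \<xi> \<in> stage (alg_sys \<Delta> n) k" using \<xi> a(3) by simp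
      have "dclass Src.H k (a \<cdot>\<^bsub>?D\<^esub> \<xi>) =
          ract Src.correspondence (dclass Src.H k f) (dclass (alg_sys \<Delta> n) k (h \<cdot>\<^bsub>?D\<^esub> \<xi>))"
        unfolding Src.ract_corr[OF f(1) h\<xi>] using a(1,3) f(1) \<xi> by (simp flip: f_def)
      then have "T (dclass Src.H k (a \<cdot>\<^bsub>?D\<^esub> \<xi>)) =
          ract Tgt.correspondence (T (dclass Src.H k f)) (dclass (alg_sys \<Delta> n) k (h \<cdot>\<^bsub>?D\<^esub> \<xi>))"
        using intertwinerD(5)[OF T Src.Corr.dclass_in_dunion[OF f(1)]
            Src.Cod.Alg.dclass_in_dunion[OF h\<xi>]] by simp
      also have "\<dots> = dclass Tgt.H k (t \<cdot>\<^bsub>?D\<^esub> (h \<cdot>\<^bsub>?D\<^esub> \<xi>))"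
        unfolding t(2) by (rule Tgt.ract_corr[OF t(1) h\<xi>])
      finally show ?thesis using t(1) a(3) \<xi> by simp
    qed
    moreover have "corr_morph k (t \<cdot>\<^bsub>?D\<^esub> h)" "morph ?D a ?y ?y"
      using t(1) a(1,3) f(1) by (simp_all flip: f_def)
    ultimately show ?case by blast
  next
    case (add a b)
    then obtain \<gamma> \<delta> where c: "corr_morph k \<gamma>" "corr_morph k \<delta>"
        "\<And>\<xi>. \<xi> \<in> stage Src.H k \<Longrightarrow> T (dclass Src.H k (a \<cdot>\<^bsub>?D\<^esub> \<xi>)) = dclass Tgt.H k (\<gamma> \<cdot>\<^bsub>?D\<^esub> \<xi>)"
        "\<And>\<xi>. \<xi> \<in> stage Src.H k \<Longrightarrow> T (dclass Src.H k (b \<cdot>\<^bsub>?D\<^esub> \<xi>)) = dclass Tgt.H k (\<delta> \<cdot>\<^bsub>?D\<^esub> \<xi>)"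
      by blast
    have "T (dclass Src.H k (hadd ?D a b \<cdot>\<^bsub>?D\<^esub> \<xi>)) = dclass Tgt.H k (hadd ?D \<gamma> \<delta> \<cdot>\<^bsub>?D\<^esub> \<xi>)"
      if \<xi>: "\<xi> \<in> stage Src.H k" for \<xi>
    proof -
      have ab: "a \<cdot>\<^bsub>?D\<^esub> \<xi> \<in> stage Src.H k" "b \<cdot>\<^bsub>?D\<^esub> \<xi> \<in> stage Src.H k" using \<xi> add by simp_all
      have cd: "\<gamma> \<cdot>\<^bsub>?D\<^esub> \<xi> \<in> stage Tgt.H k" "\<delta> \<cdot>\<^bsub>?D\<^esub> \<xi> \<in> stage Tgt.H k" using \<xi> c(1,2) by simp_all
      have "T (dclass Src.H k (hadd ?D a b \<cdot>\<^bsub>?D\<^esub> \<xi>)) =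
          T (vadd Src.correspondence (dclass Src.H k (a \<cdot>\<^bsub>?D\<^esub> \<xi>)) (dclass Src.H k (b \<cdot>\<^bsub>?D\<^esub> \<xi>)))"
        unfolding Src.vadd_corr[OF ab] using \<xi> add by simp
      also have "\<dots> = vadd Tgt.correspondence (T (dclass Src.H k (a \<cdot>\<^bsub>?D\<^esub> \<xi>)))
          (T (dclass Src.H k (b \<cdot>\<^bsub>?D\<^esub> \<xi>)))"
        by (intro intertwinerD(3)[OF T] Src.Corr.dclass_in_dunion ab)
      also have "\<dots> = dclass Tgt.H k (hadd ?D \<gamma> \<delta> \<cdot>\<^bsub>?D\<^esub> \<xi>)"
        unfolding c(3)[OF \<xi>] c(4)[OF \<xi>] Tgt.vadd_corr[OF cd] using c(1,2) \<xi> by simp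
      finally show ?thesis .
    qed
    moreover have "corr_morph k (hadd ?D \<gamma> \<delta>)" "morph ?D (hadd ?D a b) ?y ?y"
      using c(1,2) add by simp_all
    ultimately show ?case by blast
  qed
  then obtain \<gamma> where \<gamma>: "corr_morph k \<gamma>" "\<And>\<xi>. \<xi> \<in> stage Src.H k \<Longrightarrow>
      T (dclass Src.H k (ident ?D ?y \<cdot>\<^bsub>?D\<^esub> \<xi>)) = dclass Tgt.H k (\<gamma> \<cdot>\<^bsub>?D\<^esub> \<xi>)" by blast
  have "T (dclass Src.H k \<xi>) = dclass Tgt.H k (\<gamma> \<cdot>\<^bsub>?D\<^esub> \<xi>)" if "\<xi> \<in> stage Src.H k" for \<xi>
    using \<gamma>(2)[OF that] that by simp
  with \<gamma>(1) show ?thesis by blast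
qed

lemma maps_level0_into_mono:
  assumes "maps_level0_into \<Gamma> \<Delta> m n \<Lambda> \<Omega> T k" "k \<le> l"
  shows "maps_level0_into \<Gamma> \<Delta> m n \<Lambda> \<Omega> T l"
  using assms Tgt.Corr.dlevel_mono unfolding maps_level0_into_def by blast

text \<open>Each level \<open>k + j\<close> yields its own \<open>\<delta>\<close>. It equals
  \<open>\<gamma>_j\<close> because both compute \<open>T\<close> on vectors lifted from
  \<open>H_0\<close>, where \<open>T\<close> is already known from level \<open>k\<close>.\<close>

lemma intertwiner_is_Phi:
  assumes T: "T \<in> corr_intertwiners \<Gamma> \<Delta> m n \<Lambda> \<Omega>"
    and k: "maps_level0_into \<Gamma> \<Delta> m n \<Lambda> \<Omega> T k"
  shows "\<exists>\<gamma>. corr_morph k \<gamma> \<and> T = Phi_op k \<gamma>"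
proof -
  obtain \<gamma> where \<gamma>: "corr_morph k \<gamma>"
      "\<And>\<xi>. \<xi> \<in> stage Src.H k \<Longrightarrow> T (dclass Src.H k \<xi>) = dclass Tgt.H k (\<gamma> \<cdot>\<^bsub>cat \<Delta> k\<^esub> \<xi>)"
    using intertwiner_levelwise[OF T k] by blast
  have "T = Phi_op k \<gamma>"
  proof (rule Phi_eqI[OF intertwinerD(1)[OF T] \<gamma>(1)])
    fix j \<xi> assume \<xi>: "\<xi> \<in> stage Src.H (k + j)"
    have "maps_level0_into \<Gamma> \<Delta> m n \<Lambda> \<Omega> T (k + j)" by (rule maps_level0_into_mono[OF k]) simp
    from intertwiner_levelwise[OF T this] obtain \<delta> where \<delta>: "corr_morph (k + j) \<delta>"
      "\<And>\<xi>. \<xi> \<in> stage Src.H (k + j) \<Longrightarrow>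
        T (dclass Src.H (k + j) \<xi>) = dclass Tgt.H (k + j) (\<delta> \<cdot>\<^bsub>cat \<Delta> (k + j)\<^esub> \<xi>)"
      by blast
    have "\<delta> = gseq k \<gamma> j"
    proof (rule Src.eq_on_lifted[OF \<delta>(1) gseq_morph[OF \<gamma>(1)]])
      fix \<zeta> assume \<zeta>: "\<zeta> \<in> stage Src.H 0"
      define f where "f = transport Src.H 0 k \<zeta>"
      have f: "f \<in> stage Src.H k" using Src.Corr.transport_stage[OF \<zeta>, of k] by (simp add: f_def)
      have lift: "transport Src.H 0 (k + j) \<zeta> = transport Src.H k j f"
        using Src.Corr.transport_add[of 0 k j \<zeta>] by (simp add: f_def)
      note fj = Src.Corr.transport_stage[OF f, of j]
      have g: "\<gamma> \<cdot>\<^bsub>cat \<Delta> k\<^esub> f \<in> stage Tgt.H k" using f \<gamma>(1) by simp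
      have "dclass Tgt.H (k + j) (\<delta> \<cdot>\<^bsub>cat \<Delta> (k + j)\<^esub> transport Src.H k j f) =
          T (dclass Src.H (k + j) (transport Src.H k j f))"
        using \<delta>(2)[OF fj] by simp
      also have "\<dots> = dclass Tgt.H k (\<gamma> \<cdot>\<^bsub>cat \<Delta> k\<^esub> f)"
        using \<gamma>(2)[OF f] Src.Corr.dclass_transport[OF f, of j] by simp
      also have "\<dots> = dclass Tgt.H (k + j) (gseq k \<gamma> j \<cdot>\<^bsub>cat \<Delta> (k + j)\<^esub> transport Src.H k j f)"
        using Tgt.Corr.dclass_transport[OF g, of j] gseq_lift[OF \<gamma>(1) f, of j] by simp
      finally show "\<delta> \<cdot>\<^bsub>cat \<Delta> (k + j)\<^esub> transport Src.H 0 (k + j) \<zeta> =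
          gseq k \<gamma> j \<cdot>\<^bsub>cat \<Delta> (k + j)\<^esub> transport Src.H 0 (k + j) \<zeta>"
        unfolding lift
        by (rule Tgt.Corr.dclass_inj) (use \<delta>(1) gseq_morph[OF \<gamma>(1), of j] fj in simp_all)
    qed
    with \<delta>(2)[OF \<xi>] show "T (dclass Src.H (k + j) \<xi>) =
        dclass Tgt.H (k + j) (gseq k \<gamma> j \<cdot>\<^bsub>cat \<Delta> (k + j)\<^esub> \<xi>)" by simp
  qed
  with \<gamma>(1) show ?thesis by blast
qed

text \<open>Left linearity of \<open>T\<close> is evaluated on vectors lifted from
  \<open>H_0\<close>, which suffice to separate morphisms out of
  \<open>\<Lambda>_k \<Gamma>_k ... \<Gamma>_1 m_0\<close>.\<close>

lemma intertwiner_commutes: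
  assumes T: "T \<in> corr_intertwiners \<Gamma> \<Delta> m n \<Lambda> \<Omega>" and \<gamma>: "corr_morph k \<gamma>" "T = Phi_op k \<gamma>"
    and \<alpha>: "morph (cat \<Gamma> k) \<alpha> (tower \<Gamma> m k) (tower \<Gamma> m k)"
  shows "\<gamma> \<cdot>\<^bsub>cat \<Delta> k\<^esub> far (fun1 \<Lambda> k) \<alpha> = far (fun1 \<Omega> k) \<alpha> \<cdot>\<^bsub>cat \<Delta> k\<^esub> \<gamma>"
proof (rule Src.eq_on_lifted)
  fix \<zeta> assume "\<zeta> \<in> stage Src.H 0"
  define f where "f = transport Src.H 0 k \<zeta>"
  have f: "f \<in> stage Src.H k"
    using Src.Corr.transport_stage[OF \<open>\<zeta> \<in> stage Src.H 0\<close>, of k] by (simp add: f_def)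
  have a: "\<alpha> \<in> stage (alg_sys \<Gamma> m) k" using \<alpha> by simp
  have af: "far (fun1 \<Lambda> k) \<alpha> \<cdot>\<^bsub>cat \<Delta> k\<^esub> f \<in> stage Src.H k" and gf: "\<gamma> \<cdot>\<^bsub>cat \<Delta> k\<^esub> f \<in> stage Tgt.H k"
    using \<alpha> f \<gamma>(1) by simp_all
  have T_eq: "T (dclass Src.H k \<xi>) = dclass Tgt.H k (\<gamma> \<cdot>\<^bsub>cat \<Delta> k\<^esub> \<xi>)" if "\<xi> \<in> stage Src.H k" for \<xi>
    using Phi_dclass[OF \<gamma>(1), of \<xi> 0] \<gamma>(2) that by simp
  have "dclass Tgt.H k (\<gamma> \<cdot>\<^bsub>cat \<Delta> k\<^esub> (far (fun1 \<Lambda> k) \<alpha> \<cdot>\<^bsub>cat \<Delta> k\<^esub> f)) =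
      T (lact Src.correspondence (dclass (alg_sys \<Gamma> m) k \<alpha>) (dclass Src.H k f))"
    unfolding Src.lact_corr[OF a f] T_eq[OF af] ..
  also have "\<dots> = lact Tgt.correspondence (dclass (alg_sys \<Gamma> m) k \<alpha>) (T (dclass Src.H k f))"
    by (intro intertwinerD(4)[OF T] Src.Corr.dclass_in_dunion f Src.Dom.Alg.dclass_in_dunion a)
  also have "\<dots> = dclass Tgt.H k (far (fun1 \<Omega> k) \<alpha> \<cdot>\<^bsub>cat \<Delta> k\<^esub> (\<gamma> \<cdot>\<^bsub>cat \<Delta> k\<^esub> f))"
    unfolding T_eq[OF f] Tgt.lact_corr[OF a gf] ..
  finally have "\<gamma> \<cdot>\<^bsub>cat \<Delta> k\<^esub> (far (fun1 \<Lambda> k) \<alpha> \<cdot>\<^bsub>cat \<Delta> k\<^esub> f) =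
      far (fun1 \<Omega> k) \<alpha> \<cdot>\<^bsub>cat \<Delta> k\<^esub> (\<gamma> \<cdot>\<^bsub>cat \<Delta> k\<^esub> f)"
    by (rule Tgt.Corr.dclass_inj) (use \<alpha> f \<gamma>(1) in simp_all)
  then show "(\<gamma> \<cdot>\<^bsub>cat \<Delta> k\<^esub> far (fun1 \<Lambda> k) \<alpha>) \<cdot>\<^bsub>cat \<Delta> k\<^esub> transport Src.H 0 k \<zeta> =
      (far (fun1 \<Omega> k) \<alpha> \<cdot>\<^bsub>cat \<Delta> k\<^esub> \<gamma>) \<cdot>\<^bsub>cat \<Delta> k\<^esub> transport Src.H 0 k \<zeta>"
    unfolding f_def[symmetric] using \<alpha> f \<gamma>(1) by simp
qed (use \<alpha> \<gamma>(1) in simp_all)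

lemma intertwiner_unique_NT:
  assumes T: "T \<in> corr_intertwiners \<Gamma> \<Delta> m n \<Lambda> \<Omega>"
    and k: "maps_level0_into \<Gamma> \<Delta> m n \<Lambda> \<Omega> T k"
  shows "\<exists>!\<eta>. \<eta> \<in> nt_space \<Gamma> \<Delta> \<Lambda> \<Omega> k \<and> T = Phi_op k (\<eta> (tower \<Gamma> m k))"
proof -
  obtain \<gamma> where \<gamma>: "corr_morph k \<gamma>" "T = Phi_op k \<gamma>" using intertwiner_is_Phi[OF T k] by blast
  \<comment> \<open>Injectivity of \<open>\<gamma> \<mapsto> \<Phi>_\<gamma>\<close> turns the
    operator equation into a condition on one component, to which unique extension applies.\<close>
  have iff: "T = Phi_op k (\<eta> (tower \<Gamma> m k)) \<longleftrightarrow> \<eta> (tower \<Gamma> m k) = \<gamma>"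
    if "\<eta> \<in> NT (cat \<Gamma> k) (cat \<Delta> k) (fun1 \<Lambda> k) (fun1 \<Omega> k)" for \<eta>
  proof
    assume "T = Phi_op k (\<eta> (tower \<Gamma> m k))"
    from this[symmetric] \<gamma>(2) have "Phi_op k (\<eta> (tower \<Gamma> m k)) = Phi_op k \<gamma>" by (rule trans)
    then show "\<eta> (tower \<Gamma> m k) = \<gamma>"
      by (rule Phi_inj[OF Pair.NT_morph[OF that Src.Dom.tower_obj] \<gamma>(1)])
  qed (use \<gamma>(2) in \<open>simp only:\<close>)
  have "\<exists>!\<eta>. \<eta> \<in> NT (cat \<Gamma> k) (cat \<Delta> k) (fun1 \<Lambda> k) (fun1 \<Omega> k) \<and> \<eta> (tower \<Gamma> m k) = \<gamma>"
    by (rule Pair.natural_extension[OF Src.Dom.tower_generates Src.Dom.tower_obj \<gamma>(1)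
          intertwiner_commutes[OF T \<gamma>]])
  then show ?thesis unfolding nt_space_def using iff by (metis (no_types, lifting))
qed

lemma Phi_eq_exchange:
  assumes \<eta>: "\<eta> \<in> nt_space \<Gamma> \<Delta> \<Lambda> \<Omega> k" and \<kappa>: "\<kappa> \<in> nt_space \<Gamma> \<Delta> \<Lambda> \<Omega> (Suc k)"
    and eq: "Phi_op k (\<eta> (tower \<Gamma> m k)) = Phi_op (Suc k) (\<kappa> (tower \<Gamma> m (Suc k)))"
  shows "exchange \<Gamma> \<Delta> \<Lambda> \<Omega> k \<eta> \<kappa>"
proof -
  let ?x = "tower \<Gamma> m k" and ?C = "cat \<Gamma> k" and ?D = "cat \<Delta> (Suc k)"
  let ?F = "fcomp (step \<Delta> (Suc k)) (fun1 \<Lambda> k)" and ?G = "fcomp (fun1 \<Omega> (Suc k)) (step \<Gamma> (Suc k))"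
  interpret FG: functor_pair ?C ?D ?F ?G
    unfolding functor_pair_def
    using cstar_functor_fcomp[OF Src.Fun.cstar_functor_axioms Src.Cod.Step.cstar_functor_axioms]
      cstar_functor_fcomp[OF Src.Dom.Step.cstar_functor_axioms Tgt.Fun.cstar_functor_axioms] by blast
  note \<eta>m = Pair.NT_morph[OF \<eta>[unfolded nt_space_def]]
  note \<kappa>m = Pair.NT_morph[OF \<kappa>[unfolded nt_space_def]]
  note \<eta>n = Pair.NT_natural[OF \<eta>[unfolded nt_space_def]]
  note \<kappa>n = Pair.NT_natural[OF \<kappa>[unfolded nt_space_def]]
  \<comment> \<open>Raising the level of the operator of \<open>\<eta>\<close> by one, injectivity
    at level \<open>k + 1\<close> identifies the component of \<open>\<kappa>\<close> with
    \<open>\<gamma>_1\<close>. Cancelling the unitary \<open>W\<close> gives the exchange relation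
    at the tower object.\<close>
  have "\<kappa> (tower \<Gamma> m (Suc k)) = gseq k (\<eta> ?x) 1"
  proof (rule Phi_inj)
    show "corr_morph (Suc k) (\<kappa> (tower \<Gamma> m (Suc k)))" using \<kappa>m Src.Dom.tower_obj by blast
    show "corr_morph (Suc k) (gseq k (\<eta> ?x) 1)" using gseq_morph[of k "\<eta> ?x" 1] \<eta>m by simp
    show "Phi_op (Suc k) (\<kappa> (tower \<Gamma> m (Suc k))) = Phi_op (Suc k) (gseq k (\<eta> ?x) 1)"
      using eq Phi_shift[of k "\<eta> ?x"] \<eta>m by (simp del: gamma_seq.simps)
  qed
  then have at_tower: "conn \<Omega> (Suc k) ?x \<cdot>\<^bsub>?D\<^esub> far (step \<Delta> (Suc k)) (\<eta> ?x) =
      \<kappa> (fob (step \<Gamma> (Suc k)) ?x) \<cdot>\<^bsub>?D\<^esub> conn \<Lambda> (Suc k) ?x"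
    using \<eta>m[of ?x] by simp
  \<comment> \<open>Both sides are natural from \<open>\<Delta>_{k+1} \<Lambda>_k\<close> to
    \<open>\<Omega>_{k+1} \<Gamma>_{k+1}\<close>: each combines naturality of \<open>\<eta>\<close>
    or \<open>\<kappa>\<close> with that of one \<open>W\<close>.\<close>
  have "conn \<Omega> (Suc k) x \<cdot>\<^bsub>?D\<^esub> far (step \<Delta> (Suc k)) (\<eta> x) =
      \<kappa> (fob (step \<Gamma> (Suc k)) x) \<cdot>\<^bsub>?D\<^esub> conn \<Lambda> (Suc k) x" if x: "x \<in> Obj ?C" for x
  proof (rule FG.natural_eqI[OF Src.Dom.tower_generates[OF x] x Src.Dom.tower_obj,
        where p = "\<lambda>x. conn \<Omega> (Suc k) x \<cdot>\<^bsub>?D\<^esub> far (step \<Delta> (Suc k)) (\<eta> x)"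
          and q = "\<lambda>x. \<kappa> (fob (step \<Gamma> (Suc k)) x) \<cdot>\<^bsub>?D\<^esub> conn \<Lambda> (Suc k) x"])
    fix f assume f: "arr ?C f"
    let ?s = "src ?C f" and ?t = "tgt ?C f"
    have st: "?s \<in> Obj ?C" "?t \<in> Obj ?C" using f by simp_all
    note m = f \<eta>m[OF st(1)] \<eta>m[OF st(2)] \<kappa>m[of "fob (step \<Gamma> (Suc k)) ?s"] \<kappa>m[of "fob (step \<Gamma> (Suc k)) ?t"]
    have "conn \<Omega> (Suc k) ?t \<cdot>\<^bsub>?D\<^esub> far (step \<Delta> (Suc k)) (\<eta> ?t \<cdot>\<^bsub>cat \<Delta> k\<^esub> far (fun1 \<Lambda> k) f) =
        (conn \<Omega> (Suc k) ?t \<cdot>\<^bsub>?D\<^esub> far (step \<Delta> (Suc k)) (far (fun1 \<Omega> k) f)) \<cdot>\<^bsub>?D\<^esub> far (step \<Delta> (Suc k)) (\<eta> ?s)"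
      unfolding \<eta>n[OF f] using m by simp
    also have "\<dots> = far (fun1 \<Omega> (Suc k)) (far (step \<Gamma> (Suc k)) f) \<cdot>\<^bsub>?D\<^esub>
        (conn \<Omega> (Suc k) ?s \<cdot>\<^bsub>?D\<^esub> far (step \<Delta> (Suc k)) (\<eta> ?s))"
      unfolding Tgt.conn_natural[OF f] using m by simp
    finally show "(conn \<Omega> (Suc k) ?t \<cdot>\<^bsub>?D\<^esub> far (step \<Delta> (Suc k)) (\<eta> ?t)) \<cdot>\<^bsub>?D\<^esub> far ?F f =
        far ?G f \<cdot>\<^bsub>?D\<^esub> (conn \<Omega> (Suc k) ?s \<cdot>\<^bsub>?D\<^esub> far (step \<Delta> (Suc k)) (\<eta> ?s))"
      using m by (simp add: fcomp_def)
    have "\<kappa> (fob (step \<Gamma> (Suc k)) ?t) \<cdot>\<^bsub>?D\<^esub>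
        (conn \<Lambda> (Suc k) ?t \<cdot>\<^bsub>?D\<^esub> far (step \<Delta> (Suc k)) (far (fun1 \<Lambda> k) f)) =
        (\<kappa> (fob (step \<Gamma> (Suc k)) ?t) \<cdot>\<^bsub>?D\<^esub> far (fun1 \<Lambda> (Suc k)) (far (step \<Gamma> (Suc k)) f))
          \<cdot>\<^bsub>?D\<^esub> conn \<Lambda> (Suc k) ?s"
      unfolding Src.conn_natural[OF f] using m by simp
    also have "\<dots> = far (fun1 \<Omega> (Suc k)) (far (step \<Gamma> (Suc k)) f) \<cdot>\<^bsub>?D\<^esub>
        (\<kappa> (fob (step \<Gamma> (Suc k)) ?s) \<cdot>\<^bsub>?D\<^esub> conn \<Lambda> (Suc k) ?s)"
      using \<kappa>n[of "far (step \<Gamma> (Suc k)) f"] m by simp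
    finally show "(\<kappa> (fob (step \<Gamma> (Suc k)) ?t) \<cdot>\<^bsub>?D\<^esub> conn \<Lambda> (Suc k) ?t) \<cdot>\<^bsub>?D\<^esub> far ?F f =
        far ?G f \<cdot>\<^bsub>?D\<^esub> (\<kappa> (fob (step \<Gamma> (Suc k)) ?s) \<cdot>\<^bsub>?D\<^esub> conn \<Lambda> (Suc k) ?s)"
      using m by (simp add: fcomp_def)
  qed (use \<eta>m \<kappa>m at_tower in \<open>simp_all add: fcomp_def\<close>)
  then show ?thesis by (simp add: exchange_def)
qed

end

section \<open>The theorem for sums of simple objects\<close>

lemma generated_zero_cell_dsum:
  assumes "zero_cell \<Gamma>" "simple_reps (cat \<Gamma> 0) V" "is_dsum_set (cat \<Gamma> 0) V m"
  shows "generated_zero_cell \<Gamma> m"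
proof
  interpret finite_semisimple "cat \<Gamma> 0" using assms(1) by (simp add: zero_cell_def)
  show "m \<in> Obj (cat \<Gamma> 0)" using assms(3) by (auto simp: is_dsum_set_def is_dsum_def)
  show "generates (cat \<Gamma> 0) m x" if "x \<in> Obj (cat \<Gamma> 0)" for x
    by (rule dsum_generates[OF assms(2,3) that])
qed fact

text \<open>Existence of some \<open>l\<close> is asserted because \<open>LEAST\<close> has its
  intended meaning only then. The exchange relation is claimed for any \<open>\<eta>\<close>,
  \<open>\<kappa>\<close> that represent \<open>T\<close>; by uniqueness these are the
  transformations found at levels \<open>k\<close> and \<open>k + 1\<close>.\<close>

theorem theorem3p10:
  fixes \<Gamma> :: "('o, 'm) zcell" and \<Delta> :: "('p, 'n) zcell"
    and \<Lambda> \<Omega> :: "('o, 'm, 'p, 'n) ocell"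
    and V\<^sub>M :: "'o set" and V\<^sub>N :: "'p set" and m\<^sub>0 :: 'o and n\<^sub>0 :: 'p
  assumes "zero_cell \<Gamma>" and "zero_cell \<Delta>"
    and "one_cell \<Gamma> \<Delta> \<Lambda>" and "one_cell \<Gamma> \<Delta> \<Omega>"
    and "simple_reps (cat \<Gamma> 0) V\<^sub>M" and "is_dsum_set (cat \<Gamma> 0) V\<^sub>M m\<^sub>0"
    and "simple_reps (cat \<Delta> 0) V\<^sub>N" and "is_dsum_set (cat \<Delta> 0) V\<^sub>N n\<^sub>0"
  shows
    "(\<forall>c\<in>two_cells \<Gamma> \<Delta> \<Lambda> \<Omega>. \<forall>K \<eta>. truncated_rep \<Gamma> \<Delta> \<Lambda> \<Omega> c K \<eta> \<longrightarrow>
        (\<forall>k\<ge>K. Phi \<Gamma> \<Delta> m\<^sub>0 n\<^sub>0 \<Lambda> \<Omega> k (\<eta> k (tower \<Gamma> m\<^sub>0 k))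
                  \<in> corr_intertwiners \<Gamma> \<Delta> m\<^sub>0 n\<^sub>0 \<Lambda> \<Omega>) \<and>
        (\<forall>k\<ge>K. \<forall>l\<ge>K. Phi \<Gamma> \<Delta> m\<^sub>0 n\<^sub>0 \<Lambda> \<Omega> k (\<eta> k (tower \<Gamma> m\<^sub>0 k)) =
                          Phi \<Gamma> \<Delta> m\<^sub>0 n\<^sub>0 \<Lambda> \<Omega> l (\<eta> l (tower \<Gamma> m\<^sub>0 l)))) \<and>
     (\<forall>T\<in>corr_intertwiners \<Gamma> \<Delta> m\<^sub>0 n\<^sub>0 \<Lambda> \<Omega>.
        (\<exists>l. maps_level0_into \<Gamma> \<Delta> m\<^sub>0 n\<^sub>0 \<Lambda> \<Omega> T l) \<and>
        (let K\<^sub>T = (LEAST l. maps_level0_into \<Gamma> \<Delta> m\<^sub>0 n\<^sub>0 \<Lambda> \<Omega> T l) in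
          (\<forall>k\<ge>K\<^sub>T. \<exists>!\<eta>. \<eta> \<in> nt_space \<Gamma> \<Delta> \<Lambda> \<Omega> k \<and>
              T = Phi \<Gamma> \<Delta> m\<^sub>0 n\<^sub>0 \<Lambda> \<Omega> k (\<eta> (tower \<Gamma> m\<^sub>0 k))) \<and>
          (\<forall>k\<ge>K\<^sub>T. \<forall>\<eta>\<in>nt_space \<Gamma> \<Delta> \<Lambda> \<Omega> k. \<forall>\<kappa>\<in>nt_space \<Gamma> \<Delta> \<Lambda> \<Omega> (k + 1).
              T = Phi \<Gamma> \<Delta> m\<^sub>0 n\<^sub>0 \<Lambda> \<Omega> k (\<eta> (tower \<Gamma> m\<^sub>0 k)) \<longrightarrow>
              T = Phi \<Gamma> \<Delta> m\<^sub>0 n\<^sub>0 \<Lambda> \<Omega> (k + 1) (\<kappa> (tower \<Gamma> m\<^sub>0 (k + 1))) \<longrightarrow>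
              exchange \<Gamma> \<Delta> \<Lambda> \<Omega> k \<eta> \<kappa>)))"
proof -
  interpret one_cell_pair \<Gamma> \<Delta> m\<^sub>0 n\<^sub>0 \<Lambda> \<Omega>
    unfolding one_cell_pair_def generated_one_cell_def generated_one_cell_axioms_def
    using generated_zero_cell_dsum[OF assms(1,5,6)] generated_zero_cell_dsum[OF assms(2,7,8)]
      assms(3,4) by simp
  show ?thesis
  proof (intro conjI ballI allI impI)
    fix c K \<eta> assume c: "c \<in> two_cells \<Gamma> \<Delta> \<Lambda> \<Omega>" and rep: "truncated_rep \<Gamma> \<Delta> \<Lambda> \<Omega> c K \<eta>"
    have ex: "exchange \<Gamma> \<Delta> \<Lambda> \<Omega> k (\<eta> k) (\<eta> (k + 1))" if "k \<ge> K" for k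
      using rep that by (simp add: truncated_rep_def)
    have \<eta>: "\<eta> k \<in> nt_space \<Gamma> \<Delta> \<Lambda> \<Omega> k" if "k \<ge> K" for k
    proof -
      \<comment> \<open>A truncated representative agrees with a member of its class from
        \<open>K\<close> on, so its naturality is inherited at those levels.\<close>
      have "\<exists>\<theta>\<in>c. \<forall>k\<ge>K. \<theta> k = \<eta> k" using rep by (simp add: truncated_rep_def)
      then obtain \<theta> where \<theta>: "\<theta> \<in> c" "\<forall>k\<ge>K. \<theta> k = \<eta> k" by (rule bexE)
      have "\<theta> \<in> two_cell_seqs \<Gamma> \<Delta> \<Lambda> \<Omega>"
        using c \<theta>(1) by (auto simp: two_cells_def elim!: quotientE)
      then have "\<theta> k \<in> nt_space \<Gamma> \<Delta> \<Lambda> \<Omega> k" by (simp add: two_cell_seqs_def)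
      with \<theta>(2) that show ?thesis by simp
    qed
    show "Phi_op k (\<eta> k (tower \<Gamma> m\<^sub>0 k)) \<in> corr_intertwiners \<Gamma> \<Delta> m\<^sub>0 n\<^sub>0 \<Lambda> \<Omega>" if "k \<ge> K" for k
      using two_cell_intertwiner[OF \<eta> ex that] .
    show "Phi_op k (\<eta> k (tower \<Gamma> m\<^sub>0 k)) = Phi_op l (\<eta> l (tower \<Gamma> m\<^sub>0 l))"
      if "k \<ge> K" "l \<ge> K" for k l
      using two_cell_independent[OF \<eta> ex that(1)] two_cell_independent[OF \<eta> ex that(2)] by simp
  next
    fix T assume T: "T \<in> corr_intertwiners \<Gamma> \<Delta> m\<^sub>0 n\<^sub>0 \<Lambda> \<Omega>"
    show bounded: "\<exists>l. maps_level0_into \<Gamma> \<Delta> m\<^sub>0 n\<^sub>0 \<Lambda> \<Omega> T l"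
      by (rule intertwiner_bounded[OF T])
    show "let K\<^sub>T = LEAST l. maps_level0_into \<Gamma> \<Delta> m\<^sub>0 n\<^sub>0 \<Lambda> \<Omega> T l in
          (\<forall>k\<ge>K\<^sub>T. \<exists>!\<eta>. \<eta> \<in> nt_space \<Gamma> \<Delta> \<Lambda> \<Omega> k \<and> T = Phi_op k (\<eta> (tower \<Gamma> m\<^sub>0 k))) \<and>
          (\<forall>k\<ge>K\<^sub>T. \<forall>\<eta>\<in>nt_space \<Gamma> \<Delta> \<Lambda> \<Omega> k. \<forall>\<kappa>\<in>nt_space \<Gamma> \<Delta> \<Lambda> \<Omega> (k + 1).
              T = Phi_op k (\<eta> (tower \<Gamma> m\<^sub>0 k)) \<longrightarrow>
              T = Phi_op (k + 1) (\<kappa> (tower \<Gamma> m\<^sub>0 (k + 1))) \<longrightarrow>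
              exchange \<Gamma> \<Delta> \<Lambda> \<Omega> k \<eta> \<kappa>)"
      unfolding Let_def
    proof (intro conjI allI ballI impI)
      fix k assume "(LEAST l. maps_level0_into \<Gamma> \<Delta> m\<^sub>0 n\<^sub>0 \<Lambda> \<Omega> T l) \<le> k"
      \<comment> \<open>\<open>K_T\<close> itself has the property because some level does, and all
        higher levels inherit it by monotonicity.\<close>
      then have "maps_level0_into \<Gamma> \<Delta> m\<^sub>0 n\<^sub>0 \<Lambda> \<Omega> T k"
        using maps_level0_into_mono LeastI_ex[OF bounded] by blast
      from intertwiner_unique_NT[OF T this]
      show "\<exists>!\<eta>. \<eta> \<in> nt_space \<Gamma> \<Delta> \<Lambda> \<Omega> k \<and> T = Phi_op k (\<eta> (tower \<Gamma> m\<^sub>0 k))" .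
    next
      fix k \<eta> \<kappa>
      assume "\<eta> \<in> nt_space \<Gamma> \<Delta> \<Lambda> \<Omega> k" "\<kappa> \<in> nt_space \<Gamma> \<Delta> \<Lambda> \<Omega> (k + 1)"
        "T = Phi_op k (\<eta> (tower \<Gamma> m\<^sub>0 k))" "T = Phi_op (k + 1) (\<kappa> (tower \<Gamma> m\<^sub>0 (k + 1)))"
      then show "exchange \<Gamma> \<Delta> \<Lambda> \<Omega> k \<eta> \<kappa>"
        using Phi_eq_exchange[of \<eta> k \<kappa>] by (simp del: tower.simps)
    qed
  qed
qed

end
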